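(* For all integers $n\ge 2$ the Dirichlet eigenvalues $\lambda_k$ of the hemisphere $\mathbb{S}^n_+$ satisfy, for all $k\ge 1$, $$\lambda_k(\mathbb{S}^n_+)\ \le\ C_{W,n}(\mathbb{S}^n_+)\,(k-1)^{2/n}+2\sqrt{C_{W,n}(\mathbb{S}^n_+)}\,(k-1)^{1/n}+n,$$ with equality at $k=1$. Furthermore, $$\frac{\lambda_k(\mathbb{S}^n_+)-C_{W,n}(\mathbb{S}^n_+)\,(k-1)^{2/n}}{2\sqrt{C_{W,n}(\mathbb{S}^n_+)}\,(k-1)^{1/n}}\ \longrightarrow\ 1$$ along the subsequence $k=k_-(K)$, $K\to\infty$, of lowest order eigenvalues of each chain.
   Context: $\mathbb{S}^n_+=\{x\in\mathbb{R}^{n+1}:\|x\|=1,\ x_{n+1}>0\}$ is the unit hemisphere with the round metric. Its Dirichlet eigenvalues ($\Delta u+\lambda u=0$ in $\mathbb{S}^n_+$, $u=0$ on the boundary), repeated according to multiplicity, are $0<\lambda_1\le\lambda_2\le\dots$. The Weyl constant of an $n$-dimensional manifold $M$ is $C_{W,n}(M)=4\pi^2/(\omega_n|M|)^{2/n}$, where $\omega_n$ is the volume of the unit ball in $\mathbb{R}^n$ and $|M|$ the volume of $M$; for the hemisphere $C_{W,n}(\mathbb{S}^n_+)=(n!)^{2/n}$. Known facts and notation: the distinct Dirichlet eigenvalues of $\mathbb{S}^n_+$ in increasing order are $\overline{\lambda}_K=K(K+n-1)$, $K=1,2,\dots$, with multiplicity $m(K)=\binom{n+K-2}{n-1}$.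 The $K$-chain is the set of eigenvalues $\lambda_k$ with $k_-(K)\le k\le k_+(K)$, all equal to $\overline{\lambda}_K$, where $k_-(K)=1+\sum_{i=1}^{K-1}m(i)$ and $k_+(K)=\sum_{i=1}^{K}m(i)$. The eigenvalues $\lambda_{k_-(K)}$ and $\lambda_{k_+(K)}$ are called the eigenvalues of lowest and highest order of the $K$-chain. *)

theory Defs
  imports "HOL-Analysis.Analysis" "HOL-Library.Function_Algebras"
begin

text \<open>
  The ambient space \<open>\<real>\<^sup>n\<^sup>+\<^sup>1\<close> is the type \<open>(real ^ 'n) \<times> real\<close> with \<open>n = CARD('n)\<close>: its inner product and
  norm are the Euclidean ones, and the second component is the coordinate \<open>x\<^sub>n\<^sub>+\<^sub>1\<close>.
\<close>

definition hemisphere :: "((real ^ 'n) \<times> real) set" where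
  "hemisphere = {x. norm x = 1 \<and> snd x > 0}"

definition partial_deriv ::
  "'a::euclidean_space \<Rightarrow> ('a \<Rightarrow> real) \<Rightarrow> 'a \<Rightarrow> real" where
  "partial_deriv b f x = frechet_derivative f (at x) b"

text \<open>For open \<open>S\<close> the following is the usual class \<open>C\<^sup>2(S)\<close>.\<close>

definition C2_on :: "('a::euclidean_space \<Rightarrow> real) \<Rightarrow> 'a set \<Rightarrow> bool" where
  "C2_on f S \<longleftrightarrow>
     (\<forall>x\<in>S. f differentiable (at x)) \<and>
     (\<forall>b\<in>Basis. \<forall>x\<in>S. partial_deriv b f differentiable (at x)) \<and>
     (\<forall>b\<in>Basis. \<forall>c\<in>Basis. continuous_on S (partial_deriv c (partial_deriv b f)))"

definition laplacian :: "('a::euclidean_space \<Rightarrow> real) \<Rightarrow> 'a \<Rightarrow> real" where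
  "laplacian f x = (\<Sum>b\<in>Basis. partial_deriv b (partial_deriv b f) x)"

text \<open>
  The Laplace--Beltrami operator of the round metric is the Euclidean Laplacian of the extension that
  is constant along rays; a function is \<open>C\<^sup>2\<close> on an open part of the sphere iff this extension is \<open>C\<^sup>2\<close>
  on the open cone over it.
\<close>

definition radial_ext :: "('a::euclidean_space \<Rightarrow> real) \<Rightarrow> 'a \<Rightarrow> real" where
  "radial_ext u x = u (x /\<^sub>R norm x)"

definition sphere_laplacian :: "('a::euclidean_space \<Rightarrow> real) \<Rightarrow> 'a \<Rightarrow> real" where
  "sphere_laplacian u x = laplacian (radial_ext u) x"

text \<open>
  Classical solutions of the Dirichlet problem.  A function on the closed hemisphere vanishing on
  its boundary is represented by its extension by zero to the whole space; this makes the
  representation unique, so that linear algebra in the function space gives the right dimensions.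
  The open cone over the hemisphere is the upper half-space.
\<close>

definition dirichlet_eigenspace :: "real \<Rightarrow> ((real ^ 'n) \<times> real \<Rightarrow> real) set" where
  "dirichlet_eigenspace \<mu> =
     {u. (\<forall>x. x \<notin> hemisphere \<longrightarrow> u x = 0) \<and>
         continuous_on (closure hemisphere) u \<and>
         C2_on (radial_ext u) {x. snd x > 0} \<and>
         (\<forall>x\<in>hemisphere. sphere_laplacian u x + \<mu> * u x = 0)}"

interpretation fun_space: vector_space "\<lambda>(c::real) (f::'a \<Rightarrow> real) x. c * f x"
  by unfold_locales (auto simp: fun_eq_iff algebra_simps)

definition dirichlet_eigenvalues :: "'n::finite itself \<Rightarrow> real set" where
  "dirichlet_eigenvalues _ =
     {\<mu>. \<exists>u \<in> (dirichlet_eigenspace \<mu> :: ((real ^ 'n) \<times> real \<Rightarrow> real) set). u \<noteq> (\<lambda>x. 0)}"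

definition eigenvalue_mult :: "'n::finite itself \<Rightarrow> real \<Rightarrow> nat" where
  "eigenvalue_mult _ \<mu> =
     fun_space.dim (dirichlet_eigenspace \<mu> :: ((real ^ 'n) \<times> real \<Rightarrow> real) set)"

definition eigenvalue_count :: "'n::finite itself \<Rightarrow> real \<Rightarrow> nat" where
  "eigenvalue_count N \<mu> = (\<Sum>\<nu> \<in> {\<nu> \<in> dirichlet_eigenvalues N. \<nu> \<le> \<mu>}. eigenvalue_mult N \<nu>)"

text \<open>
  The \<open>k\<close>-th entry (\<open>k \<ge> 1\<close>) of the nondecreasing list of eigenvalues repeated according to
  multiplicity is the least \<open>\<mu>\<close> up to which at least \<open>k\<close> eigenvalues occur.
\<close>

definition hemi_eigenvalue :: "'n::finite itself \<Rightarrow> nat \<Rightarrow> real" where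
  "hemi_eigenvalue N k = (LEAST \<mu>. k \<le> eigenvalue_count N \<mu>)"

text \<open>
  The surface measure on the unit sphere of a \<open>d\<close>-dimensional space: \<open>d\<close> times the Lebesgue
  measure of the cone over the set.
\<close>

definition sphere_volume :: "'a::euclidean_space set \<Rightarrow> real" where
  "sphere_volume A =
     real DIM('a) * measure lebesgue {r *\<^sub>R x | r x. 0 \<le> r \<and> r \<le> 1 \<and> x \<in> A}"

definition weyl_const :: "nat \<Rightarrow> real \<Rightarrow> real" where
  "weyl_const n vol = 4 * pi ^ 2 / (unit_ball_vol (real n) * vol) powr (2 / real n)"

definition hemi_weyl_const :: "'n::finite itself \<Rightarrow> real" where
  "hemi_weyl_const _ = weyl_const CARD('n) (sphere_volume (hemisphere :: ((real ^ 'n) \<times> real) set))"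

definition chain_mult :: "nat \<Rightarrow> nat \<Rightarrow> nat" where
  "chain_mult n K = (n + K - 2) choose (n - 1)"

definition k_minus :: "nat \<Rightarrow> nat \<Rightarrow> nat" where
  "k_minus n K = 1 + (\<Sum>i = 1..<K. chain_mult n i)"

end

theory Submission
  imports Defs "HOL-Real_Asymp.Real_Asymp"
begin

text \<open>
  The spectrum is determined without integration. For an eigenfunction \<open>u\<close> with eigenvalue \<open>\<mu> > 0\<close>
  let \<open>\<alpha> > 0\<close> solve \<open>\<alpha>(\<alpha> + n - 1) = \<mu>\<close>. Then \<open>h(x) = |x|\<^sup>\<alpha> u(x/|x|)\<close> is harmonic in the upper half-space and
  vanishes on its boundary. By Stone--Weierstrass, Fischer's solution of the Dirichlet problem for polynomial
  data on the ball and the maximum principle, the odd reflection of \<open>h\<close> is on the unit ball a uniform limit of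
  harmonic polynomials. Bernstein's gradient estimate makes their Taylor coefficients at \<open>0\<close> converge with
  uniform remainder bounds, which is compatible with homogeneity of degree \<open>\<alpha>\<close> only if \<open>\<alpha>\<close> is an integer \<open>K\<close>
  and \<open>h\<close> is a homogeneous harmonic polynomial. For \<open>\<mu> \<le> 0\<close> the maximum principle excludes eigenfunctions.
  The eigenspace of \<open>K\<close> is parametrised by the normal derivative on the equator, an arbitrary homogeneous
  polynomial of degree \<open>K - 1\<close> in \<open>n\<close> variables.

  With \<open>k = k\<^sub>-(K)\<close> and \<open>m = K - 1\<close> one has \<open>n!(k - 1) = m(m + 1)\<dots>(m + n - 1) = y\<^sup>n\<close>, and both claims follow from
  \<open>m(m + n - 1) \<le> y\<^sup>2 \<le> (m + (n - 1)/2)\<^sup>2\<close>, obtained by pairing the \<open>i\<close>-th factor with the \<open>i\<close>-th last.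
\<close>

section \<open>Partial derivatives and the Laplacian\<close>

text \<open>Eigenfunctions are assumed C^2 only inside the hemisphere and merely continuous up to
  the equator, so neither integration by parts nor a reflection principle applies to them directly.
  Approximation replaces both: comparison with harmonic polynomials takes place in the maximum norm,
  by the maximum principle on a half ball, and smoothness across the equator is an outcome. Maximum
  norm control is enough because every derivative of a harmonic polynomial at the origin is bounded
  by its maximum on the unit ball, with a constant independent of the polynomial and its degree. For
  the numerical part, put y = (n! (k - 1))^(1/n). As the Weyl constant is (n!)^(2/n), the claim
  reads lambda_k \<le> y^2 + 2 y + n. The right side grows with k while lambda_k is constant on a
  chain, so the lowest order decides. There lambda_k = (m + 1) (m + n) = m (m + n - 1) + 2 m + n,
  and the three summands are compared with y^2, 2 y and n. For the limit, lambda_k - y^2 lies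
  between 2 m + const and 2 m + n, while y - m stays bounded.\<close>

lemma partial_deriv_eq: "(f has_derivative f') (at x) \<Longrightarrow> partial_deriv b f x = f' b"
  unfolding partial_deriv_def by (metis frechet_derivative_at)

lemma has_derivative_partial:
  assumes "f differentiable at x"
  shows "(f has_derivative (\<lambda>v. partial_deriv v f x)) (at x)"
  using assms unfolding partial_deriv_def by (simp add: frechet_derivative_works)

text \<open>\<open>frechet_derivative\<close> is a choice from the derivative relation. Functions
  that agree near x have the same relation, hence the same chosen value, even where neither is
  differentiable.\<close>

lemma partial_deriv_cong:
  assumes "open S" "x \<in> S" "\<And>y. y \<in> S \<Longrightarrow> f y = g y"
  shows "partial_deriv b f x = partial_deriv b g x"
proof -
  have "(f has_derivative D) (at x) = (g has_derivative D) (at x)" for D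
    using has_derivative_transform_within_open[OF _ assms(1,2)] assms(3) by (metis (no_types, lifting))
  then show ?thesis unfolding partial_deriv_def frechet_derivative_def by simp
qed

lemma differentiable_cong_open:
  assumes "open S" "x \<in> S" "\<And>y. y \<in> S \<Longrightarrow> f y = g y" "f differentiable at x"
  shows "g differentiable at x"
  using assms has_derivative_transform_within_open[OF _ assms(1,2)] unfolding differentiable_def by metis

lemma partial_deriv_const [simp]: "partial_deriv b (\<lambda>x. c) x = 0"
  by (rule partial_deriv_eq) (rule has_derivative_const)

lemma partial_deriv_add:
  assumes "f differentiable at x" "g differentiable at x"
  shows "partial_deriv b (\<lambda>x. f x + g x) x = partial_deriv b f x + partial_deriv b g x"
  using has_derivative_add[OF assms[THEN has_derivative_partial]] by (rule partial_deriv_eq)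

lemma partial_deriv_mult:
  assumes "f differentiable at x" "g differentiable at x"
  shows "partial_deriv b (\<lambda>x. f x * g x) x = f x * partial_deriv b g x + partial_deriv b f x * g x"
  using has_derivative_mult[OF assms[THEN has_derivative_partial]] by (rule partial_deriv_eq)

lemma partial_deriv_cmult:
  assumes "f differentiable at x"
  shows "partial_deriv b (\<lambda>x. c * f x) x = c * partial_deriv b f x"
  using has_derivative_mult_right[OF has_derivative_partial[OF assms]] by (rule partial_deriv_eq)

lemma partial_deriv_sum:
  assumes "\<And>i. i \<in> I \<Longrightarrow> f i differentiable at x"
  shows "partial_deriv b (\<lambda>x. \<Sum>i\<in>I. f i x) x = (\<Sum>i\<in>I. partial_deriv b (f i) x)"
  by (rule partial_deriv_eq) (rule has_derivative_sum, rule has_derivative_partial, rule assms)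

text \<open>The direction in \<open>partial_deriv\<close> may be any vector; v = x later gives the
  radial derivative behind Euler's identity.\<close>

lemma partial_deriv_direction:
  assumes "f differentiable at x"
  shows "partial_deriv v f x = (\<Sum>b\<in>Basis. (v \<bullet> b) * partial_deriv b f x)"
proof -
  have l: "linear (frechet_derivative f (at x))" by (rule linear_frechet_derivative[OF assms])
  have "partial_deriv v f x = frechet_derivative f (at x) (\<Sum>b\<in>Basis. (v \<bullet> b) *\<^sub>R b)"
    by (simp add: partial_deriv_def euclidean_representation)
  also have "\<dots> = (\<Sum>b\<in>Basis. (v \<bullet> b) * partial_deriv b f x)"
    by (simp add: linear_sum[OF l] linear_cmul[OF l] partial_deriv_def)
  finally show ?thesis .
qed

lemma partial_deriv_along:
  assumes "f differentiable at (a + t *\<^sub>R v)"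
  shows "((\<lambda>t. f (a + t *\<^sub>R v)) has_real_derivative partial_deriv v f (a + t *\<^sub>R v)) (at t)"
proof -
  let ?D = "frechet_derivative f (at (a + t *\<^sub>R v))"
  have l: "linear ?D" by (rule linear_frechet_derivative[OF assms])
  have "((\<lambda>t. f (a + t *\<^sub>R v)) has_derivative (\<lambda>s. ?D (s *\<^sub>R v))) (at t)"
    by (rule has_derivative_compose[where g=f])
       (use assms in \<open>auto simp: frechet_derivative_works intro!: derivative_eq_intros\<close>)
  then show ?thesis
    by (simp add: has_field_derivative_def partial_deriv_def linear_cmul[OF l] mult_commute_abs)
qed

lemma partial_deriv_scale:
  assumes "f differentiable at (c *\<^sub>R x)"
  shows "partial_deriv b (\<lambda>y. f (c *\<^sub>R y)) x = c * partial_deriv b f (c *\<^sub>R x)"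
    and "(\<lambda>y. f (c *\<^sub>R y)) differentiable at x"
proof -
  let ?D = "frechet_derivative f (at (c *\<^sub>R x))"
  have l: "linear ?D" by (rule linear_frechet_derivative[OF assms])
  have D: "((\<lambda>y. f (c *\<^sub>R y)) has_derivative (\<lambda>s. ?D (c *\<^sub>R s))) (at x)"
    by (rule has_derivative_compose[where g=f])
       (use assms in \<open>auto simp: frechet_derivative_works intro!: derivative_eq_intros\<close>)
  show "partial_deriv b (\<lambda>y. f (c *\<^sub>R y)) x = c * partial_deriv b f (c *\<^sub>R x)"
    using partial_deriv_eq[OF D, of b] by (simp add: partial_deriv_def linear_cmul[OF l])
  show "(\<lambda>y. f (c *\<^sub>R y)) differentiable at x" using D by (rule differentiableI)
qed

lemma C2_on_D:
  assumes "C2_on f S"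
  shows "x \<in> S \<Longrightarrow> f differentiable at x"
    and "x \<in> S \<Longrightarrow> b \<in> Basis \<Longrightarrow> partial_deriv b f differentiable at x"
    and "b \<in> Basis \<Longrightarrow> c \<in> Basis \<Longrightarrow> continuous_on S (partial_deriv c (partial_deriv b f))"
  using assms unfolding C2_on_def by auto

lemma C2_on_subset: "C2_on f S \<Longrightarrow> T \<subseteq> S \<Longrightarrow> C2_on f T"
  unfolding C2_on_def by (meson continuous_on_subset subsetD)

lemma C2_on_cont: "C2_on f S \<Longrightarrow> continuous_on S f"
  by (simp add: C2_on_D(1) continuous_at_imp_continuous_on differentiable_imp_continuous_within)

lemma C2_on_cont1: "C2_on f S \<Longrightarrow> b \<in> Basis \<Longrightarrow> continuous_on S (partial_deriv b f)"
  by (simp add: C2_on_D(2) continuous_at_imp_continuous_on differentiable_imp_continuous_within)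

text \<open>On an open set the second partial derivatives depend only on the first ones there, so
  explicit formulas \<open>df\<close> and \<open>ddf\<close> valid on \<open>S\<close> suffice,
  whatever the functions do elsewhere.\<close>

lemma C2_onI_open:
  assumes "open S" "\<And>x. x \<in> S \<Longrightarrow> f differentiable at x"
    and "\<And>b x. b \<in> Basis \<Longrightarrow> x \<in> S \<Longrightarrow> partial_deriv b f x = df b x"
    and "\<And>b x. b \<in> Basis \<Longrightarrow> x \<in> S \<Longrightarrow> df b differentiable at x"
    and "\<And>b c x. b \<in> Basis \<Longrightarrow> c \<in> Basis \<Longrightarrow> x \<in> S \<Longrightarrow> partial_deriv c (df b) x = ddf b c x"
    and "\<And>b c. b \<in> Basis \<Longrightarrow> c \<in> Basis \<Longrightarrow> continuous_on S (ddf b c)"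
  shows "C2_on f S"
    and "\<And>b c x. b \<in> Basis \<Longrightarrow> c \<in> Basis \<Longrightarrow> x \<in> S \<Longrightarrow> partial_deriv c (partial_deriv b f) x = ddf b c x"
    and "\<And>x. x \<in> S \<Longrightarrow> laplacian f x = (\<Sum>b\<in>Basis. ddf b b x)"
proof -
  show 2: "partial_deriv c (partial_deriv b f) x = ddf b c x" if "b \<in> Basis" "c \<in> Basis" "x \<in> S" for b c x
    using partial_deriv_cong[OF assms(1) that(3), of "partial_deriv b f" "df b"] assms(3,5) that by auto
  show "C2_on f S" unfolding C2_on_def
  proof (intro conjI ballI)
    fix b x :: 'a assume "b \<in> Basis" "x \<in> S"
    then show "partial_deriv b f differentiable at x"
      using differentiable_cong_open[OF assms(1), of x "df b" "partial_deriv b f"] assms(3,4) by auto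
  next
    fix b c :: 'a assume "b \<in> Basis" "c \<in> Basis"
    then show "continuous_on S (partial_deriv c (partial_deriv b f))"
      using continuous_on_cong[OF refl, of S "partial_deriv c (partial_deriv b f)" "ddf b c"] 2 assms(6) by auto
  qed (use assms in auto)
  show "laplacian f x = (\<Sum>b\<in>Basis. ddf b b x)" if "x \<in> S" for x
    unfolding laplacian_def using 2 that by (intro sum.cong) auto
qed

lemma C2_on_cong:
  assumes S: "open S" and eq: "\<And>x. x \<in> S \<Longrightarrow> f x = g x"
  shows "C2_on f S \<longleftrightarrow> C2_on g S"
proof -
  have *: "C2_on g S" if "C2_on f S" "\<And>x. x \<in> S \<Longrightarrow> f x = g x" for f g :: "'a \<Rightarrow> real"
    apply (rule C2_onI_open(1)[OF S, where df="\<lambda>b. partial_deriv b f" and ddf="\<lambda>b c. partial_deriv c (partial_deriv b f)"])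
    using C2_on_D[OF that(1)] partial_deriv_cong[OF S, of _ g f] differentiable_cong_open[OF S, of _ f g] that(2)
    by auto
  show ?thesis using *[of f g] *[of g f] eq by auto
qed

lemma laplacian_cong:
  assumes S: "open S" "x \<in> S" and eq: "\<And>x. x \<in> S \<Longrightarrow> f x = g x"
  shows "laplacian f x = laplacian g x"
  unfolding laplacian_def
  by (intro sum.cong refl partial_deriv_cong[OF S] partial_deriv_cong[OF S(1)] eq)

lemma C2_on_add:
  assumes S: "open S" and f: "C2_on f S" and g: "C2_on g S"
  shows "C2_on (\<lambda>x. f x + g x) S"
    and "\<And>x. x \<in> S \<Longrightarrow> laplacian (\<lambda>x. f x + g x) x = laplacian f x + laplacian g x"
proof -
  note * = C2_onI_open[OF S, where df="\<lambda>b x. partial_deriv b f x + partial_deriv b g x"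
       and ddf="\<lambda>b c x. partial_deriv c (partial_deriv b f) x + partial_deriv c (partial_deriv b g) x"
       and f="\<lambda>x. f x + g x"]
  show "C2_on (\<lambda>x. f x + g x) S"
    by (rule *) (auto intro!: differentiable_add C2_on_D[OF f] C2_on_D[OF g] partial_deriv_add continuous_intros)
  show "laplacian (\<lambda>x. f x + g x) x = laplacian f x + laplacian g x" if "x \<in> S" for x
    unfolding laplacian_def sum.distrib[symmetric]
    by (rule *(3)[unfolded laplacian_def, OF _ _ _ _ _ that])
       (auto intro!: differentiable_add C2_on_D[OF f] C2_on_D[OF g] partial_deriv_add continuous_intros)
qed

lemma C2_on_mult:
  assumes S: "open S" and f: "C2_on f S" and g: "C2_on g S"
  shows "C2_on (\<lambda>x. f x * g x) S"
    and "\<And>x. x \<in> S \<Longrightarrow> laplacian (\<lambda>x. f x * g x) x =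
      f x * laplacian g x + laplacian f x * g x + 2 * (\<Sum>b\<in>Basis. partial_deriv b f x * partial_deriv b g x)"
proof -
  define f1 where "f1 b x = f x * partial_deriv b g x + partial_deriv b f x * g x" for b x
  define f2 where "f2 b c x = (f x * partial_deriv c (partial_deriv b g) x + partial_deriv c f x * partial_deriv b g x)
     + (partial_deriv b f x * partial_deriv c g x + partial_deriv c (partial_deriv b f) x * g x)" for b c x
  note D = C2_on_D(1,2)[OF f] C2_on_D(1,2)[OF g]
  have f2: "partial_deriv c (f1 b) x = f2 b c x" if "b \<in> Basis" "c \<in> Basis" "x \<in> S" for b c x
    unfolding f1_def f2_def using D that
    by (simp add: partial_deriv_add partial_deriv_mult differentiable_mult)
  have c2: "continuous_on S (f2 b c)" if "b \<in> Basis" "c \<in> Basis" for b c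
    unfolding f2_def using C2_on_D(3)[OF f] C2_on_D(3)[OF g] C2_on_cont[OF f] C2_on_cont[OF g]
      C2_on_cont1[OF f] C2_on_cont1[OF g] that by (intro continuous_intros) auto
  have prems: "\<And>x. x \<in> S \<Longrightarrow> (\<lambda>x. f x * g x) differentiable at x"
     "\<And>b x. b \<in> Basis \<Longrightarrow> x \<in> S \<Longrightarrow> partial_deriv b (\<lambda>x. f x * g x) x = f1 b x"
     "\<And>b x. b \<in> Basis \<Longrightarrow> x \<in> S \<Longrightarrow> f1 b differentiable at x"
    using D by (auto simp: f1_def[abs_def] partial_deriv_mult intro!: differentiable_mult differentiable_add)
  show "C2_on (\<lambda>x. f x * g x) S"
    by (rule C2_onI_open(1)[OF S, where df=f1 and ddf=f2]) (auto simp: prems f2 c2)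
  have laplacian: "laplacian (\<lambda>x. f x * g x) x = (\<Sum>b\<in>Basis. f2 b b x)" if "x \<in> S" for x
    by (rule C2_onI_open(3)[where S=S and df=f1 and ddf=f2, OF S _ _ _ _ _ that]) (auto simp: prems f2 c2)
  show "laplacian (\<lambda>x. f x * g x) x =
      f x * laplacian g x + laplacian f x * g x + 2 * (\<Sum>b\<in>Basis. partial_deriv b f x * partial_deriv b g x)"
    if "x \<in> S" for x
  proof -
    have e: "f2 b b x = f x * partial_deriv b (partial_deriv b g) x + partial_deriv b (partial_deriv b f) x * g x
        + 2 * (partial_deriv b f x * partial_deriv b g x)" for b
      by (simp add: f2_def)
    show ?thesis using that
      by (simp add: laplacian e sum.distrib) (simp add: laplacian_def sum_distrib_left sum_distrib_right)
  qed
qed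

lemma C2_on_const: "C2_on (\<lambda>x. c) S"
  unfolding C2_on_def by (simp add: partial_deriv_const[abs_def])

lemma laplacian_const: "laplacian (\<lambda>x. c) x = 0"
  by (simp add: laplacian_def partial_deriv_const[abs_def])

lemma C2_on_cmult:
  assumes S: "open S" and f: "C2_on f S"
  shows "C2_on (\<lambda>x. c * f x) S" and "\<And>x. x \<in> S \<Longrightarrow> laplacian (\<lambda>x. c * f x) x = c * laplacian f x"
  using C2_on_mult[OF S C2_on_const f] by (auto simp: laplacian_const)

lemma C2_on_diff:
  assumes S: "open S" and f: "C2_on f S" and g: "C2_on g S"
  shows "C2_on (\<lambda>x. f x - g x) S"
    and "\<And>x. x \<in> S \<Longrightarrow> laplacian (\<lambda>x. f x - g x) x = laplacian f x - laplacian g x"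
  using C2_on_add[OF S f C2_on_cmult(1)[OF S g, of "-1"]] C2_on_cmult(2)[OF S g, of _ "-1"] by auto

section \<open>Powers of the norm\<close>

lemma partial_deriv_norm_power:
  fixes x :: "'a::euclidean_space"
  assumes "x \<noteq> 0"
  shows "(\<lambda>x. (x \<bullet> x) powr \<beta>) differentiable at x"
    and "partial_deriv b (\<lambda>x. (x \<bullet> x) powr \<beta>) x = 2 * \<beta> * (x \<bullet> b) * (x \<bullet> x) powr (\<beta> - 1)"
proof -
  have p: "x \<bullet> x > 0" using assms by simp
  have "((\<lambda>x. (x \<bullet> x) powr \<beta>) has_derivative (\<lambda>h. 2 * \<beta> * (x \<bullet> h) * (x \<bullet> x) powr (\<beta> - 1))) (at x)"
    using p by (auto intro!: derivative_eq_intros simp: inner_commute powr_diff field_simps)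
  then show "(\<lambda>x. (x \<bullet> x) powr \<beta>) differentiable at x"
    "partial_deriv b (\<lambda>x. (x \<bullet> x) powr \<beta>) x = 2 * \<beta> * (x \<bullet> b) * (x \<bullet> x) powr (\<beta> - 1)"
    by (auto simp: differentiableI partial_deriv_eq)
qed

lemma partial_deriv_inner [simp]: "partial_deriv c (\<lambda>x. x \<bullet> b) x = c \<bullet> b"
  by (rule partial_deriv_eq) (auto intro!: derivative_eq_intros)

text \<open>The exponent \<beta> is half the degree of homogeneity. These powers convert an
  extension of one degree of homogeneity into another, between eigenfunctions and harmonic
  functions.\<close>

lemma norm_power_laplacian:
  fixes x :: "'a::euclidean_space"
  shows "C2_on (\<lambda>x::'a. (x \<bullet> x) powr \<beta>) (-{0})"
    and "x \<noteq> 0 \<Longrightarrow> laplacian (\<lambda>x. (x \<bullet> x) powr \<beta>) x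
           = 2 * \<beta> * (real DIM('a) + 2 * \<beta> - 2) * (x \<bullet> x) powr (\<beta> - 1)"
proof -
  have S: "open (-{0::'a})" by auto
  define f1 where "f1 b x = 2 * \<beta> * ((x \<bullet> b) * (x \<bullet> x) powr (\<beta> - 1))" for b x :: 'a
  define f2 where "f2 b c x = 2 * \<beta> * ((x \<bullet> b) * (2 * (\<beta> - 1) * (x \<bullet> c) * (x \<bullet> x) powr (\<beta> - 2)) + (c \<bullet> b) * (x \<bullet> x) powr (\<beta> - 1))" for b c x :: 'a
  have d: "(\<lambda>x. (x \<bullet> b) * (x \<bullet> x) powr (\<beta> - 1)) differentiable at x" if "x \<noteq> 0" for b x :: 'a
    using that by (intro differentiable_mult partial_deriv_norm_power) auto
  have f2: "partial_deriv c (f1 b) x = f2 b c x" if "x \<noteq> 0" for b c x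
    unfolding f1_def f2_def using that
    by (simp add: partial_deriv_cmult d partial_deriv_mult partial_deriv_norm_power)
  have prems: "\<And>x::'a. x \<in> -{0} \<Longrightarrow> (\<lambda>x. (x \<bullet> x) powr \<beta>) differentiable at x"
     "\<And>b x::'a. b \<in> Basis \<Longrightarrow> x \<in> -{0} \<Longrightarrow> partial_deriv b (\<lambda>x. (x \<bullet> x) powr \<beta>) x = f1 b x"
     "\<And>b x. b \<in> Basis \<Longrightarrow> x \<in> -{0} \<Longrightarrow> f1 b differentiable at x"
     "\<And>b c x. b \<in> Basis \<Longrightarrow> c \<in> Basis \<Longrightarrow> x \<in> -{0} \<Longrightarrow> partial_deriv c (f1 b) x = f2 b c x"
    subgoal by (rule partial_deriv_norm_power(1)) simp
    subgoal by (simp add: partial_deriv_norm_power(2) f1_def)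
    subgoal using d by (auto simp: f1_def[abs_def])
    subgoal using f2 by simp
    done
  have cont: "continuous_on (-{0}) (f2 b c)" for b c
    unfolding f2_def by (intro continuous_intros) auto
  show "C2_on (\<lambda>x::'a. (x \<bullet> x) powr \<beta>) (-{0})" by (rule C2_onI_open(1)[OF S, where df=f1 and ddf=f2]) (simp_all add: prems cont)
  assume x: "x \<noteq> 0"
  then have x': "x \<in> -{0}" by simp
  from x have "x \<bullet> x > 0" by simp
  then have e: "(x \<bullet> x) * (x \<bullet> x) powr (\<beta> - 2) = (x \<bullet> x) powr (\<beta> - 1)"
    using powr_add[of "x \<bullet> x" 1 "\<beta> - 2"] by simp
  have "laplacian (\<lambda>x. (x \<bullet> x) powr \<beta>) x = (\<Sum>b\<in>Basis. f2 b b x)"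
    by (rule C2_onI_open(3)[where df=f1 and ddf=f2, OF S _ _ _ _ _ x']) (simp_all add: prems cont)
  also have "\<dots> = (\<Sum>b\<in>Basis. 4 * \<beta> * (\<beta> - 1) * (x \<bullet> x) powr (\<beta> - 2) * ((x \<bullet> b) * (x \<bullet> b)) + 2 * \<beta> * (x \<bullet> x) powr (\<beta> - 1))"
    by (intro sum.cong) (auto simp: f2_def algebra_simps)
  also have "\<dots> = 4 * \<beta> * (\<beta> - 1) * (x \<bullet> x) powr (\<beta> - 2) * (x \<bullet> x) + real DIM('a) * (2 * \<beta> * (x \<bullet> x) powr (\<beta> - 1))"
    by (simp add: sum.distrib sum_distrib_left[symmetric] euclidean_inner[of x x])
  also have "\<dots> = 4 * \<beta> * (\<beta> - 1) * ((x \<bullet> x) * (x \<bullet> x) powr (\<beta> - 2)) + real DIM('a) * (2 * \<beta> * (x \<bullet> x) powr (\<beta> - 1))"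
    by (simp add: algebra_simps)
  also have "\<dots> = 2 * \<beta> * (real DIM('a) + 2 * \<beta> - 2) * (x \<bullet> x) powr (\<beta> - 1)"
    unfolding e by (simp add: algebra_simps)
  finally show "laplacian (\<lambda>x. (x \<bullet> x) powr \<beta>) x
           = 2 * \<beta> * (real DIM('a) + 2 * \<beta> - 2) * (x \<bullet> x) powr (\<beta> - 1)" .
qed

section \<open>The maximum principle\<close>

text \<open>A positive second derivative at z would make the first derivative along b, which
  vanishes at the maximum, positive just after z; the mean value theorem then yields a larger value
  of f.\<close>

lemma second_partial_le_0_at_max:
  fixes f :: "'a::euclidean_space \<Rightarrow> real"
  assumes "open U" "z \<in> U" "\<And>y. y \<in> U \<Longrightarrow> f y \<le> f z"
    and f: "\<And>y. y \<in> U \<Longrightarrow> f differentiable at y" "partial_deriv b f differentiable at z"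
  shows "partial_deriv b (partial_deriv b f) z \<le> 0"
proof (rule ccontr)
  assume "\<not> ?thesis"
  then have pos: "partial_deriv b (partial_deriv b f) z > 0" by simp
  define \<phi> where "\<phi> t = f (z + t *\<^sub>R b)" for t
  define \<psi> where "\<psi> t = partial_deriv b f (z + t *\<^sub>R b)" for t
  define V where "V = (\<lambda>t. z + t *\<^sub>R b) -` U"
  have "open V" unfolding V_def
    by (intro open_vimage assms continuous_intros)
  moreover have "0 \<in> V" by (simp add: V_def assms)
  ultimately obtain e where e: "e > 0" "\<And>t. \<bar>t\<bar> < e \<Longrightarrow> t \<in> V"
    by (metis (no_types, lifting) dist_0_norm mem_ball open_contains_ball real_norm_def subset_iff)
  have \<phi>: "(\<phi> has_real_derivative \<psi> t) (at t)" if "\<bar>t\<bar> < e" for t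
    unfolding \<phi>_def \<psi>_def using e(2)[OF that] by (intro partial_deriv_along f) (simp add: V_def)
  have "\<phi> t \<le> \<phi> 0" if "\<bar>t\<bar> < e" for t
    using e(2)[OF that] assms(3) by (simp add: \<phi>_def V_def)
  then have "\<psi> 0 = 0"
    using DERIV_local_max[OF \<phi>, of 0 e] e(1) by auto
  moreover have "(\<psi> has_real_derivative partial_deriv b (partial_deriv b f) z) (at 0)"
    unfolding \<psi>_def using partial_deriv_along[of "partial_deriv b f" z 0 b] f(2) by simp
  ultimately obtain d where d: "d > 0" "\<And>t. 0 < t \<Longrightarrow> t < d \<Longrightarrow> \<psi> t > 0"
    using DERIV_pos_inc_right[OF _ pos] by (metis add_0)
  define s where "s = min d e / 2"
  have s: "0 < s" "s < d" "s < e" using d e by (auto simp: s_def)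
  obtain t where t: "0 < t" "t < s" "\<phi> s - \<phi> 0 = (s - 0) * \<psi> t"
    using MVT2[of 0 s \<phi> \<psi>] s \<phi> by force
  then have "\<phi> s - \<phi> 0 > 0" using d(2)[of t] s by auto
  moreover have "\<phi> s \<le> \<phi> 0" using e(2)[of s] s assms(3) by (simp add: \<phi>_def V_def)
  ultimately show False by simp
qed

lemma laplacian_le_0_at_max:
  assumes "open U" "z \<in> U" "\<And>y. y \<in> U \<Longrightarrow> f y \<le> f z" "C2_on f U"
  shows "laplacian f z \<le> 0"
  unfolding laplacian_def
  by (intro sum_nonpos second_partial_le_0_at_max[where U=U] C2_on_D[OF assms(4)] assms)

lemma C2_on_inner_self: "C2_on (\<lambda>x. x \<bullet> x) (UNIV :: 'a::euclidean_space set)"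
  and laplacian_inner_self: "laplacian (\<lambda>x::'a::euclidean_space. x \<bullet> x) x = 2 * real DIM('a)"
proof -
  have d: "(\<lambda>x. x \<bullet> x) differentiable at x" for x :: 'a by (intro differentiable_inner) auto
  have 1: "partial_deriv b (\<lambda>x. x \<bullet> x) x = 2 * (x \<bullet> b)" for b x :: 'a
    by (rule partial_deriv_eq) (auto intro!: derivative_eq_intros simp: inner_commute)
  have 2: "partial_deriv c (\<lambda>x. 2 * (x \<bullet> b)) x = 2 * (c \<bullet> b)" for b c x :: 'a
    by (subst partial_deriv_cmult) auto
  note * = C2_onI_open[of UNIV "\<lambda>x. x \<bullet> x" "\<lambda>b x. 2 * (x \<bullet> b)" "\<lambda>b c x::'a. 2 * (c \<bullet> b)"]
  show "C2_on (\<lambda>x. x \<bullet> x) (UNIV :: 'a::euclidean_space set)"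
    by (rule *) (simp_all add: d 1 2)
  show "laplacian (\<lambda>x::'a::euclidean_space. x \<bullet> x) x = 2 * real DIM('a)"
    by (subst *(3)) (simp_all add: d 1 2)
qed

text \<open>Adding \<epsilon> |x|^2 makes the function strictly subharmonic, and that excludes an
  interior maximum. \<open>D - U\<close> takes the role of the boundary, which suits the half ball
  with its two faces.\<close>

theorem weak_maximum_principle:
  fixes w :: "'a::euclidean_space \<Rightarrow> real"
  assumes D: "compact D" "continuous_on D w" and U: "open U" "U \<subseteq> D"
    and w: "C2_on w U" "\<And>x. x \<in> U \<Longrightarrow> laplacian w x \<ge> 0"
    and bd: "\<And>x. x \<in> D - U \<Longrightarrow> w x \<le> M"
    and x: "x \<in> D"
  shows "w x \<le> M"
proof (rule ccontr)
  assume "\<not> ?thesis"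
  then have wx: "w x > M" by simp
  obtain R where R: "\<And>y. y \<in> D \<Longrightarrow> norm y \<le> R" "R > 0"
    using compact_imp_bounded[OF D(1)] by (metis bounded_pos)
  \<comment> \<open>With |y| \<le> R on \<open>D\<close>, the perturbation is at most half of the
    excess w x - M.\<close>
  define \<epsilon> where "\<epsilon> = (w x - M) / (2 * R\<^sup>2)"
  have \<epsilon>: "\<epsilon> > 0" "\<epsilon> * R\<^sup>2 < w x - M" using wx R(2) by (auto simp: \<epsilon>_def)
  define v where "v y = w y + \<epsilon> * (y \<bullet> y)" for y
  have "continuous_on D v" unfolding v_def using D(2) by (intro continuous_intros)
  then obtain z where z: "z \<in> D" "\<And>y. y \<in> D \<Longrightarrow> v y \<le> v z"
    using continuous_attains_sup[OF D(1), of v] x by auto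
  have zU: "z \<in> U"
  proof (rule ccontr)
    assume "z \<notin> U"
    then have "w z \<le> M" using bd z(1) by auto
    moreover have "z \<bullet> z \<le> R\<^sup>2" using R(1)[OF z(1)] by (simp add: dot_square_norm power_mono)
    then have "\<epsilon> * (z \<bullet> z) \<le> \<epsilon> * R\<^sup>2" using \<epsilon>(1) by simp
    ultimately have "v z < w x" using \<epsilon>(2) unfolding v_def by linarith
    also have "w x \<le> v x" using \<epsilon>(1) by (simp add: v_def)
    finally show False using z(2)[OF x] by simp
  qed
  note I = C2_on_cmult[OF U(1) C2_on_subset[OF C2_on_inner_self subset_UNIV], where c=\<epsilon>]
  have "C2_on v U" unfolding v_def by (rule C2_on_add[OF U(1) w(1) I(1)])
  then have "laplacian v z \<le> 0"
    using z(2) U zU by (intro laplacian_le_0_at_max[of U]) auto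
  moreover have "laplacian v z = laplacian w z + \<epsilon> * (2 * real DIM('a))"
    unfolding v_def by (simp add: C2_on_add(2)[OF U(1) w(1) I(1) zU] I(2)[OF zU] laplacian_inner_self)
  moreover have "\<epsilon> * (2 * real DIM('a)) > 0" using \<epsilon>(1) by simp
  ultimately show False using w(2)[OF zU] by simp
qed

section \<open>Polynomial functions\<close>

lemmas poly_intros = real_polynomial_function.intros
lemmas poly_linear = poly_intros(1) and poly_const = poly_intros(2)
  and poly_add = poly_intros(3) and poly_mult = poly_intros(4)

lemma poly_differentiable:
  fixes f :: "'a::euclidean_space \<Rightarrow> real"
  shows "real_polynomial_function f \<Longrightarrow> f differentiable at x"
  using differentiable_at_real_polynomial_function by blast

lemma partial_deriv_linear:
  "bounded_linear f \<Longrightarrow> partial_deriv b f x = f b"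
  by (rule partial_deriv_eq) (rule bounded_linear_imp_has_derivative)

lemma poly_partial_deriv:
  fixes f :: "'a::euclidean_space \<Rightarrow> real"
  assumes "real_polynomial_function f"
  shows "real_polynomial_function (partial_deriv b f)"
  using assms
proof induction
  case (linear f)
  then have "partial_deriv b f = (\<lambda>x. f b)" by (auto simp: partial_deriv_linear)
  then show ?case by (simp add: poly_const)
next
  case (const c)
  then show ?case by (simp add: partial_deriv_const[abs_def] poly_const)
next
  case (add f g)
  then have "partial_deriv b (\<lambda>x. f x + g x) = (\<lambda>x. partial_deriv b f x + partial_deriv b g x)"
    by (auto simp: partial_deriv_add poly_differentiable)
  then show ?case using add by (simp add: poly_add)
next
  case (mult f g)
  then have "partial_deriv b (\<lambda>x. f x * g x) = (\<lambda>x. f x * partial_deriv b g x + partial_deriv b f x * g x)"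
    by (auto simp: partial_deriv_mult poly_differentiable)
  then show ?case using mult by (simp add: poly_add poly_mult)
qed

text \<open>Induction over polynomials replaces the general theorem on mixed derivatives.\<close>

lemma poly_partial_deriv_commute:
  fixes f :: "'a::euclidean_space \<Rightarrow> real"
  assumes "real_polynomial_function f"
  shows "partial_deriv c (partial_deriv b f) = partial_deriv b (partial_deriv c f)"
  using assms
proof induction
  case (linear f)
  then have "partial_deriv b f = (\<lambda>x. f b)" for b by (auto simp: partial_deriv_linear)
  then show ?case by (auto simp: fun_eq_iff)
next
  case (const k)
  then show ?case by (simp add: partial_deriv_const[abs_def])
next
  case (add f g)
  have "partial_deriv b (\<lambda>x. f x + g x) = (\<lambda>x. partial_deriv b f x + partial_deriv b g x)" for b
    using add by (simp add: fun_eq_iff partial_deriv_add poly_differentiable)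
  then show ?case using add by (simp add: fun_eq_iff partial_deriv_add poly_differentiable poly_partial_deriv)
next
  case (mult f g)
  have "partial_deriv b (\<lambda>x. f x * g x) = (\<lambda>x. f x * partial_deriv b g x + partial_deriv b f x * g x)" for b
    using mult by (simp add: fun_eq_iff partial_deriv_mult poly_differentiable)
  then show ?case using mult
    by (simp add: fun_eq_iff partial_deriv_add partial_deriv_mult poly_differentiable poly_partial_deriv differentiable_mult)
qed

lemma poly_continuous:
  fixes f :: "'a::euclidean_space \<Rightarrow> real"
  shows "real_polynomial_function f \<Longrightarrow> continuous_on S f"
  using continuous_on_polymonial_function real_polynomial_function_eq by blast

lemma poly_C2:
  fixes f :: "'a::euclidean_space \<Rightarrow> real"
  shows "real_polynomial_function f \<Longrightarrow> C2_on f S"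
  unfolding C2_on_def by (simp add: poly_differentiable poly_partial_deriv poly_continuous)

lemma laplacian_partial_deriv:
  fixes f :: "'a::euclidean_space \<Rightarrow> real"
  assumes f: "real_polynomial_function f"
  shows "laplacian (partial_deriv v f) = partial_deriv v (laplacian f)"
proof
  fix x
  have "partial_deriv v (laplacian f) x = (\<Sum>b\<in>Basis. partial_deriv v (partial_deriv b (partial_deriv b f)) x)"
    unfolding laplacian_def[abs_def]
    by (rule partial_deriv_sum) (simp add: poly_differentiable poly_partial_deriv f)
  then show "laplacian (partial_deriv v f) x = partial_deriv v (laplacian f) x"
    unfolding laplacian_def using f poly_partial_deriv_commute[of _ v] by (simp add: poly_partial_deriv)
qed

lemma poly_comp_linear:
  fixes f :: "'b::euclidean_space \<Rightarrow> real" and g :: "'a::euclidean_space \<Rightarrow> 'b"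
  assumes "real_polynomial_function f" "bounded_linear g"
  shows "real_polynomial_function (\<lambda>x. f (g x))"
  using assms(1)
proof induction
  case (linear f)
  then show ?case using assms(2) by (intro poly_linear bounded_linear_compose[of f g])
qed (simp_all add: poly_intros)

lemma real_poly_zero_if_infinite:
  fixes p :: "real \<Rightarrow> real"
  assumes "real_polynomial_function p" "infinite {t. p t = 0}"
  shows "p t = 0"
proof -
  obtain a n where p: "p = (\<lambda>x. \<Sum>i\<le>n. a i * x ^ i)"
    using real_polynomial_function_imp_sum[OF assms(1)] by blast
  have inf: "infinite {t. (\<Sum>i\<le>n. a i * t ^ i) = 0}"
    using assms(2) unfolding p .
  have "a k = 0" if "k \<le> n" for k
    using Transcendental.polyfun_rootbound[of a k n] that inf by blast
  then show ?thesis by (simp add: p)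
qed

section \<open>Homogeneous polynomials\<close>

text \<open>The scaling law is required for all real c: c = 0 forces f 0 = 0 for k > 0 and, with 0^0
  = 1, constancy for k = 0. The zero function has every degree.\<close>

definition homog_poly :: "nat \<Rightarrow> ('a::euclidean_space \<Rightarrow> real) \<Rightarrow> bool" where
  "homog_poly k f \<longleftrightarrow> real_polynomial_function f \<and> (\<forall>c x. f (c *\<^sub>R x) = c ^ k * f x)"

lemma homog_polyD:
  assumes "homog_poly k f"
  shows "real_polynomial_function f" "f (c *\<^sub>R x) = c ^ k * f x"
  using assms by (auto simp: homog_poly_def)

lemma homog_poly_0 [simp]: "homog_poly k (\<lambda>x. 0)"
  by (simp add: homog_poly_def poly_const)

lemma homog_poly_add: "homog_poly k f \<Longrightarrow> homog_poly k g \<Longrightarrow> homog_poly k (\<lambda>x. f x + g x)"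
  and homog_poly_diff: "homog_poly k f \<Longrightarrow> homog_poly k g \<Longrightarrow> homog_poly k (\<lambda>x. f x - g x)"
  and homog_poly_cmult: "homog_poly k f \<Longrightarrow> homog_poly k (\<lambda>x. c * f x)"
  and homog_poly_mult: "homog_poly k f \<Longrightarrow> homog_poly l g \<Longrightarrow> homog_poly (k + l) (\<lambda>x. f x * g x)"
  by (simp_all add: homog_poly_def poly_intros real_polynomial_function_diff
      right_diff_distrib distrib_left power_add)

lemma homog_poly_sum:
  "finite I \<Longrightarrow> (\<And>i. i \<in> I \<Longrightarrow> homog_poly k (f i)) \<Longrightarrow> homog_poly k (\<lambda>x. \<Sum>i\<in>I. f i x)"
  by (simp add: homog_poly_def sum_distrib_left real_polynomial_function_sum)

lemma homog_poly_inner: "homog_poly 1 (\<lambda>x. x \<bullet> b)"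
  by (simp add: homog_poly_def bounded_linear_inner_left poly_linear)

lemma homog_poly_0_const:
  assumes "homog_poly 0 f" shows "f x = f 0"
  using homog_polyD(2)[OF assms, of 0 x] by simp

lemma homog_poly_partial_deriv:
  assumes f: "homog_poly (Suc k) f"
  shows "homog_poly k (partial_deriv b f)"
proof -
  note p = homog_polyD(1)[OF f]
  have eq: "partial_deriv b f (c *\<^sub>R x) = c ^ k * partial_deriv b f x" if "c \<noteq> 0" for c x
  proof -
    have "c * partial_deriv b f (c *\<^sub>R x) = partial_deriv b (\<lambda>y. f (c *\<^sub>R y)) x"
      by (rule partial_deriv_scale(1)[symmetric]) (rule poly_differentiable[OF p])
    also have "\<dots> = c ^ Suc k * partial_deriv b f x"
      unfolding homog_polyD(2)[OF f] by (rule partial_deriv_cmult) (rule poly_differentiable[OF p])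
    finally show ?thesis using that by simp
  qed
  \<comment> \<open>Cancelling c fails at c = 0; both sides are continuous in c, so the identity
    extends.\<close>
  have "partial_deriv b f (0 *\<^sub>R x) = 0 ^ k * partial_deriv b f x" for x
  proof -
    have c1: "continuous_on UNIV (\<lambda>c. partial_deriv b f (c *\<^sub>R x))"
      by (rule continuous_on_compose2[OF poly_continuous[OF poly_partial_deriv[OF p]], where t=UNIV])
         (auto intro!: continuous_intros)
    have "continuous_on UNIV (\<lambda>c. partial_deriv b f (c *\<^sub>R x) - c ^ k * partial_deriv b f x)"
      by (intro continuous_on_diff c1 continuous_on_mult continuous_on_power continuous_on_id continuous_on_const)
    then have "((\<lambda>c. partial_deriv b f (c *\<^sub>R x) - c ^ k * partial_deriv b f x) \<longlongrightarrow>
        partial_deriv b f (0 *\<^sub>R x) - 0 ^ k * partial_deriv b f x) (at 0)"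
      unfolding continuous_on_def by blast
    moreover have "((\<lambda>c. partial_deriv b f (c *\<^sub>R x) - c ^ k * partial_deriv b f x) \<longlongrightarrow> 0) (at 0)"
      by (rule tendsto_eventually) (simp add: eventually_at_filter eq del: scaleR_eq_0_iff)
    ultimately have "partial_deriv b f (0 *\<^sub>R x) - 0 ^ k * partial_deriv b f x = 0"
      by (rule tendsto_unique[OF trivial_limit_at])
    then show ?thesis by simp
  qed
  with eq have "partial_deriv b f (c *\<^sub>R x) = c ^ k * partial_deriv b f x" for c x
    by (cases "c = 0") (simp only:, rule eq)
  then show ?thesis using poly_partial_deriv[OF p] unfolding homog_poly_def by blast
qed

lemma homog_poly_0_partial_deriv:
  assumes "homog_poly 0 f" shows "partial_deriv b f = (\<lambda>x. 0)"
proof -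
  have "partial_deriv b f x = partial_deriv b (\<lambda>x. f 0) x" for x
    by (rule partial_deriv_cong[OF open_UNIV UNIV_I homog_poly_0_const[OF assms]])
  then show ?thesis by (simp add: fun_eq_iff)
qed

text \<open>Truncated subtraction is harmless: in degree 0 the derivative is the zero function,
  which is homogeneous of every degree.\<close>

lemma homog_poly_partial_deriv':
  assumes f: "homog_poly k f"
  shows "homog_poly (k - 1) (partial_deriv b f)"
  using assms by (cases k) (auto simp: homog_poly_partial_deriv homog_poly_0_partial_deriv)

lemma homog_poly_laplacian:
  assumes f: "homog_poly k f"
  shows "homog_poly (k - 2) (laplacian f)"
  unfolding laplacian_def[abs_def] using homog_poly_partial_deriv'[OF homog_poly_partial_deriv'[OF f]]
  by (intro homog_poly_sum) (auto simp: numeral_2_eq_2)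

text \<open>Differentiate f (t x) = t^k f x in t at t = 1.\<close>

lemma euler_homog_poly:
  assumes f: "homog_poly k f"
  shows "(\<Sum>b\<in>Basis. (x \<bullet> b) * partial_deriv b f x) = real k * f x"
proof -
  note d = poly_differentiable[OF homog_polyD(1)[OF f]]
  have "((\<lambda>t. f (0 + t *\<^sub>R x)) has_real_derivative partial_deriv x f (0 + 1 *\<^sub>R x)) (at 1)"
    by (rule partial_deriv_along) (rule d)
  moreover have "((\<lambda>t. f (0 + t *\<^sub>R x)) has_real_derivative real k * f x) (at 1)"
    unfolding add_0 homog_polyD(2)[OF f] by (auto intro!: derivative_eq_intros)
  ultimately have "partial_deriv x f x = real k * f x"
    using DERIV_unique by fastforce
  then show ?thesis using partial_deriv_direction[OF d, of x x] by simp
qed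

section \<open>Spans of monomials\<close>

lemma fspan_add: "f \<in> fun_space.span B \<Longrightarrow> g \<in> fun_space.span B \<Longrightarrow> (\<lambda>x. f x + g x) \<in> fun_space.span B"
  using fun_space.span_add[of f B g] by (simp add: plus_fun_def)

lemma fspan_cmult: "f \<in> fun_space.span B \<Longrightarrow> (\<lambda>x. c * f x) \<in> fun_space.span B"
  by (rule fun_space.span_scale)

lemma fsum_apply: "(\<Sum>i\<in>I. (f i :: 'a \<Rightarrow> real)) x = (\<Sum>i\<in>I. f i x)"
  by (induction I rule: infinite_finite_induct) auto

lemma fsum_eq: "(\<lambda>x. \<Sum>i\<in>I. f i x :: real) = (\<Sum>i\<in>I. f i)"
  by (rule ext) (simp add: fsum_apply)

lemma fspan_sum: "(\<And>i. i \<in> I \<Longrightarrow> f i \<in> fun_space.span B) \<Longrightarrow> (\<lambda>x. \<Sum>i\<in>I. f i x) \<in> fun_space.span B"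
  unfolding fsum_eq by (rule fun_space.span_sum)

text \<open>Serves as a finite spanning set of the homogeneous polynomials; independence and the
  number of elements come later from exponent vectors.\<close>

fun monomials :: "nat \<Rightarrow> ('a::euclidean_space \<Rightarrow> real) set" where
  "monomials 0 = {\<lambda>x. 1}"
| "monomials (Suc k) = (\<Union>b\<in>Basis. (\<lambda>m x. (x \<bullet> b) * m x) ` monomials k)"

lemma finite_monomials: "finite (monomials k)"
  by (induction k) auto

lemma fspan_inner_monomials:
  assumes "f \<in> fun_space.span (monomials k)" "b \<in> Basis"
  shows "(\<lambda>x. (x \<bullet> b) * f x) \<in> fun_space.span (monomials (Suc k))"
  using assms(1)
proof (induction rule: fun_space.span_induct_alt)
  case base
  then show ?case using fun_space.span_zero by (simp add: zero_fun_def)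
next
  case (step c m g)
  have "(\<lambda>x. (x \<bullet> b) * m x) \<in> fun_space.span (monomials (Suc k))"
    using step(1) assms(2) by (intro fun_space.span_base) auto
  then have "(\<lambda>x. c * ((x \<bullet> b) * m x) + (x \<bullet> b) * g x) \<in> fun_space.span (monomials (Suc k))"
    using step(2) by (intro fspan_add fspan_cmult)
  then show ?case by (simp add: algebra_simps)
qed

text \<open>By Euler's identity f is a combination of coordinates times derivatives of f, which have
  degree one less; hence the induction on the degree.\<close>

lemma homog_poly_span: "homog_poly k f \<Longrightarrow> f \<in> fun_space.span (monomials k)"
proof (induction k arbitrary: f)
  case 0
  have "(\<lambda>x. f 0 * 1) = f" by (rule ext) (simp add: homog_poly_0_const[OF 0, symmetric])
  moreover have "(\<lambda>x::'a. f 0 * 1) \<in> fun_space.span (monomials 0)"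
    by (intro fspan_cmult fun_space.span_base) auto
  ultimately show ?case by simp
next
  case (Suc k)
  have "(\<lambda>x. (1 / real (Suc k)) * (\<Sum>b\<in>Basis. (x \<bullet> b) * partial_deriv b f x)) \<in> fun_space.span (monomials (Suc k))"
    by (intro fspan_cmult fspan_sum fspan_inner_monomials Suc.IH[OF homog_poly_partial_deriv[OF Suc.prems]])
  also have "(\<lambda>x. (1 / real (Suc k)) * (\<Sum>b\<in>Basis. (x \<bullet> b) * partial_deriv b f x)) = f"
    using euler_homog_poly[OF Suc.prems] by (auto simp: fun_eq_iff)
  finally show ?case .
qed

section \<open>Polynomials of bounded degree\<close>

definition poly_upto :: "nat \<Rightarrow> ('a::euclidean_space \<Rightarrow> real) set" where
  "poly_upto d = {f. \<exists>H. (\<forall>k. homog_poly k (H k)) \<and> f = (\<lambda>x. \<Sum>k\<le>d. H k x)}"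

lemma poly_uptoI: "(\<And>k. homog_poly k (H k)) \<Longrightarrow> (\<lambda>x. \<Sum>k\<le>d. H k x) \<in> poly_upto d"
  by (auto simp: poly_upto_def)

lemma poly_upto_add: "f \<in> poly_upto d \<Longrightarrow> g \<in> poly_upto d \<Longrightarrow> (\<lambda>x. f x + g x) \<in> poly_upto d"
proof -
  assume "f \<in> poly_upto d" "g \<in> poly_upto d"
  then obtain F G where "\<And>k. homog_poly k (F k)" "f = (\<lambda>x. \<Sum>k\<le>d. F k x)"
      "\<And>k. homog_poly k (G k)" "g = (\<lambda>x. \<Sum>k\<le>d. G k x)"
    by (auto simp: poly_upto_def)
  then show ?thesis using poly_uptoI[of "\<lambda>k x. F k x + G k x" d]
    by (simp add: homog_poly_add sum.distrib)
qed

lemma poly_upto_cmult: "f \<in> poly_upto d \<Longrightarrow> (\<lambda>x. c * f x) \<in> poly_upto d"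
proof -
  assume "f \<in> poly_upto d"
  then obtain F where "\<And>k. homog_poly k (F k)" "f = (\<lambda>x. \<Sum>k\<le>d. F k x)"
    by (auto simp: poly_upto_def)
  then show ?thesis using poly_uptoI[of "\<lambda>k x. c * F k x" d]
    by (simp add: homog_poly_cmult sum_distrib_left)
qed

lemma homog_poly_upto: "homog_poly k f \<Longrightarrow> k \<le> d \<Longrightarrow> f \<in> poly_upto d"
proof -
  assume f: "homog_poly k f" and kd: "k \<le> d"
  have "homog_poly i (if i = k then f else (\<lambda>x. 0))" for i using f by simp
  from poly_uptoI[of "\<lambda>i. if i = k then f else (\<lambda>x. 0)" d, OF this]
  have "(\<lambda>x. \<Sum>i\<le>d. (if i = k then f else (\<lambda>x. 0)) x) \<in> poly_upto d" .
  moreover have "(\<Sum>i\<le>d. (if i = k then f else (\<lambda>x. 0)) x) = f x" for x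
    using kd by (subst sum.remove[of _ k]) auto
  ultimately show "f \<in> poly_upto d" by simp
qed

lemma poly_upto_subspace: "fun_space.subspace (poly_upto d)"
  unfolding fun_space.subspace_def using poly_upto_add poly_upto_cmult homog_poly_upto[OF homog_poly_0, of 0 d]
  by (auto simp: plus_fun_def zero_fun_def)

lemma poly_upto_sum: "(\<And>i. i \<in> I \<Longrightarrow> f i \<in> poly_upto d) \<Longrightarrow> (\<lambda>x. \<Sum>i\<in>I. f i x) \<in> poly_upto d"
  unfolding fsum_eq by (rule fun_space.subspace_sum[OF poly_upto_subspace])

lemma poly_upto_mono: "d \<le> e \<Longrightarrow> f \<in> poly_upto d \<Longrightarrow> f \<in> poly_upto e"
proof -
  assume d: "d \<le> e" and "f \<in> poly_upto d"
  then obtain F where F: "\<And>k. homog_poly k (F k)" "f = (\<lambda>x. \<Sum>k\<le>d. F k x)"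
    by (auto simp: poly_upto_def)
  show ?thesis unfolding F(2) by (rule poly_upto_sum, rule homog_poly_upto[OF F(1)]) (use d in simp)
qed

lemma poly_upto_polynomial: "f \<in> poly_upto d \<Longrightarrow> real_polynomial_function f"
  by (clarsimp simp: poly_upto_def) (rule real_polynomial_function_sum, auto dest: homog_polyD(1))

lemma poly_upto_mult: "f \<in> poly_upto d \<Longrightarrow> g \<in> poly_upto e \<Longrightarrow> (\<lambda>x. f x * g x) \<in> poly_upto (d + e)"
proof -
  assume "f \<in> poly_upto d" "g \<in> poly_upto e"
  then obtain F G where *: "\<And>k. homog_poly k (F k)" "f = (\<lambda>x. \<Sum>k\<le>d. F k x)"
      "\<And>k. homog_poly k (G k)" "g = (\<lambda>x. \<Sum>k\<le>e. G k x)"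
    by (auto simp: poly_upto_def)
  have "(\<lambda>x. \<Sum>i\<le>d. \<Sum>j\<le>e. F i x * G j x) \<in> poly_upto (d + e)"
    by (rule poly_upto_sum, rule poly_upto_sum, rule homog_poly_upto[OF homog_poly_mult[OF *(1,3)]]) auto
  then show ?thesis by (simp add: *(2,4) sum_product)
qed

lemma poly_upto_exists:
  fixes f :: "'a::euclidean_space \<Rightarrow> real"
  assumes "real_polynomial_function f" shows "\<exists>d. f \<in> poly_upto d"
  using assms
proof induction
  case (linear f)
  then have "homog_poly 1 f" by (simp add: homog_poly_def linear_simps poly_intros)
  then show ?case using homog_poly_upto by blast
next
  case (const c)
  have "homog_poly 0 (\<lambda>x::'a. c)" by (simp add: homog_poly_def poly_intros)
  then show ?case using homog_poly_upto by blast
next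
  case (add f g)
  then obtain d e where "f \<in> poly_upto d" "g \<in> poly_upto e" by auto
  then have "f \<in> poly_upto (max d e)" "g \<in> poly_upto (max d e)" using poly_upto_mono by (metis max.cobounded1 max.cobounded2)+
  then show ?case using poly_upto_add by blast
next
  case (mult f g)
  then show ?case using poly_upto_mult by blast
qed

lemma poly_upto_span: "f \<in> poly_upto d \<Longrightarrow> f \<in> fun_space.span (\<Union>k\<le>d. monomials k)"
  unfolding poly_upto_def
  by (clarsimp intro!: fspan_sum)
     (use fun_space.span_mono[of "monomials k" "\<Union>k\<le>d. monomials k" for k] homog_poly_span in blast)

text \<open>The loss of two degrees offsets the factor 1 - |x|^2 in the Dirichlet problem on the
  ball.\<close>

lemma poly_upto_laplacian:
  fixes f :: "'a::euclidean_space \<Rightarrow> real"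
  assumes "f \<in> poly_upto d"
  shows "laplacian f \<in> poly_upto (d - 2)"
proof -
  obtain F where *: "\<And>k. homog_poly k (F k)" "f = (\<lambda>x. \<Sum>k\<le>d. F k x)"
    using assms by (auto simp: poly_upto_def)
  note d = poly_differentiable[OF homog_polyD(1)[OF *(1)]]
     poly_differentiable[OF poly_partial_deriv[OF homog_polyD(1)[OF *(1)]]]
  have 1: "partial_deriv b f = (\<lambda>x. \<Sum>k\<le>d. partial_deriv b (F k) x)" for b
    unfolding *(2) by (rule ext, rule partial_deriv_sum) (rule d)
  have "laplacian f = (\<lambda>x. \<Sum>k\<le>d. laplacian (F k) x)"
    unfolding laplacian_def[abs_def] 1
    by (rule ext, subst partial_deriv_sum, rule d) (rule sum.swap)
  then show ?thesis
    by (simp only:) (rule poly_upto_sum, rule homog_poly_upto[OF homog_poly_laplacian[OF *(1)]], auto)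
qed

section \<open>Finite-dimensional function spaces\<close>

text \<open>\<open>L\<close> is assumed linear on \<open>V\<close> only, so the argument works with
  explicit linear combinations of \<open>B\<close>.\<close>

lemma linear_image_independent:
  fixes L :: "('a \<Rightarrow> real) \<Rightarrow> ('b \<Rightarrow> real)"
  assumes V: "fun_space.subspace V"
    and L: "\<And>f g. f \<in> V \<Longrightarrow> g \<in> V \<Longrightarrow> L (\<lambda>x. f x + g x) = (\<lambda>x. L f x + L g x)"
      "\<And>f c. f \<in> V \<Longrightarrow> L (\<lambda>x. c * f x) = (\<lambda>x. c * L f x)"
    and inj: "\<And>f. f \<in> V \<Longrightarrow> L f = (\<lambda>x. 0) \<Longrightarrow> f = (\<lambda>x. 0)"
    and B: "finite B" "B \<subseteq> V" "fun_space.independent B"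
  shows "inj_on L B" "fun_space.independent (L ` B)" "L ` fun_space.span B = fun_space.span (L ` B)"
proof -
  have L0: "L (\<lambda>x. 0) = (\<lambda>x. 0)"
    using L(2)[of "\<lambda>x. 0" 0] fun_space.subspace_0[OF V(1)] by (simp add: zero_fun_def)
  have Lsum: "(\<lambda>x. \<Sum>b\<in>C. c b * b x) \<in> V \<and> L (\<lambda>x. \<Sum>b\<in>C. c b * b x) = (\<lambda>x. \<Sum>b\<in>C. c b * L b x)"
    if "finite C" "C \<subseteq> V" for c C
    using that
  proof (induction C)
    case empty
    then show ?case using L0 fun_space.subspace_0[OF V(1)] by (simp add: zero_fun_def)
  next
    case (insert b C)
    have 1: "(\<lambda>x. c b * b x) \<in> V" using insert fun_space.subspace_scale[OF V(1)] by auto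
    have 2: "(\<lambda>x. c b * b x + (\<Sum>b\<in>C. c b * b x)) \<in> V"
      using fun_space.subspace_add[OF V(1) 1] insert by (simp add: plus_fun_def)
    show ?case using insert L(1)[OF 1, of "\<lambda>x. \<Sum>b\<in>C. c b * b x"] L(2)[of b] 2 by simp
  qed
  have coef: "c b = 0" if "(\<lambda>x. \<Sum>b\<in>B. c b * L b x) = (\<lambda>x. 0)" "b \<in> B" for c b
  proof -
    have "(\<lambda>x. \<Sum>b\<in>B. c b * b x) = (\<lambda>x. 0)"
      using inj Lsum[OF B(1,2), of c] that(1) by auto
    then have "(\<Sum>b\<in>B. (\<lambda>x. c b * b x)) = 0"
      by (simp add: fun_eq_iff fsum_apply)
    then show ?thesis
      using fun_space.independentD[OF B(3,1) subset_refl, of c] that(2) by simp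
  qed
  show injB: "inj_on L B"
  proof
    fix b b' assume b: "b \<in> B" "b' \<in> B" "L b = L b'"
    show "b = b'"
    proof (rule ccontr)
      assume "b \<noteq> b'"
      \<comment> \<open>Equal images would give the nontrivial relation L b - L b' = 0.\<close>
      let ?c = "\<lambda>d. if d = b then 1 else if d = b' then -1 else (0::real)"
      have "(\<Sum>d\<in>B. ?c d * L d x) = (\<Sum>d\<in>{b,b'}. ?c d * L d x)" for x
        using b B(1) by (intro sum.mono_neutral_right) auto
      then have "(\<lambda>x. \<Sum>d\<in>B. ?c d * L d x) = (\<lambda>x. 0)" using b \<open>b \<noteq> b'\<close> by auto
      from coef[OF this b(1)] show False by simp
    qed
  qed
  show "fun_space.independent (L ` B)"
  proof (rule fun_space.independent_if_scalars_zero)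
    show "finite (L ` B)" using B(1) by simp
    fix f x assume f: "(\<Sum>x\<in>L ` B. (\<lambda>xa. f x * x xa)) = 0" and x: "x \<in> L ` B"
    then have "(\<lambda>x. \<Sum>b\<in>B. f (L b) * L b x) = (\<lambda>x. 0)"
      by (simp add: sum.reindex[OF injB] o_def fun_eq_iff fsum_apply)
    from coef[OF this] x show "f x = 0" by auto
  qed
  have "L (\<Sum>b\<in>B. (\<lambda>x. c b * b x)) = (\<Sum>b\<in>B. (\<lambda>x. c b * L b x))" for c
    unfolding fsum_eq[symmetric] using Lsum[OF B(1,2), of c] by (rule conjunct2)
  moreover have "(\<Sum>y\<in>L ` B. (\<lambda>x. c y * y x)) = (\<Sum>b\<in>B. (\<lambda>x. c (L b) * L b x))" for c
    by (simp add: sum.reindex[OF injB])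
  moreover have "(\<Sum>b\<in>B. (\<lambda>x. c b * L b x)) \<in> fun_space.span (L ` B)" for c
    by (intro fun_space.span_sum fun_space.span_scale fun_space.span_base imageI)
  ultimately show "L ` fun_space.span B = fun_space.span (L ` B)"
    unfolding fun_space.span_finite[OF B(1)] fun_space.span_finite[OF finite_imageI[OF B(1)]]
    using B(1) by (auto simp: image_iff)
qed

text \<open>Were g outside the span of the image of a basis, then g together with this image would
  be more independent vectors than the basis has elements.\<close>

lemma injective_endo_surj:
  fixes L :: "('a \<Rightarrow> real) \<Rightarrow> ('a \<Rightarrow> real)"
  assumes V: "fun_space.subspace V" "finite T" "V \<subseteq> fun_space.span T"
    and L: "\<And>f. f \<in> V \<Longrightarrow> L f \<in> V"
      "\<And>f g. f \<in> V \<Longrightarrow> g \<in> V \<Longrightarrow> L (\<lambda>x. f x + g x) = (\<lambda>x. L f x + L g x)"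
      "\<And>f c. f \<in> V \<Longrightarrow> L (\<lambda>x. c * f x) = (\<lambda>x. c * L f x)"
    and inj: "\<And>f. f \<in> V \<Longrightarrow> L f = (\<lambda>x. 0) \<Longrightarrow> f = (\<lambda>x. 0)"
    and g: "g \<in> V"
  shows "\<exists>f\<in>V. L f = g"
proof -
  obtain B where B: "B \<subseteq> V" "fun_space.independent B" "V \<subseteq> fun_space.span B"
    using fun_space.maximal_independent_subset[of V] by metis
  have fB: "finite B"
    using fun_space.independent_span_bound[OF V(2) B(2) subset_trans[OF B(1) V(3)]] by (rule conjunct1)
  note I = linear_image_independent[where L=L and V=V and B=B, OF V(1) L(2,3) inj fB B(1,2)]
  have "g \<in> fun_space.span (L ` B)"
  proof (rule ccontr)
    assume n: "g \<notin> fun_space.span (L ` B)"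
    have "fun_space.independent (insert g (L ` B))"
      by (rule fun_space.independent_insertI[OF n I(2)])
    moreover have "insert g (L ` B) \<subseteq> fun_space.span B"
      by (intro insert_subsetI image_subsetI subsetD[OF B(3)] g L(1) subsetD[OF B(1)])
    ultimately have "card (insert g (L ` B)) \<le> card B"
      by (intro fun_space.independent_span_bound[OF fB, THEN conjunct2])
    moreover have "g \<notin> L ` B" using n fun_space.span_base[of g "L ` B"] by argo
    then have "card (insert g (L ` B)) = Suc (card B)"
      by (simp only: card_insert_disjoint[OF finite_imageI[OF fB]] card_image[OF I(1)] not_False_eq_True)
    ultimately show False by linarith
  qed
  then have "g \<in> L ` fun_space.span B" by (simp only: I(3))
  then show ?thesis using fun_space.span_minimal[OF B(1) V(1)] by auto
qed

text \<open>Finitely many sample points determine the members of a finite-dimensional function space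
  linearly. This expansion turns pointwise convergence into convergence of coefficients.\<close>

lemma finite_dim_interpolation:
  assumes "finite B"
  shows "\<exists>X \<phi>. finite X \<and> (\<forall>y. \<phi> y \<in> fun_space.span B) \<and>
    (\<forall>f \<in> fun_space.span B. \<forall>x. f x = (\<Sum>y\<in>X. f y * \<phi> y (x::'a) :: real))"
  using assms
proof (induction B)
  case empty
  show ?case by (rule exI[of _ "{}"], rule exI[of _ "\<lambda>y. 0"]) auto
next
  case (insert b B)
  then obtain X \<phi> where *: "finite X" "\<And>y. \<phi> y \<in> fun_space.span B"
    "\<And>f x. f \<in> fun_space.span B \<Longrightarrow> f x = (\<Sum>y\<in>X. f y * \<phi> y x)" by blast
  have mono: "fun_space.span B \<subseteq> fun_space.span (insert b B)" by (intro fun_space.span_mono) auto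
  \<comment> \<open>Interpolation error at the new function b. If it vanishes identically the old
    points suffice; otherwise a point where it is nonzero is added.\<close>
  define r where "r x = b x - (\<Sum>y\<in>X. b y * \<phi> y x)" for x
  have decomp: "\<exists>k. (\<lambda>x. f x - k * b x) \<in> fun_space.span B" if "f \<in> fun_space.span (insert b B)" for f
    using that by (auto simp: fun_space.span_insert fun_diff_def)
  have part: "\<exists>k. \<forall>x. (\<Sum>y\<in>X. f y * \<phi> y x) = f x - k * r x" if f: "f \<in> fun_space.span (insert b B)" for f
  proof -
    obtain k where "(\<lambda>x. f x - k * b x) \<in> fun_space.span B" using decomp[OF f] by auto
    from *(3)[OF this] have "f x - k * b x = (\<Sum>y\<in>X. f y * \<phi> y x) - k * (\<Sum>y\<in>X. b y * \<phi> y x)" for x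
      by (simp add: algebra_simps sum_subtractf sum_distrib_left)
    then show ?thesis by (intro exI[of _ k]) (simp add: r_def algebra_simps)
  qed
  show ?case
  proof (cases "\<forall>x. r x = 0")
    case True
    then have "f x = (\<Sum>y\<in>X. f y * \<phi> y x)" if f: "f \<in> fun_space.span (insert b B)" for f x
      using part[OF f] by auto
    then show ?thesis using * mono by blast
  next
    case False
    then obtain z where z: "r z \<noteq> 0" by auto
    \<comment> \<open>Outside \<open>X\<close> the values of \<open>\<phi>\<close> are arbitrary,
      and z may or may not lie in \<open>X\<close>; the cut-off makes the sum over
      \<open>insert z X\<close> equal to the sum over \<open>X\<close> in both cases.\<close>
    define \<phi>' where "\<phi>' y x = (if y \<in> X then \<phi> y x else 0)" for y x
    \<comment> \<open>Every f exceeds its old interpolation by a multiple k r. Evaluation at z gives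
      k = (f z - old value at z) / r z, and the added term supplies exactly k r.\<close>
    define \<psi> where "\<psi> y x = \<phi>' y x + ((if y = z then 1 / r z else 0) - \<phi>' y z / r z) * r x" for y x
    have zero: "(\<lambda>x. 0) \<in> fun_space.span C" for C :: "('a \<Rightarrow> real) set"
      using fun_space.span_zero by (simp add: zero_fun_def)
    have \<phi>': "\<phi>' y \<in> fun_space.span (insert b B)" for y
      using *(2) mono zero by (cases "y \<in> X") (auto simp: \<phi>'_def[abs_def])
    have "(\<lambda>x. b x + (-1) * (\<Sum>y\<in>X. b y * \<phi> y x)) \<in> fun_space.span (insert b B)"
      by (intro fspan_add fspan_cmult fspan_sum subsetD[OF mono *(2)] fun_space.span_base insertI1)
    then have r: "r \<in> fun_space.span (insert b B)" by (simp add: r_def[abs_def])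
    have "\<psi> y \<in> fun_space.span (insert b B)" for y
      unfolding \<psi>_def[abs_def] by (intro fspan_add fspan_cmult \<phi>' r)
    moreover have "f x = (\<Sum>y\<in>insert z X. f y * \<psi> y x)" if f: "f \<in> fun_space.span (insert b B)" for f x
    proof -
      obtain k where k: "\<And>x. (\<Sum>y\<in>X. f y * \<phi> y x) = f x - k * r x" using part[OF f] by auto
      have 1: "(\<Sum>y\<in>insert z X. f y * \<phi>' y x) = f x - k * r x" for x
        unfolding k[symmetric] using *(1) by (intro sum.mono_neutral_cong_right) (auto simp: \<phi>'_def)
      have "f y * \<psi> y x = f y * \<phi>' y x + (f y * (if y = z then 1 / r z else 0) * r x - f y * \<phi>' y z * (r x / r z))" for y
        by (simp add: \<psi>_def algebra_simps)
      then have "(\<Sum>y\<in>insert z X. f y * \<psi> y x) =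
        (\<Sum>y\<in>insert z X. f y * \<phi>' y x) + ((\<Sum>y\<in>insert z X. f y * (if y = z then 1 / r z else 0)) * r x
           - (\<Sum>y\<in>insert z X. f y * \<phi>' y z) * (r x / r z))"
        by (simp only: sum.distrib sum_subtractf sum_distrib_right)
      also have "(\<Sum>y\<in>insert z X. f y * (if y = z then 1 / r z else 0)) = f z / r z"
        using *(1) by (subst sum.remove[of _ z]) auto
      finally show ?thesis unfolding 1 using z by (simp add: field_simps)
    qed
    ultimately show ?thesis using *(1) by (intro exI[of _ "insert z X"] exI[of _ \<psi>]) blast
  qed
qed

lemma finite_dim_pointwise_closed:
  assumes "finite B" "\<And>j. f j \<in> fun_space.span B" "\<And>x. (\<lambda>j. f j x) \<longlonglongrightarrow> g (x::'a) "
  shows "g \<in> fun_space.span B"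
proof -
  obtain X \<phi> where *: "finite X" "\<And>y. \<phi> y \<in> fun_space.span B"
    "\<And>f x. f \<in> fun_space.span B \<Longrightarrow> f x = (\<Sum>y\<in>X. f y * \<phi> y (x::'a) :: real)"
    using finite_dim_interpolation[OF assms(1)] by blast
  have "(\<lambda>j. f j x) \<longlonglongrightarrow> (\<Sum>y\<in>X. g y * \<phi> y x)" for x
    unfolding *(3)[OF assms(2), of _ x] by (intro tendsto_intros assms)
  then have "g = (\<lambda>x. \<Sum>y\<in>X. g y * \<phi> y x)"
    using LIMSEQ_unique[OF assms(3)] by blast
  also have "\<dots> \<in> fun_space.span B" by (intro fspan_sum fspan_cmult *)
  finally show ?thesis .
qed

section \<open>Harmonic polynomials\<close>

definition harmonic_poly :: "('a::euclidean_space \<Rightarrow> real) \<Rightarrow> bool" where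
  "harmonic_poly h \<longleftrightarrow> real_polynomial_function h \<and> (\<forall>x. laplacian h x = 0)"

lemma harmonic_polyD:
  assumes "harmonic_poly h"
  shows "real_polynomial_function h" "laplacian h x = 0" "laplacian h = (\<lambda>x. 0)"
  using assms by (auto simp: harmonic_poly_def)

lemma laplacian_poly_simps:
  fixes f g :: "'a::euclidean_space \<Rightarrow> real"
  assumes "real_polynomial_function f" "real_polynomial_function g"
  shows "laplacian (\<lambda>x. f x + g x) x = laplacian f x + laplacian g x"
    and "laplacian (\<lambda>x. f x - g x) x = laplacian f x - laplacian g x"
    and "laplacian (\<lambda>x. c * f x) x = c * laplacian f x"
    and "laplacian (\<lambda>x. f x * g x) x =
      f x * laplacian g x + laplacian f x * g x + 2 * (\<Sum>b\<in>Basis. partial_deriv b f x * partial_deriv b g x)"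
  by (rule C2_on_add(2)[OF open_UNIV poly_C2 poly_C2 UNIV_I] C2_on_diff(2)[OF open_UNIV poly_C2 poly_C2 UNIV_I]
    C2_on_cmult(2)[OF open_UNIV poly_C2 UNIV_I] C2_on_mult(2)[OF open_UNIV poly_C2 poly_C2 UNIV_I], (rule assms)+)+

lemma harmonic_poly_diff:
  "harmonic_poly f \<Longrightarrow> harmonic_poly g \<Longrightarrow> harmonic_poly (\<lambda>x. f x - g x)"
  by (simp add: harmonic_poly_def laplacian_poly_simps real_polynomial_function_diff)

lemma harmonic_poly_partial_deriv:
  "harmonic_poly f \<Longrightarrow> harmonic_poly (partial_deriv v f)"
  by (simp add: harmonic_poly_def poly_partial_deriv laplacian_partial_deriv)
     (simp add: partial_deriv_cong[OF open_UNIV UNIV_I, of "laplacian f" "\<lambda>x. 0"])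

text \<open>On each line through the origin the polynomial has infinitely many zeros.\<close>

lemma poly_zero_if_zero_on_ball:
  fixes q :: "'a::euclidean_space \<Rightarrow> real"
  assumes q: "real_polynomial_function q" and r: "r > 0" "\<And>x. norm x < r \<Longrightarrow> q x = 0"
  shows "q x = 0"
proof -
  have "real_polynomial_function (\<lambda>t. q (t *\<^sub>R x))"
    by (rule poly_comp_linear[OF q bounded_linear_scaleR_left])
  moreover have "infinite {t. q (t *\<^sub>R x) = 0}"
  proof (rule infinite_super)
    show "{0<..<r / (norm x + 1)} \<subseteq> {t. q (t *\<^sub>R x) = 0}"
    proof
      fix t assume t: "t \<in> {0<..<r / (norm x + 1)}"
      have "t * norm x \<le> t * (norm x + 1)" using t by (simp add: algebra_simps)
      also have "\<dots> < r" using t by (simp add: field_simps add_pos_nonneg)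
      finally show "t \<in> {t. q (t *\<^sub>R x) = 0}" using r(2)[of "t *\<^sub>R x"] t by simp
    qed
    show "infinite {0<..<r / (norm x + 1)}" using r(1) by (intro infinite_Ioo) (simp add: add_nonneg_pos)
  qed
  ultimately show ?thesis using real_poly_zero_if_infinite[of "\<lambda>t. q (t *\<^sub>R x)" 1] by simp
qed

lemma poly_maximum_principle:
  fixes w :: "'a::euclidean_space \<Rightarrow> real"
  assumes w: "real_polynomial_function w" "\<And>x. norm x < 1 \<Longrightarrow> laplacian w x \<ge> 0"
    and bd: "\<And>x. norm x = 1 \<Longrightarrow> w x \<le> M" and x: "norm x \<le> 1"
  shows "w x \<le> M"
proof (rule weak_maximum_principle[of "cball 0 1" w "ball 0 1"])
  show "continuous_on (cball 0 1) w" by (rule poly_continuous[OF w(1)])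
  show "C2_on w (ball 0 1)" by (rule poly_C2[OF w(1)])
qed (use assms in auto)

lemma homog_poly_inner_self: "homog_poly 2 (\<lambda>x. x \<bullet> x)"
proof -
  have "homog_poly 2 (\<lambda>x. \<Sum>b\<in>Basis. (x \<bullet> b) * (x \<bullet> b))"
    using homog_poly_mult[OF homog_poly_inner homog_poly_inner] by (intro homog_poly_sum) (auto simp: numeral_2_eq_2)
  then show ?thesis by (simp add: euclidean_inner[symmetric])
qed

text \<open>With \<phi> = 1 - |x|^2, seek h = p - \<phi> q, which agrees with p on the sphere;
  harmonicity means that \<open>L q = laplacian p\<close>. \<open>L\<close> maps polynomials of
  degree at most d to themselves. If q is in its kernel, \<phi> q is harmonic and vanishes on the
  sphere, hence in the ball by the maximum principle, so q = 0. In finite dimension injectivity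
  gives surjectivity.\<close>

theorem harmonic_extension_exists:
  fixes p :: "'a::euclidean_space \<Rightarrow> real"
  assumes "real_polynomial_function p"
  shows "\<exists>h. harmonic_poly h \<and> (\<forall>x. norm x = 1 \<longrightarrow> h x = p x)"
proof -
  obtain d where p: "p \<in> poly_upto d" using poly_upto_exists[OF assms] by auto
  define \<phi> where "\<phi> x = 1 - x \<bullet> x" for x :: 'a
  have "homog_poly 0 (\<lambda>x::'a. 1)" by (simp add: homog_poly_def poly_intros)
  then have "(\<lambda>x::'a. 1 + (-1) * (x \<bullet> x)) \<in> poly_upto 2"
    by (intro poly_upto_add poly_upto_cmult) (auto intro: homog_poly_upto homog_poly_inner_self)
  then have \<phi>: "\<phi> \<in> poly_upto 2" unfolding \<phi>_def[abs_def] by simp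
  define L where "L q = laplacian (\<lambda>x. \<phi> x * q x)" for q
  have \<phi>q: "real_polynomial_function (\<lambda>x. \<phi> x * q x)" if "q \<in> poly_upto d" for q
    using poly_upto_polynomial[OF poly_upto_mult[OF \<phi> that]] .
  have "\<exists>q\<in>poly_upto d. L q = laplacian p"
  proof (rule injective_endo_surj[OF poly_upto_subspace])
    show "finite (\<Union>k\<le>d. monomials k)" using finite_monomials by auto
    show "poly_upto d \<subseteq> fun_space.span (\<Union>k\<le>d. monomials k)" using poly_upto_span by blast
    show "laplacian p \<in> poly_upto d" using poly_upto_mono[OF _ poly_upto_laplacian[OF p], of d] by simp
    fix f g :: "'a \<Rightarrow> real" and c assume f: "f \<in> poly_upto d"
    show "L f \<in> poly_upto d" unfolding L_def using poly_upto_laplacian[OF poly_upto_mult[OF \<phi> f]] by simp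
    show "L (\<lambda>x. c * f x) = (\<lambda>x. c * L f x)"
      unfolding L_def by (rule ext) (simp add: laplacian_poly_simps(3)[OF \<phi>q[OF f] \<phi>q[OF f], symmetric] mult.left_commute)
    show "f = (\<lambda>x. 0)" if Lf: "L f = (\<lambda>x. 0)"
    proof -
      note lap = fun_cong[OF Lf[unfolded L_def]]
      have le: "\<phi> x * f x \<le> 0" if "norm x \<le> 1" for x
        using poly_maximum_principle[OF \<phi>q[OF f], of 0 x] that lap
        by (auto simp: \<phi>_def dot_square_norm)
      have ge: "-1 * (\<phi> x * f x) \<le> 0" if "norm x \<le> 1" for x
      proof (rule poly_maximum_principle[OF _ _ _ that])
        show "real_polynomial_function (\<lambda>x. -1 * (\<phi> x * f x))"
          using poly_const poly_mult \<phi>q[OF f] by fast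
        show "0 \<le> laplacian (\<lambda>x. -1 * (\<phi> x * f x)) y" for y
          unfolding laplacian_poly_simps(3)[OF \<phi>q[OF f] \<phi>q[OF f]] lap by simp
      qed (simp add: \<phi>_def dot_square_norm)
      have "f x = 0" if "norm x < 1" for x
      proof -
        have "\<phi> x * f x = 0" using le[of x] ge[of x] that by simp
        moreover have "\<phi> x > 0" using that by (simp add: \<phi>_def dot_square_norm power_less_one_iff)
        ultimately show ?thesis by simp
      qed
      then show ?thesis
        using poly_zero_if_zero_on_ball[OF poly_upto_polynomial[OF f], of 1] by auto
    qed
    show "L (\<lambda>x. f x + g x) = (\<lambda>x. L f x + L g x)" if g: "g \<in> poly_upto d"
      unfolding L_def by (rule ext) (simp add: laplacian_poly_simps(1)[OF \<phi>q[OF f] \<phi>q[OF g], symmetric] distrib_left)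
  qed
  then obtain q where q: "q \<in> poly_upto d" "L q = laplacian p" by auto
  have "harmonic_poly (\<lambda>x. p x - \<phi> x * q x)"
    unfolding harmonic_poly_def using assms \<phi>q[OF q(1)] fun_cong[OF q(2)[unfolded L_def]]
    by (simp add: laplacian_poly_simps real_polynomial_function_diff)
  then show ?thesis by (intro exI conjI) (auto simp: \<phi>_def dot_square_norm)
qed

text \<open>Bernstein's method: an auxiliary function built from the square of the derivative is
  subharmonic and controlled on the boundary.\<close>

lemma bernstein_gradient_bound:
  fixes h :: "'a::euclidean_space \<Rightarrow> real"
  assumes h: "harmonic_poly h" and M: "\<And>x. norm x \<le> 1 \<Longrightarrow> \<bar>h x\<bar> \<le> M" and x: "norm x \<le> 1"
  shows "((1 - x \<bullet> x) * partial_deriv v h x)\<^sup>2 \<le> (2 * real DIM('a) + 12) * (norm v)\<^sup>2 * M\<^sup>2"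
proof -
  \<comment> \<open>The coefficient of g^2 to be absorbed below is at most 4 N + 24 on the ball, N
    being the dimension. Half of it suffices because the Laplacian of h^2 is twice the squared
    gradient; |v|^2 comes from Cauchy--Schwarz for the directional derivative.\<close>
  define A where "A = (2 * real DIM('a) + 12) * (norm v)\<^sup>2"
  define \<phi> where "\<phi> x = 1 - x \<bullet> x" for x :: 'a
  define g where "g = partial_deriv v h"
  define w where "w x = (\<phi> x * g x) * (\<phi> x * g x) + A * (h x * h x)" for x
  note hp = harmonic_polyD(1)[OF h]
  have g: "harmonic_poly g" unfolding g_def by (rule harmonic_poly_partial_deriv[OF h])
  note gp = harmonic_polyD(1)[OF g]
  have ip: "real_polynomial_function (\<lambda>x::'a. x \<bullet> x)" by (rule homog_polyD(1)[OF homog_poly_inner_self])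
  have \<phi>p: "real_polynomial_function \<phi>"
    unfolding \<phi>_def[abs_def] by (intro real_polynomial_function_diff ip poly_const)
  have \<phi>1: "partial_deriv b \<phi> x = - 2 * (x \<bullet> b)" for b x
    unfolding \<phi>_def by (rule partial_deriv_eq) (auto intro!: derivative_eq_intros simp: inner_commute)
  have \<phi>2: "laplacian \<phi> x = - 2 * real DIM('a)" for x
    unfolding \<phi>_def using laplacian_poly_simps(2)[OF poly_const ip, of 1]
    by (simp add: laplacian_const laplacian_inner_self)
  have fp: "real_polynomial_function (\<lambda>x. \<phi> x * g x)" by (rule poly_mult[OF \<phi>p gp])
  have hh: "real_polynomial_function (\<lambda>x. h x * h x)" by (rule poly_mult[OF hp hp])
  have ff: "real_polynomial_function (\<lambda>x. (\<phi> x * g x) * (\<phi> x * g x))" by (rule poly_mult[OF fp fp])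
  have Ah: "real_polynomial_function (\<lambda>x. A * (h x * h x))"
    by (rule poly_mult[OF poly_const hh])
  have weq: "w = (\<lambda>x. (\<phi> x * g x) * (\<phi> x * g x) + A * (h x * h x))" by (rule ext) (simp add: w_def)
  have wp: "real_polynomial_function w"
    unfolding weq by (rule poly_add[OF ff Ah])
  have lap: "laplacian w x \<ge> 0" if "norm x < 1" for x
  proof -
    define G where "G b = partial_deriv b g x" for b
    have f1: "partial_deriv b (\<lambda>x. \<phi> x * g x) x = \<phi> x * G b - 2 * (x \<bullet> b) * g x" for b
      by (simp add: partial_deriv_mult poly_differentiable \<phi>p gp \<phi>1 G_def)
    have f2: "laplacian (\<lambda>x. \<phi> x * g x) x = - 2 * real DIM('a) * g x - 4 * (\<Sum>b\<in>Basis. (x \<bullet> b) * G b)"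
    proof -
      have "(\<Sum>b\<in>Basis. partial_deriv b \<phi> x * partial_deriv b g x) = -2 * (\<Sum>b\<in>Basis. (x \<bullet> b) * G b)"
        unfolding sum_distrib_left \<phi>1 G_def by (intro sum.cong refl mult.assoc)
      then show ?thesis
        unfolding laplacian_poly_simps(4)[OF \<phi>p gp] \<phi>2 harmonic_polyD(2)[OF g] by simp
    qed
    have "laplacian w x = 2 * (\<phi> x * g x) * (- 2 * real DIM('a) * g x - 4 * (\<Sum>b\<in>Basis. (x \<bullet> b) * G b))
        + 2 * (\<Sum>b\<in>Basis. (\<phi> x * G b - 2 * (x \<bullet> b) * g x)\<^sup>2) + 2 * A * (\<Sum>b\<in>Basis. (partial_deriv b h x)\<^sup>2)"
    proof -
      have "laplacian w x = (\<phi> x * g x) * laplacian (\<lambda>x. \<phi> x * g x) x + laplacian (\<lambda>x. \<phi> x * g x) x * (\<phi> x * g x)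
          + 2 * (\<Sum>b\<in>Basis. (\<phi> x * G b - 2 * (x \<bullet> b) * g x) * (\<phi> x * G b - 2 * (x \<bullet> b) * g x))
          + A * (h x * 0 + 0 * h x + 2 * (\<Sum>b\<in>Basis. partial_deriv b h x * partial_deriv b h x))"
        unfolding weq laplacian_poly_simps(1)[OF ff Ah] laplacian_poly_simps(3)[OF hh hh]
          laplacian_poly_simps(4)[OF fp fp] laplacian_poly_simps(4)[OF hp hp] f1 harmonic_polyD(2)[OF h] ..
      moreover have "a * L + L * a + 2 * S + A * (h x * 0 + 0 * h x + 2 * T) = 2 * a * L + 2 * S + 2 * A * T" for a L S T
        by (simp add: algebra_simps)
      ultimately show ?thesis unfolding f2 power2_eq_square by (rule trans)
    qed
    \<comment> \<open>Completing the square with 4 in place of 2 absorbs the indefinite cross term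
      from the Laplacian of \<phi> g; only multiples of g^2 remain negative.\<close>
    also have "2 * (\<phi> x * g x) * (- 2 * real DIM('a) * g x - 4 * (\<Sum>b\<in>Basis. (x \<bullet> b) * G b))
        + 2 * (\<Sum>b\<in>Basis. (\<phi> x * G b - 2 * (x \<bullet> b) * g x)\<^sup>2) =
        2 * (\<Sum>b\<in>Basis. (\<phi> x * G b - 4 * (x \<bullet> b) * g x)\<^sup>2) - 4 * real DIM('a) * \<phi> x * (g x)\<^sup>2 - 24 * (x \<bullet> x) * (g x)\<^sup>2"
    proof -
      have e1: "(\<Sum>b\<in>Basis. (\<phi> x * G b - 2 * (x \<bullet> b) * g x)\<^sup>2) =
         (\<Sum>b\<in>Basis. (\<phi> x * G b - 4 * (x \<bullet> b) * g x)\<^sup>2) + 4 * \<phi> x * g x * (\<Sum>b\<in>Basis. (x \<bullet> b) * G b)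
           - 12 * (g x)\<^sup>2 * (\<Sum>b\<in>Basis. (x \<bullet> b) * (x \<bullet> b))"
        unfolding sum_distrib_left sum.distrib[symmetric] sum_subtractf[symmetric]
        by (rule sum.cong) (auto simp: power2_eq_square algebra_simps)
      show ?thesis unfolding e1 euclidean_inner[of x x] by (simp add: power2_eq_square algebra_simps)
    qed
    finally have lw: "laplacian w x = 2 * (\<Sum>b\<in>Basis. (\<phi> x * G b - 4 * (x \<bullet> b) * g x)\<^sup>2)
        - (4 * real DIM('a) * \<phi> x + 24 * (x \<bullet> x)) * (g x)\<^sup>2 + 2 * A * (\<Sum>b\<in>Basis. (partial_deriv b h x)\<^sup>2)"
      by (simp add: algebra_simps)
    have "(g x)\<^sup>2 \<le> (\<Sum>b\<in>Basis. (v \<bullet> b)\<^sup>2) * (\<Sum>b\<in>Basis. (partial_deriv b h x)\<^sup>2)"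
      unfolding g_def partial_deriv_direction[OF poly_differentiable[OF hp], of v] by (rule Cauchy_Schwarz_ineq_sum)
    also have "(\<Sum>b\<in>Basis. (v \<bullet> b)\<^sup>2) = (norm v)\<^sup>2"
      unfolding power2_norm_eq_inner euclidean_inner[of v v] by (simp add: power2_eq_square)
    finally have "2 * (2 * real DIM('a) + 12) * (g x)\<^sup>2
        \<le> 2 * (2 * real DIM('a) + 12) * ((norm v)\<^sup>2 * (\<Sum>b\<in>Basis. (partial_deriv b h x)\<^sup>2))"
      by (intro mult_left_mono) auto
    then have cs: "(4 * real DIM('a) + 24) * (g x)\<^sup>2 \<le> 2 * A * (\<Sum>b\<in>Basis. (partial_deriv b h x)\<^sup>2)"
      by (simp add: A_def algebra_simps)
    have "x \<bullet> x \<le> 1" using that by (simp add: dot_square_norm power_le_one)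
    then have "4 * real DIM('a) * \<phi> x + 24 * (x \<bullet> x) \<le> 4 * real DIM('a) * 1 + 24 * 1"
      by (intro add_mono mult_left_mono) (auto simp: \<phi>_def)
    then have "(4 * real DIM('a) * \<phi> x + 24 * (x \<bullet> x)) * (g x)\<^sup>2 \<le> (4 * real DIM('a) + 24) * (g x)\<^sup>2"
      by (intro mult_right_mono) auto
    moreover have "0 \<le> (\<Sum>b\<in>Basis. (\<phi> x * G b - 4 * (x \<bullet> b) * g x)\<^sup>2)" by (intro sum_nonneg) auto
    ultimately show ?thesis using cs lw by linarith
  qed
  have hM: "h x * h x \<le> M\<^sup>2" if "norm x \<le> 1" for x
    using power_mono[OF M[OF that], of 2] by (simp add: power2_eq_square)
  have A0: "A \<ge> 0" by (simp add: A_def)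
  have "w x \<le> A * M\<^sup>2"
  proof (rule poly_maximum_principle[OF wp lap _ x])
    fix y :: 'a assume "norm y = 1"
    then show "w y \<le> A * M\<^sup>2" using mult_left_mono[OF hM[of y] A0] by (simp add: w_def \<phi>_def dot_square_norm)
  qed
  moreover have "((1 - x \<bullet> x) * partial_deriv v h x)\<^sup>2 \<le> w x"
    using A0 by (simp add: w_def \<phi>_def g_def power2_eq_square)
  ultimately show ?thesis by (simp add: A_def)
qed

section \<open>Interior estimates for all derivatives\<close>

lemma harmonic_poly_scale:
  assumes h: "harmonic_poly h"
  shows "harmonic_poly (\<lambda>x. h (c *\<^sub>R x))"
    and "partial_deriv b (\<lambda>x. h (c *\<^sub>R x)) x = c * partial_deriv b h (c *\<^sub>R x)"
proof -
  note hp = harmonic_polyD(1)[OF h]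
  have s: "partial_deriv b (\<lambda>x. f (c *\<^sub>R x)) = (\<lambda>x. c * partial_deriv b f (c *\<^sub>R x))"
    if "real_polynomial_function f" for f :: "'a \<Rightarrow> real" and b
    by (rule ext, rule partial_deriv_scale(1)) (rule poly_differentiable[OF that])
  have r: "real_polynomial_function (\<lambda>x. f (c *\<^sub>R x))"  if "real_polynomial_function f" for f :: "'a \<Rightarrow> real"
    by (rule poly_comp_linear[OF that bounded_linear_scaleR_right])
  have "partial_deriv b (partial_deriv b (\<lambda>x. h (c *\<^sub>R x))) x = c\<^sup>2 * partial_deriv b (partial_deriv b h) (c *\<^sub>R x)" for b x
    by (simp add: s hp poly_partial_deriv partial_deriv_cmult poly_differentiable r power2_eq_square)
  then have "laplacian (\<lambda>x. h (c *\<^sub>R x)) x = c\<^sup>2 * laplacian h (c *\<^sub>R x)" for x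
    by (simp add: laplacian_def sum_distrib_left)
  then show "harmonic_poly (\<lambda>x. h (c *\<^sub>R x))"
    using h r by (simp add: harmonic_poly_def)
  show "partial_deriv b (\<lambda>x. h (c *\<^sub>R x)) x = c * partial_deriv b h (c *\<^sub>R x)"
    using s[OF hp] by simp
qed

text \<open>Rescale to the unit ball; for |y| \<le> 1/2 the weight 1 - |y|^2 in Bernstein's estimate
  is at least 1/2 and can be divided out.\<close>

lemma harmonic_poly_derivative_bound:
  fixes h :: "'a::euclidean_space \<Rightarrow> real"
  assumes h: "harmonic_poly h" and M: "\<And>x. norm x \<le> r \<Longrightarrow> \<bar>h x\<bar> \<le> M" and r: "r > 0" and x: "norm x \<le> r / 2"
  shows "\<bar>partial_deriv v h x\<bar> \<le> 2 * sqrt (2 * real DIM('a) + 12) * norm v / r * M"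
proof -
  define k where "k x = h (r *\<^sub>R x)" for x
  define y where "y = x /\<^sub>R r"
  have y: "norm y \<le> 1/2" "x = r *\<^sub>R y" using r x by (auto simp: y_def field_simps)
  have M0: "M \<ge> 0" using M[of 0] r by force
  have "norm (r *\<^sub>R z) \<le> r" if "norm z \<le> 1" for z :: 'a using that r by simp
  then have "\<bar>k z\<bar> \<le> M" if "norm z \<le> 1" for z using M that by (simp add: k_def)
  then have "((1 - y \<bullet> y) * partial_deriv v k y)\<^sup>2 \<le> (2 * real DIM('a) + 12) * (norm v)\<^sup>2 * M\<^sup>2"
    using y unfolding k_def by (intro bernstein_gradient_bound harmonic_poly_scale(1)[OF h]) auto
  then have "\<bar>(1 - y \<bullet> y) * partial_deriv v k y\<bar> \<le> sqrt ((2 * real DIM('a) + 12) * (norm v)\<^sup>2 * M\<^sup>2)"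
    by (metis real_sqrt_abs real_sqrt_le_mono)
  also have "\<dots> = sqrt (2 * real DIM('a) + 12) * norm v * M"
    using M0 by (simp add: real_sqrt_mult)
  finally have 1: "\<bar>(1 - y \<bullet> y)\<bar> * \<bar>partial_deriv v k y\<bar> \<le> sqrt (2 * real DIM('a) + 12) * norm v * M"
    by (simp add: abs_mult)
  have "y \<bullet> y \<le> (1/2)\<^sup>2" unfolding dot_square_norm using y by (intro power_mono) auto
  then have "1/2 * \<bar>partial_deriv v k y\<bar> \<le> \<bar>(1 - y \<bullet> y)\<bar> * \<bar>partial_deriv v k y\<bar>"
    by (intro mult_right_mono) (auto simp: power2_eq_square)
  moreover have "partial_deriv v k y = r * partial_deriv v h x"
    unfolding k_def y(2) by (rule harmonic_poly_scale(2)[OF h])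
  ultimately have "r * \<bar>partial_deriv v h x\<bar> \<le> 2 * (sqrt (2 * real DIM('a) + 12) * norm v * M)"
    using 1 r by (simp only: abs_mult abs_of_pos[OF r])
  then show ?thesis using r by (simp add: field_simps)
qed

lemma harmonic_poly_iterated:
  "harmonic_poly h \<Longrightarrow> harmonic_poly ((partial_deriv v ^^ m) h)"
  by (induction m) (auto simp: harmonic_poly_partial_deriv)

text \<open>Each differentiation costs half of the radius. The constant depends on v and m but not
  on h, so the bound survives passage to a limit of harmonic polynomials.\<close>

lemma harmonic_poly_iterated_bound:
  fixes v :: "'a::euclidean_space"
  shows "\<exists>C\<ge>0. \<forall>h M x. harmonic_poly h \<longrightarrow> (\<forall>x. norm x \<le> 1 \<longrightarrow> \<bar>h x\<bar> \<le> M) \<longrightarrow> norm x \<le> 1 / 2 ^ m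
     \<longrightarrow> \<bar>(partial_deriv v ^^ m) h x\<bar> \<le> C * M"
proof (induction m)
  case 0
  show ?case by (intro exI[of _ 1]) auto
next
  case (Suc m)
  then obtain C where C: "C \<ge> 0" "\<And>h M x. harmonic_poly h \<Longrightarrow> (\<And>x. norm x \<le> 1 \<Longrightarrow> \<bar>h x\<bar> \<le> M) \<Longrightarrow> norm x \<le> 1 / 2 ^ m
     \<Longrightarrow> \<bar>(partial_deriv v ^^ m) h x\<bar> \<le> C * M" by metis
  define c where "c = 2 * sqrt (2 * real DIM('a) + 12) * norm v / (1 / 2 ^ m)"
  have "\<bar>(partial_deriv v ^^ Suc m) h x\<bar> \<le> c * (C * M)"
    if "harmonic_poly h" "\<And>x. norm x \<le> 1 \<Longrightarrow> \<bar>h x\<bar> \<le> M" "norm x \<le> 1 / 2 ^ Suc m" for h M x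
    unfolding c_def funpow.simps o_def
    by (rule harmonic_poly_derivative_bound[OF harmonic_poly_iterated[OF that(1)] C(2)[OF that(1,2)]])
       (use that(3) in auto)
  then show ?case using C(1) by (intro exI[of _ "c * C"]) (auto simp: c_def mult.assoc)
qed

section \<open>Homogeneous limits of harmonic polynomials\<close>

lemma subspace_pointwise_closed:
  assumes W: "fun_space.subspace W" "W \<subseteq> fun_space.span T" "finite T"
    and f: "\<And>j. f j \<in> W" "\<And>x. (\<lambda>j. f j x) \<longlonglongrightarrow> g (x::'a)"
  shows "g \<in> W"
proof -
  obtain B where B: "B \<subseteq> W" "fun_space.independent B" "W \<subseteq> fun_space.span B"
    using fun_space.maximal_independent_subset[of W] by metis
  have "finite B"
    using fun_space.independent_span_bound[OF W(3) B(2) subset_trans[OF B(1) W(2)]] by (rule conjunct1)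
  then have "g \<in> fun_space.span B"
    by (rule finite_dim_pointwise_closed[OF _ subsetD[OF B(3) f(1)] f(2)])
  then show ?thesis by (rule subsetD[OF fun_space.span_minimal[OF B(1) W(1)]])
qed

text \<open>Divide by the smallest power with nonzero coefficient and let t tend to 0: the other
  terms and the bound tend to 0, so that coefficient vanishes after all. The exponents are real,
  since \<alpha> is to be compared with integers.\<close>

lemma powr_combination_eq_0:
  fixes c :: "real \<Rightarrow> real"
  assumes E: "finite E" "\<And>\<beta>. \<beta> \<in> E \<Longrightarrow> \<beta> < \<nu>" and \<tau>: "\<tau> > 0"
    and le: "\<And>t. 0 < t \<Longrightarrow> t < \<tau> \<Longrightarrow> \<bar>\<Sum>\<beta>\<in>E. c \<beta> * t powr \<beta>\<bar> \<le> B * t powr \<nu>"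
    and \<beta>: "\<beta> \<in> E"
  shows "c \<beta> = 0"
proof (rule ccontr)
  assume "c \<beta> \<noteq> 0"
  define F where "F = {\<beta>\<in>E. c \<beta> \<noteq> 0}"
  have F: "finite F" "F \<noteq> {}" using E(1) \<beta> \<open>c \<beta> \<noteq> 0\<close> by (auto simp: F_def)
  define m where "m = Min F"
  have m: "m \<in> F" "\<And>\<beta>. \<beta> \<in> F \<Longrightarrow> m \<le> \<beta>" using F by (auto simp: m_def)
  have lim0: "((\<lambda>t::real. t powr a) \<longlongrightarrow> 0) (at_right 0)" if "a > 0" for a :: real
    by (rule tendsto_zero_powrI[OF _ tendsto_const]) (use that in \<open>auto intro!: tendsto_eq_intros simp: eventually_at_filter\<close>)
  have "((\<lambda>t. (\<Sum>\<beta>\<in>F - {m}. c \<beta> * t powr (\<beta> - m)) + c m) \<longlongrightarrow> (\<Sum>\<beta>\<in>F - {m}. c \<beta> * 0) + c m) (at_right 0)"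
    using m by (intro tendsto_intros lim0) force
  then have 1: "((\<lambda>t. (\<Sum>\<beta>\<in>F - {m}. c \<beta> * t powr (\<beta> - m)) + c m) \<longlongrightarrow> c m) (at_right 0)" by simp
  have 2: "((\<lambda>t. B * t powr (\<nu> - m)) \<longlongrightarrow> 0) (at_right 0)"
    by (rule tendsto_mult_right_zero, rule lim0) (use m E(2) in \<open>auto simp: F_def\<close>)
  have "eventually (\<lambda>t. norm ((\<Sum>\<beta>\<in>F - {m}. c \<beta> * t powr (\<beta> - m)) + c m) \<le> B * t powr (\<nu> - m)) (at_right 0)"
    unfolding eventually_at_right_field
  proof (intro exI conjI allI impI)
    show "\<tau> > 0" by (rule \<tau>)
    fix t assume t: "0 < t" "t < \<tau>"
    have "(\<Sum>\<beta>\<in>E. c \<beta> * t powr \<beta>) = (\<Sum>\<beta>\<in>F. c \<beta> * t powr \<beta>)"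
      using E(1) by (intro sum.mono_neutral_right) (auto simp: F_def)
    also have "\<dots> = (\<Sum>\<beta>\<in>F. c \<beta> * t powr (\<beta> - m)) * t powr m"
      unfolding sum_distrib_right using t by (intro sum.cong refl) (simp add: powr_diff)
    also have "(\<Sum>\<beta>\<in>F. c \<beta> * t powr (\<beta> - m)) = (\<Sum>\<beta>\<in>F - {m}. c \<beta> * t powr (\<beta> - m)) + c m"
      using F m t by (subst sum.remove[of F m]) auto
    finally have "\<bar>(\<Sum>\<beta>\<in>F - {m}. c \<beta> * t powr (\<beta> - m)) + c m\<bar> * t powr m \<le> B * t powr (\<nu> - m) * t powr m"
      using le[OF t] t by (simp add: abs_mult powr_diff)
    then show "norm ((\<Sum>\<beta>\<in>F - {m}. c \<beta> * t powr (\<beta> - m)) + c m) \<le> B * t powr (\<nu> - m)"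
      using t by simp
  qed
  then have "((\<lambda>t. (\<Sum>\<beta>\<in>F - {m}. c \<beta> * t powr (\<beta> - m)) + c m) \<longlongrightarrow> 0) (at_right 0)"
    using 2 by (rule Lim_null_comparison)
  then have "c m = 0" using tendsto_unique[OF _ 1] by auto
  then show False using m(1) by (simp add: F_def)
qed

section \<open>Taylor coefficients along rays\<close>

lemma poly_iterated: "real_polynomial_function (f::'a::euclidean_space \<Rightarrow> real) \<Longrightarrow> real_polynomial_function ((partial_deriv v ^^ m) f)"
  by (induction m) (auto simp: poly_partial_deriv)

lemma iterated_sum:
  assumes "\<And>k. real_polynomial_function (F k :: 'a::euclidean_space \<Rightarrow> real)"
  shows "(partial_deriv v ^^ m) (\<lambda>x. \<Sum>k\<in>I. F k x) = (\<lambda>x. \<Sum>k\<in>I. (partial_deriv v ^^ m) (F k) x)"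
proof (induction m)
  case (Suc m)
  show ?case unfolding funpow.simps o_def Suc
    by (rule ext, rule partial_deriv_sum) (rule poly_differentiable[OF poly_iterated[OF assms]])
qed simp

lemma iterated_diff:
  assumes "real_polynomial_function f" "real_polynomial_function (g :: 'a::euclidean_space \<Rightarrow> real)"
  shows "(partial_deriv v ^^ m) (\<lambda>x. f x - g x) = (\<lambda>x. (partial_deriv v ^^ m) f x - (partial_deriv v ^^ m) g x)"
proof (induction m)
  case (Suc m)
  show ?case unfolding funpow.simps o_def Suc
    by (rule ext, rule partial_deriv_eq, rule has_derivative_diff)
       (rule has_derivative_partial[OF poly_differentiable[OF poly_iterated]], rule assms)+
qed simp

lemma homog_poly_iterated:
  "homog_poly k g \<Longrightarrow> homog_poly (k - m) ((partial_deriv e ^^ m) g)"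
proof (induction m)
  case (Suc m)
  then show ?case using homog_poly_partial_deriv'[of "k - m" "(partial_deriv e ^^ m) g" e] by simp
qed simp

lemma homog_poly_radial_deriv:
  assumes "homog_poly k f" shows "partial_deriv x f x = real k * f x"
  using euler_homog_poly[OF assms, of x] partial_deriv_direction[OF poly_differentiable[OF homog_polyD(1)[OF assms]], of x x]
  by simp

text \<open>By Euler's identity each derivative along e, evaluated at e, contributes the remaining
  degree as a factor.\<close>

lemma homog_poly_iterated_value:
  assumes g: "homog_poly k g" and "m \<le> k"
  shows "fact (k - m) * (partial_deriv e ^^ m) g e = fact k * g e"
  using assms(2)
proof (induction m)
  case (Suc m)
  then have "k - m = Suc (k - Suc m)" by simp
  then have "fact (k - m) = real (k - m) * fact (k - Suc m)" by (metis fact_Suc of_nat_fact of_nat_mult)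
  moreover have "(partial_deriv e ^^ Suc m) g e = real (k - m) * (partial_deriv e ^^ m) g e"
    using homog_poly_radial_deriv[OF homog_poly_iterated[OF g, of m e]] by simp
  ultimately show ?case using Suc by (simp add: mult_ac)
qed simp

lemma homog_poly_iterated_at_0:
  assumes g: "homog_poly k g"
  shows "(partial_deriv e ^^ m) g 0 = (if m = k then fact k * g e else 0)"
proof -
  have *: "(partial_deriv e ^^ i) g 0 = 0 ^ (k - i) * (partial_deriv e ^^ i) g e" for i
    using homog_polyD(2)[OF homog_poly_iterated[OF g, of i e], of 0 e] by simp
  consider "m < k" | "m = k" | "m > k" by linarith
  then show ?thesis
  proof cases
    case 1
    then show ?thesis using *[of m] by simp
  next
    case 2
    then show ?thesis using *[of k] homog_poly_iterated_value[OF g, of k e] by simp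
  next
    case 3
    have "homog_poly 0 ((partial_deriv e ^^ (m - 1)) g)"
      using homog_poly_iterated[OF g, of "m - 1" e] 3 by simp
    from homog_poly_0_partial_deriv[OF this, of e] 3 show ?thesis
      by (metis One_nat_def Suc_pred comp_apply funpow.simps(2) less_nat_zero_code nat_neq_iff neq0_conv)
  qed
qed

text \<open>The Laplacian of f (t x) in x is a polynomial in t that vanishes identically, and its
  coefficients are the Laplacians of the homogeneous parts. \<open>F\<close> is 0 beyond the degree,
  so that the formula holds for every m.\<close>

lemma homogeneous_parts:
  fixes f :: "'a::euclidean_space \<Rightarrow> real"
  assumes f: "harmonic_poly f"
  shows "\<exists>F. (\<forall>k. homog_poly k (F k) \<and> harmonic_poly (F k)) \<and> (\<forall>e m. (partial_deriv e ^^ m) f 0 = fact m * F m e)"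
proof -
  obtain d G where G: "\<And>k. homog_poly k (G k)" "f = (\<lambda>x. \<Sum>k\<le>d. G k x)"
    using poly_upto_exists[OF harmonic_polyD(1)[OF f]] by (auto simp: poly_upto_def)
  note Gp = homog_polyD(1)[OF G(1)]
  have lapG: "laplacian (G k) x = 0" if k: "k \<le> d" for k x
  proof -
    have lap_sum: "laplacian (\<lambda>x. \<Sum>k\<in>I. c k * G k x) x = (\<Sum>k\<in>I. c k * laplacian (G k) x)" if "finite I" for c I
      using that
    proof (induction I)
      case empty
      then show ?case by (simp add: laplacian_const)
    next
      case (insert k I)
      have p: "real_polynomial_function (\<lambda>x. c k * G k x)" for k
        by (intro poly_intros Gp)
      have "real_polynomial_function (\<lambda>x. \<Sum>k\<in>I. c k * G k x)"
        by (rule real_polynomial_function_sum[OF insert(1) p])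
      with insert show ?case by (simp add: laplacian_poly_simps(1)[OF p] laplacian_poly_simps(3)[OF Gp Gp])
    qed
    have "(\<Sum>k\<le>d. laplacian (G k) x * t ^ k) = 0" for t
    proof -
      have "(\<lambda>x. f (t *\<^sub>R x)) = (\<lambda>x. \<Sum>k\<le>d. t ^ k * G k x)"
        by (simp add: G(2) homog_polyD(2)[OF G(1)])
      then have "(\<Sum>k\<le>d. t ^ k * laplacian (G k) x) = 0"
        using lap_sum[of "{..d}" "\<lambda>k. t ^ k"] harmonic_polyD(2)[OF harmonic_poly_scale(1)[OF f, of t], of x] by simp
      then show ?thesis by (simp add: mult.commute)
    qed
    then show ?thesis using polyfun_eq_0[of "\<lambda>k. laplacian (G k) x" d] k by blast
  qed
  define F where "F k = (if k \<le> d then G k else (\<lambda>x. 0))" for k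
  have "homog_poly k (F k) \<and> harmonic_poly (F k)" for k
    using G(1) lapG Gp by (simp add: F_def harmonic_poly_def laplacian_const poly_const)
  moreover have "(partial_deriv e ^^ m) f 0 = fact m * F m e" for e m
    unfolding G(2) iterated_sum[OF Gp] homog_poly_iterated_at_0[OF G(1)]
    by (simp add: F_def sum.delta)
  ultimately show ?thesis by blast
qed

text \<open>The remainder is controlled by the maximum of h alone, uniformly in h; t is limited to
  the range where the bound on the n-th derivative holds.\<close>

lemma harmonic_poly_taylor:
  fixes e :: "'a::euclidean_space"
  assumes e: "norm e \<le> 1"
  obtains C where "\<forall>h M t. harmonic_poly h \<longrightarrow> (\<forall>x. norm x \<le> 1 \<longrightarrow> \<bar>h x\<bar> \<le> M) \<longrightarrow> 0 \<le> t \<longrightarrow> t \<le> 1 / 2 ^ n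
     \<longrightarrow> \<bar>h (t *\<^sub>R e) - (\<Sum>m<n. (partial_deriv e ^^ m) h 0 / fact m * t ^ m)\<bar> \<le> C * M * t ^ n"
proof -
  obtain C where C: "C \<ge> 0" "\<And>h M x. harmonic_poly h \<Longrightarrow> (\<And>x. norm x \<le> 1 \<Longrightarrow> \<bar>h x\<bar> \<le> M) \<Longrightarrow> norm x \<le> 1 / 2 ^ n
     \<Longrightarrow> \<bar>(partial_deriv e ^^ n) h x\<bar> \<le> C * M" using harmonic_poly_iterated_bound[where v=e and m=n] by metis
  have "\<bar>h (t *\<^sub>R e) - (\<Sum>m<n. (partial_deriv e ^^ m) h 0 / fact m * t ^ m)\<bar> \<le> C * M * t ^ n"
    if h: "harmonic_poly h" and M: "\<And>x. norm x \<le> 1 \<Longrightarrow> \<bar>h x\<bar> \<le> M" and t: "0 \<le> t" "t \<le> 1 / 2 ^ n" for h M t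
  proof -
    define D where "D m s = (partial_deriv e ^^ m) h (s *\<^sub>R e)" for m s
    have "\<forall>m s. (D m has_real_derivative D (Suc m) s) (at s)"
    proof (intro allI)
      fix m s
      show "(D m has_real_derivative D (Suc m) s) (at s)"
        using partial_deriv_along[of "(partial_deriv e ^^ m) h" 0 s e]
          poly_differentiable[OF poly_iterated[OF harmonic_polyD(1)[OF h]]]
        by (simp add: D_def[abs_def])
    qed
    from Maclaurin_all_le[OF refl this, of t n] obtain s where s: "\<bar>s\<bar> \<le> \<bar>t\<bar>"
      "D 0 t = (\<Sum>m<n. D m 0 / fact m * t ^ m) + D n s / fact n * t ^ n" by blast
    have "norm (s *\<^sub>R e) \<le> 1 / 2 ^ n"
      using s(1) t mult_mono[of "\<bar>s\<bar>" "1 / 2 ^ n" "norm e" 1] e by simp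
    from C(2)[OF h M this] have "\<bar>D n s\<bar> \<le> C * M" by (simp add: D_def)
    moreover have "\<bar>D n s\<bar> / fact n \<le> \<bar>D n s\<bar>"
      using fact_ge_1[of n, where 'a=real] by (simp add: divide_le_eq mult_left_mono[of 1 "fact n" "\<bar>D n s\<bar>", simplified])
    ultimately have "\<bar>D n s\<bar> / fact n * t ^ n \<le> C * M * t ^ n"
      using t by (intro mult_right_mono) auto
    then have "\<bar>D n s / fact n * t ^ n\<bar> \<le> C * M * t ^ n"
      using t by (simp add: abs_mult)
    then show ?thesis using s(2) by (simp add: D_def)
  qed
  then show ?thesis by (intro that) blast
qed

text \<open>Along each ray, t^\<alpha> h e differs from a polynomial in t by O(t^n) with n >
  \<alpha>. Comparing powers, h e = 0 unless \<alpha> is an integer K. In that case h is the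
  pointwise limit of the degree K parts, which lie in a finite-dimensional space of harmonic
  polynomials, and this space is closed.\<close>

theorem homogeneous_limit_of_harmonic_polys:
  fixes h :: "'a::euclidean_space \<Rightarrow> real"
  assumes H: "\<And>j. harmonic_poly (H j)"
    and conv: "\<And>\<epsilon>. \<epsilon> > 0 \<Longrightarrow> \<exists>J::nat. \<forall>j\<ge>J. \<forall>x. norm x \<le> 1 \<longrightarrow> \<bar>H j x - h x\<bar> \<le> \<epsilon>"
    and h: "\<And>c x. c > 0 \<Longrightarrow> h (c *\<^sub>R x) = c powr \<alpha> * h x" and \<alpha>: "\<alpha> > 0"
  shows "(\<forall>x. h x = 0) \<or> (\<exists>K. \<alpha> = real K \<and> homog_poly K h \<and> harmonic_poly h)"
proof -
  obtain F where F: "\<And>j k. homog_poly k (F j k)" "\<And>j k. harmonic_poly (F j k)"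
    "\<And>j e m. (partial_deriv e ^^ m) (H j) 0 = fact m * F j m e"
    using homogeneous_parts[OF H] by metis
  have h0: "h 0 = 0" using h[of 2 0] \<alpha> by (auto simp: powr_def)
  have convp: "(\<lambda>j. H j x) \<longlonglongrightarrow> h x" if "norm x \<le> 1" for x
  proof (rule LIMSEQ_I)
    fix r :: real assume "r > 0"
    then show "\<exists>no. \<forall>n\<ge>no. norm (H n x - h x) < r" using conv[of "r/2"] that by fastforce
  qed
  have Fconv: "convergent (\<lambda>j. F j m e)" for m e
  proof -
    obtain C where C: "C \<ge> 0" "\<And>h M. harmonic_poly h \<Longrightarrow> (\<And>x. norm x \<le> 1 \<Longrightarrow> \<bar>h x\<bar> \<le> M)
       \<Longrightarrow> \<bar>(partial_deriv e ^^ m) h 0\<bar> \<le> C * M"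
      using harmonic_poly_iterated_bound[where v=e and m=m] by (metis norm_zero zero_le_divide_1_iff zero_le_numeral zero_le_power)
    have "Cauchy (\<lambda>j. F j m e)"
    proof (rule CauchyI)
      fix r :: real assume r: "r > 0"
      \<comment> \<open>The 1 added to \<open>C\<close> covers C = 0; the factor 2 accounts for the
        deviation of both \<open>H i\<close> and \<open>H j\<close> from h.\<close>
      define \<epsilon> where "\<epsilon> = r / (2 * (C + 1))"
      have \<epsilon>: "\<epsilon> > 0" using r C(1) by (simp add: \<epsilon>_def)
      obtain J where J: "\<And>j x. j \<ge> J \<Longrightarrow> norm x \<le> 1 \<Longrightarrow> \<bar>H j x - h x\<bar> \<le> \<epsilon>" using conv[OF \<epsilon>] by blast
      have "norm (F i m e - F j m e) < r" if ij: "i \<ge> J" "j \<ge> J" for i j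
      proof -
        have "\<bar>H i x - H j x\<bar> \<le> 2 * \<epsilon>" if "norm x \<le> 1" for x
          using J[OF ij(1) that] J[OF ij(2) that] by linarith
        from C(2)[OF harmonic_poly_diff[OF H H] this]
        have "\<bar>fact m * F i m e - fact m * F j m e\<bar> \<le> C * (2 * \<epsilon>)"
          unfolding iterated_diff[OF harmonic_polyD(1)[OF H] harmonic_polyD(1)[OF H]] F(3) .
        also have "C * (2 * \<epsilon>) < (C + 1) * (2 * \<epsilon>)" using \<epsilon> by simp
        also have "(C + 1) * (2 * \<epsilon>) = r"
        proof -
          have "C + 1 \<noteq> 0" using C(1) by simp
          moreover have "k \<noteq> 0 \<Longrightarrow> k * (2 * (r / (2 * k))) = r" for k by simp
          ultimately show ?thesis unfolding \<epsilon>_def by blast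
        qed
        finally have "fact m * \<bar>F i m e - F j m e\<bar> < r" by (simp add: right_diff_distrib[symmetric] abs_mult)
        moreover have "\<bar>F i m e - F j m e\<bar> \<le> fact m * \<bar>F i m e - F j m e\<bar>"
          using fact_ge_1[of m, where 'a=real] by (simp add: mult_right_mono[of 1 "fact m", simplified])
        ultimately show ?thesis by simp
      qed
      then show "\<exists>M. \<forall>i\<ge>M. \<forall>n\<ge>M. norm (F i m e - F n m e) < r" by blast
    qed
    then show ?thesis by (simp add: Cauchy_convergent_iff)
  qed
  define a where "a m e = lim (\<lambda>j. F j m e)" for m e
  have a: "(\<lambda>j. F j m e) \<longlonglongrightarrow> a m e" for m e
    using Fconv[of m e] by (simp add: a_def convergent_LIMSEQ_iff)
  obtain J0 where J0: "\<And>j x. j \<ge> J0 \<Longrightarrow> norm x \<le> 1 \<Longrightarrow> \<bar>H j x - h x\<bar> \<le> 1" using conv[of 1] by auto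
  have "bounded (H J0 ` cball 0 1)"
    by (intro compact_imp_bounded compact_continuous_image poly_continuous harmonic_polyD(1)[OF H]) auto
  then obtain M0 where M0: "\<And>x. norm x \<le> 1 \<Longrightarrow> \<bar>H J0 x\<bar> \<le> M0"
    unfolding bounded_iff by (metis imageI mem_cball_0 real_norm_def)
  define M where "M = M0 + 2"
  have M: "\<bar>H j x\<bar> \<le> M" if "j \<ge> J0" "norm x \<le> 1" for j x
    using J0[OF that] J0[OF order_refl that(2)] M0[OF that(2)] unfolding M_def by linarith
  \<comment> \<open>Makes the remainder t^n of smaller order than t^\<alpha>.\<close>
  define n where "n = nat \<lceil>\<alpha>\<rceil> + 1"
  have n: "\<alpha> < real n" unfolding n_def by linarith
  have key: "h e = (if \<alpha> \<in> real ` {..<n} then a (nat \<lfloor>\<alpha>\<rfloor>) e else 0)" if e: "norm e \<le> 1" for e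
  proof -
    obtain C where C: "\<forall>h M t. harmonic_poly h \<longrightarrow> (\<forall>x. norm x \<le> 1 \<longrightarrow> \<bar>h x\<bar> \<le> M) \<longrightarrow> 0 \<le> t \<longrightarrow> t \<le> 1 / 2 ^ n
     \<longrightarrow> \<bar>h (t *\<^sub>R e) - (\<Sum>m<n. (partial_deriv e ^^ m) h 0 / fact m * t ^ m)\<bar> \<le> C * M * t ^ n"
      by (rule harmonic_poly_taylor[OF e])
    have le: "\<bar>t powr \<alpha> * h e - (\<Sum>m<n. a m e * t ^ m)\<bar> \<le> C * M * t ^ n" if t: "0 < t" "t < 1 / 2 ^ n" for t
    proof -
      have "t * norm e \<le> 1"
        using t e mult_mono[of t 1 "norm e" 1] by (simp add: less_imp_le order_trans[of t "1 / 2 ^ n" 1])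
      then have "norm (t *\<^sub>R e) \<le> 1" using t by simp
      then have "(\<lambda>j. \<bar>H j (t *\<^sub>R e) - (\<Sum>m<n. F j m e * t ^ m)\<bar>) \<longlonglongrightarrow> \<bar>h (t *\<^sub>R e) - (\<Sum>m<n. a m e * t ^ m)\<bar>"
        by (intro tendsto_rabs tendsto_diff convp tendsto_sum tendsto_mult_right a)
      moreover have "\<forall>j\<ge>J0. \<bar>H j (t *\<^sub>R e) - (\<Sum>m<n. F j m e * t ^ m)\<bar> \<le> C * M * t ^ n"
      proof (intro allI impI)
        fix j assume j: "j \<ge> J0"
        have "\<forall>x. norm x \<le> 1 \<longrightarrow> \<bar>H j x\<bar> \<le> M" using M[OF j] by blast
        from C[rule_format, OF H this[rule_format], of t] t show "\<bar>H j (t *\<^sub>R e) - (\<Sum>m<n. F j m e * t ^ m)\<bar> \<le> C * M * t ^ n"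
          unfolding F(3) by simp
      qed
      ultimately have "\<bar>h (t *\<^sub>R e) - (\<Sum>m<n. a m e * t ^ m)\<bar> \<le> C * M * t ^ n"
        by (intro LIMSEQ_le_const2) auto
      then show ?thesis using h[OF t(1)] by simp
    qed
    define E where "E = insert \<alpha> (real ` {..<n})"
    \<comment> \<open>If \<alpha> is an integer, it coincides with one of the exponents below n; the
      set \<open>E\<close> then contains it once, and \<open>c\<close> merges its two coefficients
      into their difference.\<close>
    define c where "c \<beta> = (if \<beta> = \<alpha> then h e else 0) - (if \<beta> \<in> real ` {..<n} then a (nat \<lfloor>\<beta>\<rfloor>) e else 0)" for \<beta>
    have "c \<alpha> = 0"
    proof (rule powr_combination_eq_0[of E "real n" "1 / 2 ^ n" c "C * M"])
      show "\<bar>\<Sum>\<beta>\<in>E. c \<beta> * t powr \<beta>\<bar> \<le> C * M * t powr real n" if t: "0 < t" "t < 1 / 2 ^ n" for t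
      proof -
        have "(\<Sum>\<beta>\<in>E. c \<beta> * t powr \<beta>) = (\<Sum>\<beta>\<in>E. (if \<beta> = \<alpha> then h e else 0) * t powr \<beta>)
            - (\<Sum>\<beta>\<in>E. (if \<beta> \<in> real ` {..<n} then a (nat \<lfloor>\<beta>\<rfloor>) e else 0) * t powr \<beta>)"
          by (simp add: c_def left_diff_distrib sum_subtractf)
        also have "(\<Sum>\<beta>\<in>E. (if \<beta> = \<alpha> then h e else 0) * t powr \<beta>) = (\<Sum>\<beta>\<in>{\<alpha>}. h e * t powr \<beta>)"
          by (rule sum.mono_neutral_cong_right) (auto simp: E_def)
        also have "(\<Sum>\<beta>\<in>E. (if \<beta> \<in> real ` {..<n} then a (nat \<lfloor>\<beta>\<rfloor>) e else 0) * t powr \<beta>)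
            = (\<Sum>\<beta>\<in>real ` {..<n}. a (nat \<lfloor>\<beta>\<rfloor>) e * t powr \<beta>)"
          by (rule sum.mono_neutral_cong_right) (auto simp: E_def)
        also have "\<dots> = (\<Sum>m<n. a m e * t ^ m)"
          using t by (subst sum.reindex) (auto simp: powr_realpow inj_on_def)
        finally show ?thesis using le[OF t] t by (simp add: powr_realpow mult.commute)
      qed
    qed (use n in \<open>auto simp: E_def\<close>)
    then show ?thesis by (simp add: c_def)
  qed
  have scale: "h x = (norm x) powr \<alpha> * h (x /\<^sub>R norm x)" if "x \<noteq> 0" for x
    using h[of "norm x" "x /\<^sub>R norm x"] that by simp
  have unit: "norm (x /\<^sub>R norm x) \<le> 1" for x :: 'a by (cases "x = 0") auto
  show ?thesis
  proof (cases "\<alpha> \<in> real ` {..<n}")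
    case False
    then have "h x = 0" for x using key[OF unit] scale h0 by (cases "x = 0") auto
    then show ?thesis by simp
  next
    case True
    then obtain K where K: "\<alpha> = real K" by auto
    have lim1: "(\<lambda>j. F j K x) \<longlonglongrightarrow> h x" if "norm x \<le> 1" for x
      using key[OF that] True a[of K x] by (simp add: K)
    \<comment> \<open>Homogeneity carries the convergence from the unit ball to the whole
      space.\<close>
    have lim: "(\<lambda>j. F j K x) \<longlonglongrightarrow> h x" for x
    proof (cases "x = 0")
      case True then show ?thesis using lim1 by simp
    next
      case False
      have "(\<lambda>j. norm x ^ K * F j K (x /\<^sub>R norm x)) \<longlonglongrightarrow> norm x ^ K * h (x /\<^sub>R norm x)"
        by (intro tendsto_intros lim1 unit)
      then show ?thesis using False scale[OF False]
        by (simp add: homog_polyD(2)[OF F(1), symmetric] K powr_realpow)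
    qed
    define W :: "('a \<Rightarrow> real) set" where "W = {g. homog_poly K g \<and> harmonic_poly g}"
    have "h \<in> W"
    proof (rule subspace_pointwise_closed[where f="\<lambda>j. F j K"])
      show "fun_space.subspace W"
      proof (rule fun_space.subspaceI)
        show "0 \<in> W" by (simp add: W_def zero_fun_def harmonic_poly_def laplacian_const poly_const)
        fix f g and c :: real assume fg: "f \<in> W"
        then show "(\<lambda>x. c * f x) \<in> W"
          by (simp add: W_def harmonic_poly_def laplacian_poly_simps(3)[of f f] homog_poly_cmult homog_polyD(1)[OF homog_poly_cmult[of K]])
        assume "g \<in> W"
        with fg show "f + g \<in> W"
          by (simp add: W_def plus_fun_def harmonic_poly_def laplacian_poly_simps(1) homog_poly_add homog_polyD(1)[OF homog_poly_add[of K]])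
      qed
      show "W \<subseteq> fun_space.span (monomials K)" using homog_poly_span by (auto simp: W_def)
    qed (auto simp: W_def F finite_monomials lim)
    then show ?thesis using K by (auto simp: W_def)
  qed
qed

section \<open>Eigenfunctions on the hemisphere\<close>

lemma laplacian_scale:
  assumes S: "open S" and f: "C2_on f S" and c: "\<And>x. x \<in> S \<Longrightarrow> c *\<^sub>R x \<in> S" and x: "x \<in> S"
  shows "laplacian (\<lambda>y. f (c *\<^sub>R y)) x = c\<^sup>2 * laplacian f (c *\<^sub>R x)"
proof -
  have 1: "partial_deriv b (\<lambda>y. f (c *\<^sub>R y)) y = c * partial_deriv b f (c *\<^sub>R y)" if "y \<in> S" for b y
    by (rule partial_deriv_scale(1)[OF C2_on_D(1)[OF f c[OF that]]])
  have "partial_deriv b (partial_deriv b (\<lambda>y. f (c *\<^sub>R y))) x = c\<^sup>2 * partial_deriv b (partial_deriv b f) (c *\<^sub>R x)"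
    if b: "b \<in> Basis" for b
  proof -
    note d = C2_on_D(2)[OF f c[OF x] b]
    have "partial_deriv b (partial_deriv b (\<lambda>y. f (c *\<^sub>R y))) x = partial_deriv b (\<lambda>y. c * partial_deriv b f (c *\<^sub>R y)) x"
      by (rule partial_deriv_cong[OF S x 1])
    also have "\<dots> = c * (c * partial_deriv b (partial_deriv b f) (c *\<^sub>R x))"
      by (subst partial_deriv_cmult[OF partial_deriv_scale(2)[OF d]]) (simp add: partial_deriv_scale(1)[OF d])
    finally show ?thesis by (simp add: power2_eq_square)
  qed
  then show ?thesis by (simp add: laplacian_def sum_distrib_left)
qed

text \<open>This is the extension of P from the sphere that is constant along rays. With N the
  dimension, the power contributes -K (N - K - 2) and the cross term, by Euler's identity, -2 K^2;
  together -K (K + N - 2).\<close>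

lemma homog_harmonic_laplacian_on_sphere:
  fixes P :: "'a::euclidean_space \<Rightarrow> real"
  assumes P: "homog_poly K P" "harmonic_poly P"
  shows "C2_on (\<lambda>x. (x \<bullet> x) powr (- real K / 2) * P x) (-{0})"
    and "norm x = 1 \<Longrightarrow> laplacian (\<lambda>x. (x \<bullet> x) powr (- real K / 2) * P x) x = - (real K * (real K + real DIM('a) - 2)) * P x"
proof -
  have S: "open (-{0::'a})" by auto
  note N = norm_power_laplacian[where \<beta>="- real K / 2"]
  note m = C2_on_mult[OF S N(1) poly_C2[OF homog_polyD(1)[OF P(1)]]]
  show "C2_on (\<lambda>x. (x \<bullet> x) powr (- real K / 2) * P x) (-{0})" by (rule m(1))
  assume x: "norm x = 1"
  then have x0: "x \<noteq> 0" and xx: "x \<bullet> x = 1" by (auto simp: dot_square_norm)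
  have "(\<Sum>b\<in>Basis. partial_deriv b (\<lambda>x. (x \<bullet> x) powr (- real K / 2)) x * partial_deriv b P x)
      = - real K * (\<Sum>b\<in>Basis. (x \<bullet> b) * partial_deriv b P x)"
    unfolding partial_deriv_norm_power(2)[OF x0] sum_distrib_left xx by (intro sum.cong) auto
  also have "\<dots> = - real K * (real K * P x)" unfolding euler_homog_poly[OF P(1)] ..
  finally have "laplacian (\<lambda>x. (x \<bullet> x) powr (- real K / 2) * P x) x
     = 2 * (- real K / 2) * (real DIM('a) + 2 * (- real K / 2) - 2) * P x + 2 * (- real K * (real K * P x))"
    using m(2)[of x] N(2)[OF x0] x0 harmonic_polyD(2)[OF P(2)] xx by simp
  also have "\<dots> = - (real K * (real K + real DIM('a) - 2)) * P x" by (simp add: algebra_simps)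
  finally show "laplacian (\<lambda>x. (x \<bullet> x) powr (- real K / 2) * P x) x = - (real K * (real K + real DIM('a) - 2)) * P x" .
qed

text \<open>A point of the equator is approached by moving it towards the pole (0, 1) and
  normalising.\<close>

lemma closure_hemisphere:
  "closure hemisphere = {x :: (real ^ 'n::finite) \<times> real. norm x = 1 \<and> snd x \<ge> 0}"
proof
  have "closed ({x. norm x = 1} \<inter> {x :: (real ^ 'n::finite) \<times> real. snd x \<ge> 0})"
    by (intro closed_Int closed_Collect_eq closed_Collect_le continuous_intros)
  then show "closure hemisphere \<subseteq> {x :: (real ^ 'n::finite) \<times> real. norm x = 1 \<and> snd x \<ge> 0}"
    by (intro closure_minimal) (auto simp: hemisphere_def Int_def)
  show "{x :: (real ^ 'n::finite) \<times> real. norm x = 1 \<and> snd x \<ge> 0} \<subseteq> closure hemisphere"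
  proof
    fix x :: "(real ^ 'n) \<times> real" assume x: "x \<in> {x. norm x = 1 \<and> snd x \<ge> 0}"
    define z where "z s = (x + s *\<^sub>R (0, 1)) /\<^sub>R norm (x + s *\<^sub>R (0, 1))" for s :: real
    have "((\<lambda>s. x + s *\<^sub>R (0, 1)) \<longlongrightarrow> x + 0 *\<^sub>R (0, 1)) (at_right 0)" by (intro tendsto_intros)
    then have "((\<lambda>s. x + s *\<^sub>R (0, 1)) \<longlongrightarrow> x) (at_right 0)" by (simp add: zero_prod_def[symmetric])
    then have "(z \<longlongrightarrow> x /\<^sub>R norm x) (at_right 0)"
      unfolding z_def by (intro tendsto_intros) (use x in auto)
    moreover have "eventually (\<lambda>s. z s \<in> closure hemisphere) (at_right 0)"
      unfolding eventually_at_right_field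
    proof (intro exI[of _ 1] conjI allI impI)
      fix s :: real assume s: "0 < s" "s < 1"
      have pos: "snd (x + s *\<^sub>R (0, 1)) > 0" using x s by auto
      then have "x + s *\<^sub>R (0, 1) \<noteq> 0" by (metis less_irrefl snd_zero)
      then have "z s \<in> hemisphere" using pos by (auto simp: hemisphere_def z_def)
      then show "z s \<in> closure hemisphere" using closure_subset by blast
    qed simp
    ultimately show "x \<in> closure hemisphere"
      using Lim_in_closed_set[OF closed_closure, of z _ "at_right 0"] x by auto
  qed
qed

lemma open_upper: "open {x :: (real ^ 'n::finite) \<times> real. snd x > 0}"
  by (intro open_Collect_less continuous_intros)

lemma dirichlet_eigenspaceD:
  fixes u :: "(real ^ 'n::finite) \<times> real \<Rightarrow> real"
  assumes "u \<in> dirichlet_eigenspace \<mu>"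
  shows "x \<notin> hemisphere \<Longrightarrow> u x = 0" "snd x \<le> 0 \<Longrightarrow> u x = 0" "continuous_on (closure hemisphere) u"
    "C2_on (radial_ext u) {x. snd x > 0}" "x \<in> hemisphere \<Longrightarrow> laplacian (radial_ext u) x = - \<mu> * u x"
proof -
  have *: "\<forall>x. x \<notin> hemisphere \<longrightarrow> u x = 0" "\<forall>x\<in>hemisphere. laplacian (radial_ext u) x + \<mu> * u x = 0"
    using assms unfolding dirichlet_eigenspace_def sphere_laplacian_def by blast+
  show "x \<notin> hemisphere \<Longrightarrow> u x = 0" using * by blast
  show "snd x \<le> 0 \<Longrightarrow> u x = 0" using *(1)[rule_format, of x] by (simp add: hemisphere_def)
  show "x \<in> hemisphere \<Longrightarrow> laplacian (radial_ext u) x = - \<mu> * u x" using *(2)[rule_format, of x] by simp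
qed (use assms in \<open>simp_all only: dirichlet_eigenspace_def mem_Collect_eq\<close>)

lemma radial_ext_scale: "c > 0 \<Longrightarrow> radial_ext u (c *\<^sub>R x) = radial_ext u x"
proof -
  assume c: "c > 0"
  have "inverse (norm (c *\<^sub>R x)) * c = inverse (norm x)" using c by (cases "x = 0") (auto simp: field_simps)
  then have "(c *\<^sub>R x) /\<^sub>R norm (c *\<^sub>R x) = x /\<^sub>R norm x" unfolding scaleR_scaleR by simp
  then show ?thesis by (simp only: radial_ext_def)
qed

lemma radial_ext_unit: "norm x = 1 \<Longrightarrow> radial_ext u x = u x"
  by (simp add: radial_ext_def)

text \<open>The Laplacian of a function constant along rays is homogeneous of degree -2, so the
  equation on the hemisphere determines it on the open half-space.\<close>

lemma radial_ext_laplacian: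
  fixes u :: "(real ^ 'n::finite) \<times> real \<Rightarrow> real"
  assumes u: "u \<in> dirichlet_eigenspace \<mu>" and x: "snd x > 0"
  shows "laplacian (radial_ext u) x = - \<mu> * radial_ext u x / (x \<bullet> x)"
proof -
  have x0: "x \<noteq> 0" using x by auto
  define c where "c = 1 / norm x"
  have c: "c > 0" using x0 by (simp add: c_def)
  have "laplacian (radial_ext u) x = laplacian (\<lambda>y. radial_ext u (c *\<^sub>R y)) x"
    by (simp add: radial_ext_scale[OF c])
  also have "\<dots> = c\<^sup>2 * laplacian (radial_ext u) (c *\<^sub>R x)"
    by (rule laplacian_scale[OF open_upper dirichlet_eigenspaceD(4)[OF u]]) (use c x in auto)
  also have "laplacian (radial_ext u) (c *\<^sub>R x) = - \<mu> * u (c *\<^sub>R x)"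
    using dirichlet_eigenspaceD(5)[OF u, of "c *\<^sub>R x"] x x0 by (simp add: hemisphere_def c_def)
  also have "u (c *\<^sub>R x) = radial_ext u x" by (simp add: radial_ext_def c_def divide_inverse)
  finally show ?thesis by (simp add: c_def power_divide dot_square_norm)
qed

lemma homog_poly_snd: "homog_poly 1 (snd :: 'b::euclidean_space \<times> real \<Rightarrow> real)"
  by (simp add: homog_poly_def bounded_linear_snd poly_linear)

lemma harmonic_poly_snd: "harmonic_poly (snd :: 'b::euclidean_space \<times> real \<Rightarrow> real)"
proof -
  have "homog_poly 0 (partial_deriv b (snd :: 'b \<times> real \<Rightarrow> real))" for b
    using homog_poly_partial_deriv[of 0] homog_poly_snd by auto
  then show ?thesis
    using homog_polyD(1)[OF homog_poly_snd]
    unfolding harmonic_poly_def laplacian_def by (simp add: homog_poly_0_partial_deriv del: split_paired_All)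
qed

text \<open>At a positive maximum the equation gives a nonnegative Laplacian, which for \<mu> = 0 is
  no contradiction yet. Subtracting \<epsilon> times the last coordinate, itself an eigenfunction
  with eigenvalue n, makes the sign strict.\<close>

lemma eigenfunction_nonpos_if_mu_nonpos:
  fixes u :: "(real ^ 'n::finite) \<times> real \<Rightarrow> real"
  assumes u: "u \<in> dirichlet_eigenspace \<mu>" and \<mu>: "\<mu> \<le> 0"
  shows "u x \<le> 0"
proof (rule ccontr)
  assume "\<not> ?thesis"
  then have ux: "u x > 0" by simp
  then have xh: "x \<in> hemisphere" using dirichlet_eigenspaceD(1)[OF u, of x] by force
  \<comment> \<open>The last coordinate is at most 1 on the sphere, so \<open>f\<close> stays
    positive at x.\<close>
  define \<epsilon> where "\<epsilon> = u x / 2"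
  have \<epsilon>: "\<epsilon> > 0" using ux by (simp add: \<epsilon>_def)
  define f where "f y = u y - \<epsilon> * snd y" for y
  have "compact (closure (hemisphere :: ((real ^ 'n) \<times> real) set))"
    by (intro compact_closure[THEN iffD2] bounded_subset[OF bounded_cball[of 0 1]]) (auto simp: hemisphere_def)
  moreover have "continuous_on (closure hemisphere) f"
    unfolding f_def by (intro continuous_intros dirichlet_eigenspaceD(3)[OF u])
  moreover have xc: "x \<in> closure hemisphere" using xh closure_subset by blast
  ultimately obtain z where z: "z \<in> closure hemisphere" "\<And>y. y \<in> closure hemisphere \<Longrightarrow> f y \<le> f z"
    using continuous_attains_sup[of "closure hemisphere" f] by (metis empty_iff)
  have "norm x = 1" using xh unfolding hemisphere_def by blast
  then have "snd x \<le> 1" using norm_snd_le[of "snd x" "fst x"] by simp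
  then have "\<epsilon> * snd x \<le> \<epsilon> * 1" using \<epsilon> by (intro mult_left_mono) auto
  then have "f x > 0" using \<epsilon> by (simp add: f_def \<epsilon>_def)
  then have fz: "f z > 0" using z(2)[OF xc] by linarith
  have "snd z \<ge> 0" using z(1) by (simp add: closure_hemisphere)
  then have "\<epsilon> * snd z \<ge> 0" using \<epsilon> by simp
  then have uz: "u z > 0" using fz unfolding f_def by linarith
  then have zh: "z \<in> hemisphere" using dirichlet_eigenspaceD(1)[OF u, of z] by force
  let ?s = "\<lambda>x::(real ^ 'n) \<times> real. (x \<bullet> x) powr (- real 1 / 2) * snd x"
  define V where "V y = radial_ext u y - \<epsilon> * ?s y" for y
  have Vf: "V y = f (y /\<^sub>R norm y)" if "snd y > 0" for y
  proof -
    have "y \<noteq> 0" using that by auto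
    then have "(y \<bullet> y) powr (- real 1 / 2) = inverse (norm y)"
      by (simp add: dot_square_norm powr_minus powr_half_sqrt)
    then show ?thesis by (simp add: V_def f_def radial_ext_def)
  qed
  note s = homog_harmonic_laplacian_on_sphere[OF homog_poly_snd harmonic_poly_snd]
  have sC: "C2_on ?s {x. snd x > 0}" by (rule C2_on_subset[OF s(1)]) auto
  note sC' = C2_on_cmult[OF open_upper sC, where c=\<epsilon>]
  note VC = C2_on_diff[OF open_upper dirichlet_eigenspaceD(4)[OF u] sC'(1)]
  have z1: "norm z = 1" "snd z > 0" using zh by (auto simp: hemisphere_def)
  \<comment> \<open>\<open>V\<close> is constant along rays, so its maximum over the hemisphere is a
    maximum over the open half-space, where the Euclidean criterion applies.\<close>
  have "laplacian V z \<le> 0"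
  proof (rule laplacian_le_0_at_max[OF open_upper])
    show "z \<in> {x. snd x > 0}" using z1 by simp
    fix y :: "(real ^ 'n) \<times> real" assume y: "y \<in> {x. snd x > 0}"
    then have "y \<noteq> 0" by auto
    with y have "y /\<^sub>R norm y \<in> closure hemisphere" by (simp add: closure_hemisphere)
    from z(2)[OF this] show "V y \<le> V z" using Vf[of y] Vf[of z] y z1 by simp
  next
    show "C2_on V {x. snd x > 0}" unfolding V_def by (rule VC(1))
  qed
  moreover have "laplacian V z = - \<mu> * u z + \<epsilon> * (real CARD('n) * snd z)"
    unfolding V_def using VC(2)[of z] sC'(2)[of z] s(2)[OF z1(1)] z1 dirichlet_eigenspaceD(5)[OF u zh]
    by (simp add: algebra_simps)
  moreover have "- \<mu> * u z \<ge> 0" using \<mu> uz by (simp add: mult_nonpos_nonneg)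
  moreover have "\<epsilon> * (real CARD('n) * snd z) > 0" using \<epsilon> z1 by simp
  ultimately show False by linarith
qed

lemma eigenspace_uminus:
  fixes u :: "(real ^ 'n::finite) \<times> real \<Rightarrow> real"
  assumes u: "u \<in> dirichlet_eigenspace \<mu>" shows "(\<lambda>x. - u x) \<in> dirichlet_eigenspace \<mu>"
proof -
  have "radial_ext (\<lambda>x. - u x) = (\<lambda>x. -1 * radial_ext u x)" by (auto simp: radial_ext_def)
  then show ?thesis
    using dirichlet_eigenspaceD[OF u] C2_on_cmult[OF open_upper dirichlet_eigenspaceD(4)[OF u], where c="-1"]
    unfolding dirichlet_eigenspace_def sphere_laplacian_def
    by (auto simp: continuous_on_minus hemisphere_def simp del: split_paired_All)
qed

lemma eigenfunction_zero_if_mu_nonpos: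
  fixes u :: "(real ^ 'n::finite) \<times> real \<Rightarrow> real"
  assumes u: "u \<in> dirichlet_eigenspace \<mu>" and \<mu>: "\<mu> \<le> 0"
  shows "u x = 0"
  using eigenfunction_nonpos_if_mu_nonpos[OF u \<mu>, of x]
    eigenfunction_nonpos_if_mu_nonpos[OF eigenspace_uminus[OF u] \<mu>, of x] by simp

section \<open>Odd harmonic extension of eigenfunctions\<close>

definition mirror :: "'b \<times> real \<Rightarrow> 'b \<times> real" where
  "mirror x = (fst x, - snd x)"

lemma mirror_simps [simp]:
  "mirror (mirror x) = x" "snd (mirror x) = - snd x" "norm (mirror (x::'b::euclidean_space \<times> real)) = norm x"
  "mirror (c *\<^sub>R x) = c *\<^sub>R mirror x"
  by (auto simp: mirror_def norm_prod_def)

lemma bounded_linear_mirror: "bounded_linear (mirror :: 'b::euclidean_space \<times> real \<Rightarrow> _)"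
  unfolding mirror_def[abs_def]
  by (intro bounded_linear_Pair bounded_linear_fst bounded_linear_minus bounded_linear_snd)

text \<open>The mirror sends each basis vector to itself or its negative, and a second derivative
  does not see the sign.\<close>

lemma harmonic_poly_mirror:
  fixes f :: "'b::euclidean_space \<times> real \<Rightarrow> real"
  assumes f: "harmonic_poly f"
  shows "harmonic_poly (\<lambda>x. f (mirror x))"
proof -
  have pd: "partial_deriv b (\<lambda>x. g (mirror x)) = (\<lambda>x. partial_deriv (mirror b) g (mirror x))"
    if "real_polynomial_function g" for g :: "'b \<times> real \<Rightarrow> real" and b
  proof
    fix x
    show "partial_deriv b (\<lambda>x. g (mirror x)) x = partial_deriv (mirror b) g (mirror x)"
      by (rule partial_deriv_eq)
         (rule has_derivative_compose[OF bounded_linear_imp_has_derivative[OF bounded_linear_mirror]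
             has_derivative_partial[OF poly_differentiable[OF that]]])
  qed
  note fp = harmonic_polyD(1)[OF f]
  have "partial_deriv (mirror b) (partial_deriv (mirror b) f) y = partial_deriv b (partial_deriv b f) y"
    if b: "b \<in> Basis" for b y
  proof -
    have neg: "partial_deriv (- b) g z = - partial_deriv b g z" if "real_polynomial_function g" for g :: "'b \<times> real \<Rightarrow> real" and z
      using linear_neg[OF linear_frechet_derivative[OF poly_differentiable[OF that, of z]]] by (simp add: partial_deriv_def)
    from b consider "mirror b = b" | "mirror b = - b" by (auto simp: Basis_prod_def mirror_def)
    then show ?thesis
    proof cases
      case 2
      have "partial_deriv (- b) f = (\<lambda>z. -1 * partial_deriv b f z)" using neg[OF fp] by auto
      then show ?thesis unfolding 2
        by (simp add: neg[OF poly_partial_deriv[OF fp]]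
            partial_deriv_cmult[OF poly_differentiable[OF poly_partial_deriv[OF fp]], of _ "-1", simplified]
            neg[OF real_polynomial_function_minus[OF poly_partial_deriv[OF fp]]])
    qed simp
  qed
  then have "laplacian (\<lambda>x. f (mirror x)) x = laplacian f (mirror x)" for x
    by (simp add: laplacian_def pd fp poly_partial_deriv)
  then show ?thesis using f poly_comp_linear[OF fp bounded_linear_mirror] by (simp add: harmonic_poly_def del: split_paired_All)
qed

lemma eigenfunction_continuous_on_sphere:
  fixes u :: "(real ^ 'n::finite) \<times> real \<Rightarrow> real"
  assumes u: "u \<in> dirichlet_eigenspace \<mu>"
  shows "continuous_on (sphere 0 1) u"
proof -
  have "sphere 0 1 = closure hemisphere \<union> {x :: (real ^ 'n) \<times> real. norm x = 1 \<and> snd x \<le> 0}"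
    unfolding closure_hemisphere by auto
  moreover have "closed {x :: (real ^ 'n) \<times> real. norm x = 1 \<and> snd x \<le> 0}"
    unfolding Collect_conj_eq by (intro closed_Int closed_Collect_eq closed_Collect_le continuous_intros)
  moreover have "continuous_on {x :: (real ^ 'n) \<times> real. norm x = 1 \<and> snd x \<le> 0} u"
    by (rule continuous_on_eq[OF continuous_on_const[of _ 0]]) (simp add: dirichlet_eigenspaceD(2)[OF u])
  ultimately show ?thesis
    using dirichlet_eigenspaceD(3)[OF u] by (simp add: continuous_on_closed_Un)
qed

text \<open>The homogeneous extension of degree \<alpha>, called h in the overview before its
  reflection. It vanishes at the origin because \<open>0 powr a = 0\<close> for every a.\<close>

definition cone_ext :: "real \<Rightarrow> ('a::euclidean_space \<Rightarrow> real) \<Rightarrow> 'a \<Rightarrow> real" where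
  "cone_ext \<alpha> u x = (x \<bullet> x) powr (\<alpha> / 2) * radial_ext u x"

lemma cone_ext_scale:
  assumes "c > 0" shows "cone_ext \<alpha> u (c *\<^sub>R x) = c powr \<alpha> * cone_ext \<alpha> u x"
proof -
  have "(c *\<^sub>R x) \<bullet> (c *\<^sub>R x) = c powr 2 * (x \<bullet> x)"
    using assms by (simp add: power2_eq_square)
  then have "((c *\<^sub>R x) \<bullet> (c *\<^sub>R x)) powr (\<alpha> / 2) = c powr \<alpha> * (x \<bullet> x) powr (\<alpha> / 2)"
    using assms by (simp only: powr_mult powr_powr) simp
  then show ?thesis using assms by (simp add: cone_ext_def radial_ext_scale)
qed

lemma cone_ext_unit: "norm x = 1 \<Longrightarrow> cone_ext \<alpha> u x = u x"
  by (simp add: cone_ext_def radial_ext_unit dot_square_norm)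

text \<open>The cross term of the product rule vanishes because \<open>radial_ext u\<close> has zero
  radial derivative; the Laplacian of the power supplies \<alpha> (\<alpha> + n - 1), which cancels
  \<mu>.\<close>

lemma cone_ext_harmonic:
  fixes u :: "(real ^ 'n::finite) \<times> real \<Rightarrow> real"
  assumes u: "u \<in> dirichlet_eigenspace \<mu>" and \<mu>: "\<mu> = \<alpha> * (\<alpha> + real CARD('n) - 1)"
  shows "C2_on (cone_ext \<alpha> u) {x. snd x > 0}"
    and "snd x > 0 \<Longrightarrow> laplacian (cone_ext \<alpha> u) x = 0"
proof -
  let ?H = "{x :: (real ^ 'n) \<times> real. snd x > 0}"
  note N = norm_power_laplacian[where \<beta>="\<alpha> / 2"]
  have NC: "C2_on (\<lambda>x. (x \<bullet> x) powr (\<alpha> / 2)) ?H" by (rule C2_on_subset[OF N(1)]) auto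
  note uC = dirichlet_eigenspaceD(4)[OF u]
  note m = C2_on_mult[OF open_upper NC uC]
  show "C2_on (cone_ext \<alpha> u) ?H" unfolding cone_ext_def[abs_def] by (rule m(1))
  assume x: "snd x > 0"
  then have x0: "x \<noteq> 0" by auto
  then have xx: "x \<bullet> x > 0" by simp
  have "((\<lambda>t. radial_ext u (0 + t *\<^sub>R x)) has_real_derivative partial_deriv x (radial_ext u) (0 + 1 *\<^sub>R x)) (at 1)"
    by (rule partial_deriv_along) (use C2_on_D(1)[OF uC] x in simp)
  moreover have "((\<lambda>t. radial_ext u (0 + t *\<^sub>R x)) has_real_derivative 0) (at 1)"
  proof (rule has_field_derivative_transform_within_open[OF DERIV_const[of "radial_ext u x"]])
    show "open {0::real<..}" "(1::real) \<in> {0<..}" by auto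
  qed (simp add: radial_ext_scale)
  ultimately have "partial_deriv x (radial_ext u) x = 0" using DERIV_unique by fastforce
  then have r0: "(\<Sum>b\<in>Basis. (x \<bullet> b) * partial_deriv b (radial_ext u) x) = 0"
    using partial_deriv_direction[OF C2_on_D(1)[OF uC], of x x] x by simp
  have "(\<Sum>b\<in>Basis. partial_deriv b (\<lambda>x. (x \<bullet> x) powr (\<alpha> / 2)) x * partial_deriv b (radial_ext u) x)
     = \<alpha> * (x \<bullet> x) powr (\<alpha> / 2 - 1) * (\<Sum>b\<in>Basis. (x \<bullet> b) * partial_deriv b (radial_ext u) x)"
    unfolding partial_deriv_norm_power(2)[OF x0] sum_distrib_left by (intro sum.cong) auto
  also have "\<dots> = 0" by (simp only: r0 mult_zero_right)
  finally have "laplacian (cone_ext \<alpha> u) x = (x \<bullet> x) powr (\<alpha> / 2) * (- \<mu> * radial_ext u x / (x \<bullet> x))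
      + 2 * (\<alpha> / 2) * (real DIM((real ^ 'n) \<times> real) + 2 * (\<alpha> / 2) - 2) * (x \<bullet> x) powr (\<alpha> / 2 - 1) * radial_ext u x"
    unfolding cone_ext_def[abs_def] using m(2)[of x] N(2)[OF x0] radial_ext_laplacian[OF u x] x by simp
  also have "(x \<bullet> x) powr (\<alpha> / 2) * (- \<mu> * radial_ext u x / (x \<bullet> x)) = - \<mu> * radial_ext u x * (x \<bullet> x) powr (\<alpha> / 2 - 1)"
    using xx by (simp add: powr_diff)
  finally show "laplacian (cone_ext \<alpha> u) x = 0" by (simp add: \<mu> algebra_simps)
qed

text \<open>Away from 0 this is composition with the projection to the sphere; at 0 the factor
  |x|^\<alpha> tends to 0 while u is bounded.\<close>

lemma cone_ext_continuous:
  fixes u :: "(real ^ 'n::finite) \<times> real \<Rightarrow> real"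
  assumes u: "u \<in> dirichlet_eigenspace \<mu>" and \<alpha>: "\<alpha> > 0"
  shows "continuous_on UNIV (cone_ext \<alpha> u)"
proof -
  have "continuous_on (-{0}) (\<lambda>x. u (x /\<^sub>R norm x))"
  proof (rule continuous_on_compose2[OF eigenfunction_continuous_on_sphere[OF u]])
    show "continuous_on (-{0}) (\<lambda>x :: (real ^ 'n) \<times> real. x /\<^sub>R norm x)"
      by (intro continuous_intros) auto
    have "norm (x /\<^sub>R norm x) = 1" if "x \<noteq> 0" for x :: "(real ^ 'n) \<times> real" using that by simp
    then show "(\<lambda>x. x /\<^sub>R norm x) ` (- {0}) \<subseteq> sphere (0 :: (real ^ 'n) \<times> real) 1"
      by (intro image_subsetI) (metis ComplD mem_sphere_0 singletonI)
  qed
  then have "continuous_on (-{0}) (cone_ext \<alpha> u)"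
    unfolding cone_ext_def[abs_def] radial_ext_def by (intro continuous_intros) auto
  then have 1: "isCont (cone_ext \<alpha> u) x" if "x \<noteq> 0" for x
    using that continuous_on_eq_continuous_at[of "-{0}" "cone_ext \<alpha> u"] by (simp add: open_Compl)
  have "bounded (u ` sphere 0 1)"
    by (intro compact_imp_bounded compact_continuous_image eigenfunction_continuous_on_sphere[OF u]) auto
  then obtain M where M: "\<And>x. norm x = 1 \<Longrightarrow> \<bar>u x\<bar> \<le> M"
    unfolding bounded_iff by (metis imageI mem_sphere_0 real_norm_def)
  have "\<bar>cone_ext \<alpha> u x\<bar> \<le> (x \<bullet> x) powr (\<alpha> / 2) * M" for x
  proof (cases "x = 0")
    case False
    then have "\<bar>u (x /\<^sub>R norm x)\<bar> \<le> M" by (intro M) simp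
    then show ?thesis by (simp add: cone_ext_def radial_ext_def abs_mult mult_left_mono)
  qed (simp add: cone_ext_def)
  then have ev: "\<forall>\<^sub>F x in at 0. norm (cone_ext \<alpha> u x) \<le> (x \<bullet> x) powr (\<alpha> / 2) * M"
    by (intro always_eventually allI) (simp only: real_norm_def)
  have "((\<lambda>x :: (real ^ 'n) \<times> real. (x \<bullet> x) powr (\<alpha> / 2) * M) \<longlongrightarrow> 0) (at 0)"
  proof (rule tendsto_mult_left_zero, rule tendsto_zero_powrI[where b="\<alpha> / 2"])
    show "((\<lambda>x. \<alpha> / 2) \<longlongrightarrow> \<alpha> / 2) (at 0)" by (rule tendsto_const)
    show "\<forall>\<^sub>F x :: (real ^ 'n) \<times> real in at 0. 0 \<le> x \<bullet> x" by (rule always_eventually) simp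
    show "0 < \<alpha> / 2" using \<alpha> by simp
    have "((\<lambda>x :: (real ^ 'n) \<times> real. x \<bullet> x) \<longlongrightarrow> (0 :: (real ^ 'n) \<times> real) \<bullet> 0) (at 0)"
      by (rule tendsto_inner) (rule tendsto_ident_at)+
    then show "((\<lambda>x :: (real ^ 'n) \<times> real. x \<bullet> x) \<longlongrightarrow> 0) (at 0)" by simp
  qed
  then have "(cone_ext \<alpha> u \<longlongrightarrow> 0) (at 0)"
    by (rule Lim_null_comparison[OF ev])
  then have "isCont (cone_ext \<alpha> u) 0" by (simp add: isCont_def cone_ext_def)
  with 1 have "isCont (cone_ext \<alpha> u) x" for x by (cases "x = 0") simp_all
  then show ?thesis by (intro continuous_at_imp_continuous_on ballI)
qed

lemma cone_ext_lower:
  fixes u :: "(real ^ 'n::finite) \<times> real \<Rightarrow> real"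
  assumes u: "u \<in> dirichlet_eigenspace \<mu>" and "snd x \<le> 0"
  shows "cone_ext \<alpha> u x = 0"
proof -
  have "u (x /\<^sub>R norm x) = 0"
    using assms(2) by (intro dirichlet_eigenspaceD(2)[OF u]) (simp add: mult_nonneg_nonpos)
  then show ?thesis by (simp add: cone_ext_def radial_ext_def)
qed

text \<open>For an eigenfunction, \<open>cone_ext\<close> vanishes where snd x \<le> 0, so at each
  point at most one of the two terms is nonzero and the difference is the odd reflection.\<close>

definition odd_ext :: "real \<Rightarrow> ('b::euclidean_space \<times> real \<Rightarrow> real) \<Rightarrow> 'b \<times> real \<Rightarrow> real" where
  "odd_ext \<alpha> u x = cone_ext \<alpha> u x - cone_ext \<alpha> u (mirror x)"

text \<open>The antisymmetrised \<open>G\<close> vanishes on the flat face of the upper half ball.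
  On the round face the error is below \<epsilon>/2 from x plus \<epsilon>/2 from its mirror image,
  where u is 0. The maximum principle on the half ball, inside which \<open>cone_ext\<close> is C^2,
  gives the rest, and oddness transfers it to the lower half.\<close>

lemma harmonic_approximation:
  fixes u :: "(real ^ 'n::finite) \<times> real \<Rightarrow> real"
  assumes u: "u \<in> dirichlet_eigenspace \<mu>" and \<mu>: "\<mu> = \<alpha> * (\<alpha> + real CARD('n) - 1)" and \<alpha>: "\<alpha> > 0"
    and \<epsilon>: "\<epsilon> > 0"
  shows "\<exists>G. harmonic_poly G \<and> (\<forall>x. norm x \<le> 1 \<longrightarrow> \<bar>G x - odd_ext \<alpha> u x\<bar> \<le> \<epsilon>)"
proof -
  obtain p where p: "real_polynomial_function p" "\<And>x. x \<in> sphere 0 1 \<Longrightarrow> \<bar>u x - p x\<bar> < \<epsilon> / 2"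
    using Stone_Weierstrass_real_polynomial_function[OF _ eigenfunction_continuous_on_sphere[OF u], of "\<epsilon> / 2"] \<epsilon>
    by auto
  obtain q where q: "harmonic_poly q" "\<And>x. norm x = 1 \<Longrightarrow> q x = p x"
    using harmonic_extension_exists[OF p(1)] by blast
  define G where "G x = q x - q (mirror x)" for x
  have G: "harmonic_poly G" unfolding G_def by (intro harmonic_poly_diff harmonic_poly_mirror q(1))
  let ?D = "{x :: (real ^ 'n) \<times> real. norm x \<le> 1 \<and> snd x \<ge> 0}"
  let ?U = "{x :: (real ^ 'n) \<times> real. norm x < 1 \<and> snd x > 0}"
  have "closed ?D" unfolding Collect_conj_eq by (intro closed_Int closed_Collect_le continuous_intros)
  then have D: "compact ?D" by (intro compact_eq_bounded_closed[THEN iffD2] conjI bounded_subset[OF bounded_cball[of 0 1]]) auto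
  have U: "open ?U" unfolding Collect_conj_eq by (intro open_Int open_Collect_less continuous_intros)
  have hC: "C2_on (cone_ext \<alpha> u) ?U" by (rule C2_on_subset[OF cone_ext_harmonic(1)[OF u \<mu>]]) auto
  have GC: "C2_on G ?U" by (rule poly_C2[OF harmonic_polyD(1)[OF G]])
  have hc: "continuous_on ?D (cone_ext \<alpha> u)" "continuous_on ?D G"
    using cone_ext_continuous[OF u \<alpha>] continuous_on_subset poly_continuous[OF harmonic_polyD(1)[OF G]] by blast+
  have bd: "\<bar>cone_ext \<alpha> u x - G x\<bar> \<le> \<epsilon>" if x: "x \<in> ?D - ?U" for x
  proof (cases "norm x = 1")
    case True
    have "\<bar>u x - p x\<bar> < \<epsilon> / 2" "\<bar>u (mirror x) - p (mirror x)\<bar> < \<epsilon> / 2"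
      using p(2) True by auto
    moreover have "u (mirror x) = 0" using x by (intro dirichlet_eigenspaceD(2)[OF u]) simp
    moreover have "q x = p x" "q (mirror x) = p (mirror x)" using q(2) True by simp_all
    ultimately show ?thesis unfolding G_def cone_ext_unit[OF True] by linarith
  next
    case False
    then have "snd x = 0" using x by auto
    then have "mirror x = x" "cone_ext \<alpha> u x = 0" using cone_ext_lower[OF u] by (auto simp: mirror_def prod_eq_iff)
    then show ?thesis using \<epsilon> by (simp add: G_def)
  qed
  have up: "\<bar>cone_ext \<alpha> u x - G x\<bar> \<le> \<epsilon>" if x: "x \<in> ?D" for x
  proof -
    have "cone_ext \<alpha> u x - G x \<le> \<epsilon>"
    proof (rule weak_maximum_principle[OF D _ U])
      show "continuous_on ?D (\<lambda>x. cone_ext \<alpha> u x - G x)" by (intro continuous_intros hc)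
      show "C2_on (\<lambda>x. cone_ext \<alpha> u x - G x) ?U" by (rule C2_on_diff[OF U hC GC])
      show "laplacian (\<lambda>x. cone_ext \<alpha> u x - G x) x \<ge> 0" if "x \<in> ?U" for x
        using C2_on_diff(2)[OF U hC GC that] cone_ext_harmonic(2)[OF u \<mu>, of x] that harmonic_polyD(2)[OF G, of x] by simp
    qed (use bd x in \<open>force+\<close>)
    moreover have "G x - cone_ext \<alpha> u x \<le> \<epsilon>"
    proof (rule weak_maximum_principle[OF D _ U])
      show "continuous_on ?D (\<lambda>x. G x - cone_ext \<alpha> u x)" by (intro continuous_intros hc)
      show "C2_on (\<lambda>x. G x - cone_ext \<alpha> u x) ?U" by (rule C2_on_diff[OF U GC hC])
      show "laplacian (\<lambda>x. G x - cone_ext \<alpha> u x) x \<ge> 0" if "x \<in> ?U" for x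
        using C2_on_diff(2)[OF U GC hC that] cone_ext_harmonic(2)[OF u \<mu>, of x] that harmonic_polyD(2)[OF G, of x] by simp
    qed (use bd x in \<open>force+\<close>)
    ultimately show ?thesis by linarith
  qed
  have "\<bar>G x - odd_ext \<alpha> u x\<bar> \<le> \<epsilon>" if x: "norm x \<le> 1" for x
  proof (cases "snd x \<ge> 0")
    case True
    then have "cone_ext \<alpha> u (mirror x) = 0" by (intro cone_ext_lower[OF u]) simp
    then show ?thesis using up[of x] True x by (simp add: odd_ext_def abs_minus_commute)
  next
    case False
    then have "cone_ext \<alpha> u x = 0" by (intro cone_ext_lower[OF u]) simp
    then show ?thesis using up[of "mirror x"] False x by (simp add: odd_ext_def G_def)
  qed
  with G show ?thesis by blast
qed

theorem eigenfunction_is_harmonic: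
  fixes u :: "(real ^ 'n::finite) \<times> real \<Rightarrow> real"
  assumes u: "u \<in> dirichlet_eigenspace \<mu>" and nz: "u \<noteq> (\<lambda>x. 0)"
  shows "\<exists>K\<ge>1. \<exists>P. \<mu> = real K * (real K + real CARD('n) - 1) \<and> homog_poly K P \<and> harmonic_poly P \<and>
    (\<forall>x. snd x = 0 \<longrightarrow> P x = 0) \<and> u = (\<lambda>x. if x \<in> hemisphere then P x else 0)"
proof -
  have \<mu>0: "\<mu> > 0" using eigenfunction_zero_if_mu_nonpos[OF u] nz by (metis (no_types, lifting) ext not_le)
  define n where "n = real CARD('n)"
  have n: "n \<ge> 1" by (simp add: n_def Suc_le_eq)
  \<comment> \<open>The larger root of \<alpha> (\<alpha> + n - 1) = \<mu>, positive because \<mu> >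
    0.\<close>
  define \<alpha> where "\<alpha> = (sqrt ((n - 1)\<^sup>2 + 4 * \<mu>) - (n - 1)) / 2"
  have "sqrt ((n - 1)\<^sup>2) < sqrt ((n - 1)\<^sup>2 + 4 * \<mu>)" by (rule real_sqrt_less_mono) (use \<mu>0 in simp)
  then have \<alpha>: "\<alpha> > 0" using n by (simp add: \<alpha>_def)
  have "2 * \<alpha> + (n - 1) = sqrt ((n - 1)\<^sup>2 + 4 * \<mu>)" by (simp add: \<alpha>_def field_simps)
  then have "(2 * \<alpha> + (n - 1))\<^sup>2 = (n - 1)\<^sup>2 + 4 * \<mu>" using \<mu>0 by simp
  then have "4 * \<mu> = 4 * (\<alpha> * (\<alpha> + n - 1))" by (simp add: power2_eq_square algebra_simps)
  then have \<mu>: "\<mu> = \<alpha> * (\<alpha> + real CARD('n) - 1)" by (simp add: n_def)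
  define h where "h = odd_ext \<alpha> u"
  have hu: "h x = u x" if "x \<in> hemisphere" for x
  proof -
    have "cone_ext \<alpha> u (mirror x) = 0" using that by (intro cone_ext_lower[OF u]) (simp add: hemisphere_def)
    then show ?thesis using that by (simp add: h_def odd_ext_def cone_ext_unit hemisphere_def)
  qed
  have "\<forall>j::nat. \<exists>G. harmonic_poly G \<and> (\<forall>x. norm x \<le> 1 \<longrightarrow> \<bar>G x - h x\<bar> \<le> 1 / real (Suc j))"
    unfolding h_def by (intro allI harmonic_approximation[OF u \<mu> \<alpha>]) simp
  then obtain G where G: "\<And>j. harmonic_poly (G j)"
    "\<And>j x. norm x \<le> 1 \<Longrightarrow> \<bar>G j x - h x\<bar> \<le> 1 / real (Suc j)" by metis
  have "(\<forall>x. h x = 0) \<or> (\<exists>K. \<alpha> = real K \<and> homog_poly K h \<and> harmonic_poly h)"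
  proof (rule homogeneous_limit_of_harmonic_polys[OF G(1) _ _ \<alpha>])
    fix \<epsilon> :: real assume "\<epsilon> > 0"
    then obtain J where J: "inverse (real (Suc J)) < \<epsilon>" using reals_Archimedean by blast
    have "\<bar>G j x - h x\<bar> \<le> \<epsilon>" if "j \<ge> J" "norm x \<le> 1" for j x
    proof -
      have "1 / real (Suc j) \<le> 1 / real (Suc J)" using that by (intro divide_left_mono) auto
      then show ?thesis using G(2)[OF that(2), of j] J by (simp add: inverse_eq_divide)
    qed
    then show "\<exists>J. \<forall>j\<ge>J. \<forall>x. norm x \<le> 1 \<longrightarrow> \<bar>G j x - h x\<bar> \<le> \<epsilon>" by blast
  next
    fix c :: real and x :: "(real ^ 'n) \<times> real" assume "c > 0"
    then show "h (c *\<^sub>R x) = c powr \<alpha> * h x"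
      by (simp add: h_def odd_ext_def cone_ext_scale right_diff_distrib)
  qed
  moreover have "\<not> (\<forall>x. h x = 0)"
  proof
    assume z: "\<forall>x. h x = 0"
    have "u x = 0" for x
      using hu[of x] spec[OF z, of x] dirichlet_eigenspaceD(1)[OF u, of x] by (cases "x \<in> hemisphere") simp_all
    then show False using nz by auto
  qed
  ultimately obtain K where K: "\<alpha> = real K" "homog_poly K h" "harmonic_poly h" by blast
  have "h x = 0" if "snd x = 0" for x
  proof -
    have "mirror x = x" using that by (auto simp: mirror_def prod_eq_iff)
    then show ?thesis by (simp add: h_def odd_ext_def)
  qed
  moreover have "u = (\<lambda>x. if x \<in> hemisphere then h x else 0)"
    using hu dirichlet_eigenspaceD(1)[OF u] by auto
  moreover have "K \<ge> 1" using \<alpha> K(1) by simp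
  ultimately show ?thesis using K \<mu> by blast
qed

text \<open>Vanishing on the equator makes the extension by zero continuous on the closed
  hemisphere; the equation is the formula for the Laplacian of the extension constant along
  rays.\<close>

lemma harmonic_is_eigenfunction:
  fixes P :: "(real ^ 'n::finite) \<times> real \<Rightarrow> real"
  assumes P: "homog_poly K P" "harmonic_poly P" and P0: "\<And>x. snd x = 0 \<Longrightarrow> P x = 0"
  shows "(\<lambda>x. if x \<in> hemisphere then P x else 0) \<in> dirichlet_eigenspace (real K * (real K + real CARD('n) - 1))"
    (is "?u \<in> _")
proof -
  let ?H = "{x :: (real ^ 'n) \<times> real. snd x > 0}"
  let ?w = "\<lambda>x. (x \<bullet> x) powr (- real K / 2) * P x"
  have eq: "radial_ext ?u x = ?w x" if "x \<in> ?H" for x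
  proof -
    have x0: "x \<noteq> 0" using that by auto
    then have "x /\<^sub>R norm x \<in> hemisphere" using that by (simp add: hemisphere_def)
    then have "radial_ext ?u x = inverse (norm x) ^ K * P x"
      by (simp add: radial_ext_def homog_polyD(2)[OF P(1)])
    also have "inverse (norm x) ^ K = (x \<bullet> x) powr (- real K / 2)"
    proof -
      have "x \<bullet> x = norm x powr 2" using x0 by (simp add: dot_square_norm)
      then have "(x \<bullet> x) powr (- real K / 2) = norm x powr (- real K)" by (simp only: powr_powr) simp
      also have "\<dots> = inverse (norm x) ^ K" using x0 by (simp only: powr_minus) (simp add: powr_realpow power_inverse)
      finally show ?thesis ..
    qed
    finally show ?thesis .
  qed
  note w = homog_harmonic_laplacian_on_sphere[OF P]
  have wC: "C2_on ?w ?H" by (rule C2_on_subset[OF w(1)]) auto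
  have "C2_on (radial_ext ?u) ?H"
    using C2_on_cong[OF open_upper, of "radial_ext ?u" ?w] eq wC by blast
  moreover have "sphere_laplacian ?u x + real K * (real K + real CARD('n) - 1) * ?u x = 0" if x: "x \<in> hemisphere" for x
  proof -
    have xH: "x \<in> ?H" "norm x = 1" using x by (auto simp: hemisphere_def)
    have "sphere_laplacian ?u x = laplacian ?w x"
      unfolding sphere_laplacian_def by (rule laplacian_cong[OF open_upper xH(1) eq])
    then show ?thesis using w(2)[OF xH(2)] x by (simp add: algebra_simps)
  qed
  moreover have "continuous_on (closure hemisphere) ?u"
  proof (rule continuous_on_eq[OF poly_continuous[OF homog_polyD(1)[OF P(1)]]])
    fix x :: "(real ^ 'n) \<times> real" assume "x \<in> closure hemisphere"
    then have "norm x = 1" "snd x \<ge> 0" unfolding closure_hemisphere by simp_all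
    then show "P x = ?u x" using P0[of x] by (auto simp: hemisphere_def)
  qed
  ultimately show ?thesis unfolding dirichlet_eigenspace_def by simp
qed

text \<open>Induction on the set of variables. As a function of the variable j the sum is a
  polynomial, so its coefficients, which collect the exponent vectors with a fixed value of a j,
  vanish for all values of the other variables.\<close>

lemma monomial_coeffs_zero:
  fixes c :: "('i \<Rightarrow> nat) \<Rightarrow> real"
  assumes "finite I" "finite A" "\<And>a i. a \<in> A \<Longrightarrow> i \<notin> I \<Longrightarrow> a i = 0"
    and "\<And>x. (\<Sum>a\<in>A. c a * (\<Prod>i\<in>I. x i ^ a i)) = 0"
  shows "\<forall>a\<in>A. c a = 0"
  using assms
proof (induction I arbitrary: A c)
  case empty
  then have "A \<subseteq> {\<lambda>i. 0}" by auto
  then consider "A = {}" | "A = {\<lambda>i. 0}" by blast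
  then show ?case using empty(3) by cases auto
next
  case (insert j I)
  define d where "d = Max ((\<lambda>a. a j) ` A)"
  have d: "a j \<le> d" if "a \<in> A" for a using that insert.prems(1) by (simp add: d_def)
  have inner: "(\<Sum>a\<in>{a\<in>A. a j = k}. c a * (\<Prod>i\<in>I. x i ^ a i)) = 0" if k: "k \<le> d" for k x
  proof -
    have "(\<Sum>k\<le>d. (\<Sum>a\<in>{a\<in>A. a j = k}. c a * (\<Prod>i\<in>I. x i ^ a i)) * s ^ k) = 0" for s
    proof -
      have "0 = (\<Sum>a\<in>A. c a * (\<Prod>i\<in>insert j I. (x(j := s)) i ^ a i))" using insert.prems(3)[of "x(j := s)"] by simp
      also have "\<dots> = (\<Sum>a\<in>A. c a * (\<Prod>i\<in>I. x i ^ a i) * s ^ a j)"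
      proof (intro sum.cong refl)
        fix a
        have "(\<Prod>i\<in>I. (x(j := s)) i ^ a i) = (\<Prod>i\<in>I. x i ^ a i)"
          using insert.hyps(2) by (intro prod.cong) auto
        then show "c a * (\<Prod>i\<in>insert j I. (x(j := s)) i ^ a i) = c a * (\<Prod>i\<in>I. x i ^ a i) * s ^ a j"
          using insert.hyps by simp
      qed
      also have "\<dots> = (\<Sum>k\<le>d. \<Sum>a\<in>{a\<in>A. a j = k}. c a * (\<Prod>i\<in>I. x i ^ a i) * s ^ a j)"
        using insert.prems(1) d by (intro sum.group[symmetric]) auto
      also have "\<dots> = (\<Sum>k\<le>d. (\<Sum>a\<in>{a\<in>A. a j = k}. c a * (\<Prod>i\<in>I. x i ^ a i)) * s ^ k)"
        unfolding sum_distrib_right by (intro sum.cong refl) auto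
      finally show ?thesis by simp
    qed
    then show ?thesis
      using polyfun_eq_0[of "\<lambda>k. (\<Sum>a\<in>{a\<in>A. a j = k}. c a * (\<Prod>i\<in>I. x i ^ a i))" d] k by blast
  qed
  show ?case
  proof
    fix a assume a: "a \<in> A"
    define k where "k = a j"
    \<comment> \<open>Erasing the exponent of j makes the vectors supported in \<open>I\<close>, as
      the induction hypothesis requires; it equals k throughout this class, so nothing is
      lost.\<close>
    define A' where "A' = (\<lambda>a. a(j := 0)) ` {a\<in>A. a j = k}"
    have inj: "inj_on (\<lambda>a. a(j := 0)) {a\<in>A. a j = k}"
      by (intro inj_onI) (metis (mono_tags, lifting) fun_upd_triv fun_upd_upd mem_Collect_eq)
    have "\<forall>a\<in>A'. c (a(j := k)) = 0"
    proof (rule insert.IH)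
      show "finite A'" using insert.prems(1) by (simp add: A'_def)
      show "a i = 0" if "a \<in> A'" "i \<notin> I" for a i
        using that insert.prems(2) by (auto simp: A'_def)
      fix x :: "'i \<Rightarrow> real"
      have "(\<Sum>a\<in>A'. c (a(j := k)) * (\<Prod>i\<in>I. x i ^ a i))
          = (\<Sum>a\<in>{a\<in>A. a j = k}. c (a(j := k)) * (\<Prod>i\<in>I. x i ^ (a(j := 0)) i))"
        unfolding A'_def by (subst sum.reindex[OF inj]) simp
      also have "\<dots> = (\<Sum>a\<in>{a\<in>A. a j = k}. c a * (\<Prod>i\<in>I. x i ^ a i))"
      proof (intro sum.cong refl)
        fix a assume "a \<in> {a\<in>A. a j = k}"
        then have "a(j := k) = a" by auto
        moreover have "(\<Prod>i\<in>I. x i ^ (a(j := 0)) i) = (\<Prod>i\<in>I. x i ^ a i)"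
          using insert.hyps(2) by (intro prod.cong) auto
        ultimately show "c (a(j := k)) * (\<Prod>i\<in>I. x i ^ (a(j := 0)) i) = c a * (\<Prod>i\<in>I. x i ^ a i)" by simp
      qed
      also have "\<dots> = 0" using inner[of k x] d[OF a] by (simp add: k_def)
      finally show "(\<Sum>a\<in>A'. c (a(j := k)) * (\<Prod>i\<in>I. x i ^ a i)) = 0" .
    qed
    moreover have "a(j := 0) \<in> A'" using a by (auto simp: A'_def k_def)
    ultimately have "c ((a(j := 0))(j := k)) = 0" by blast
    then show "c a = 0" by (simp add: k_def)
  qed
qed

section \<open>Exponent vectors and the dimension of homogeneous polynomials\<close>

definition exponents :: "nat \<Rightarrow> ('a::euclidean_space \<Rightarrow> nat) set" where
  "exponents k = {a. (\<forall>b. b \<notin> Basis \<longrightarrow> a b = 0) \<and> (\<Sum>b\<in>Basis. a b) = k}"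

definition monomial :: "('a::euclidean_space \<Rightarrow> nat) \<Rightarrow> 'a \<Rightarrow> real" where
  "monomial a x = (\<Prod>b\<in>Basis. (x \<bullet> b) ^ a b)"

text \<open>An enumeration of the basis turns exponent vectors into lists of naturals with
  prescribed length and sum, whose number is known.\<close>

lemma exponents_bij:
  obtains f where "bij_betw f (exponents k :: ('a::euclidean_space \<Rightarrow> nat) set)
    {l::nat list. length l = DIM('a) \<and> sum_list l = k}"
proof -
  obtain bs where bs: "set bs = (Basis :: 'a set)" "distinct bs"
    using finite_distinct_list[OF finite_Basis] by blast
  have len: "length bs = DIM('a)" using distinct_card[OF bs(2)] bs(1) by simp
  have "bij_betw (\<lambda>a. map a bs) (exponents k) {l::nat list. length l = DIM('a) \<and> sum_list l = k}"
    unfolding bij_betw_def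
  proof (intro conjI subset_antisym subsetI inj_onI)
    fix a a' :: "'a \<Rightarrow> nat" assume "a \<in> exponents k" "a' \<in> exponents k" "map a bs = map a' bs"
    then show "a = a'" using bs(1) by (auto simp: exponents_def fun_eq_iff)
  next
    fix l assume "l \<in> (\<lambda>a. map a bs) ` exponents k"
    then show "l \<in> {l. length l = DIM('a) \<and> sum_list l = k}"
      using sum_list_distinct_conv_sum_set[OF bs(2)] bs(1) len by (auto simp: exponents_def)
  next
    fix l :: "nat list" assume l: "l \<in> {l. length l = DIM('a) \<and> sum_list l = k}"
    define a where "a b = (case map_of (zip bs l) b of None \<Rightarrow> 0 | Some v \<Rightarrow> v)" for b
    have "map a bs = l"
    proof (rule nth_equalityI)
      show "length (map a bs) = length l" using l len by simp
      fix i assume "i < length (map a bs)"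
      then show "map a bs ! i = l ! i"
        using map_of_zip_nth[of bs l i] bs(2) l len by (simp add: a_def)
    qed
    moreover have "a \<in> exponents k"
    proof -
      have "a b = 0" if "b \<notin> Basis" for b
      proof -
        have "map_of (zip bs l) b = None" using map_of_zip_is_None[of bs l b] that bs(1) l len by simp
        then show ?thesis by (simp add: a_def)
      qed
      moreover have "(\<Sum>b\<in>Basis. a b) = k"
        using sum_list_distinct_conv_sum_set[OF bs(2), of a] bs(1) \<open>map a bs = l\<close> l by simp
      ultimately show ?thesis by (simp add: exponents_def)
    qed
    ultimately show "l \<in> (\<lambda>a. map a bs) ` exponents k" by blast
  qed
  then show ?thesis by (rule that)
qed

lemma card_exponents: "card (exponents k :: ('a::euclidean_space \<Rightarrow> nat) set) = (k + DIM('a) - 1) choose k"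
proof -
  obtain f where "bij_betw f (exponents k :: ('a \<Rightarrow> nat) set) {l::nat list. length l = DIM('a) \<and> sum_list l = k}"
    by (rule exponents_bij)
  from bij_betw_same_card[OF this] show ?thesis
    by (simp only: card_length_sum_list)
qed

lemma finite_exponents: "finite (exponents k :: ('a::euclidean_space \<Rightarrow> nat) set)"
proof (rule card_ge_0_finite)
  show "0 < card (exponents k :: ('a \<Rightarrow> nat) set)" unfolding card_exponents
    using DIM_positive[where 'a='a] by (intro zero_less_binomial) linarith
qed

lemma monomial_independent:
  fixes A :: "('a::euclidean_space \<Rightarrow> nat) set"
  assumes A: "A \<subseteq> exponents k" and s: "\<And>x. (\<Sum>a\<in>A. c a * monomial a x) = 0" and a: "a \<in> A"
  shows "c a = 0"
proof -
  have "\<forall>a\<in>A. c a = 0"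
  proof (rule monomial_coeffs_zero[OF finite_Basis])
    show "finite A" using A finite_exponents finite_subset by blast
    show "a b = 0" if "a \<in> A" "b \<notin> Basis" for a b using that A by (auto simp: exponents_def)
    fix x :: "'a \<Rightarrow> real"
    define y where "y = (\<Sum>b\<in>Basis. x b *\<^sub>R b)"
    have "y \<bullet> b = x b" if "b \<in> Basis" for b using that by (simp add: y_def inner_sum_left_Basis)
    then have "monomial a y = (\<Prod>b\<in>Basis. x b ^ a b)" for a by (simp add: monomial_def)
    then show "(\<Sum>a\<in>A. c a * (\<Prod>b\<in>Basis. x b ^ a b)) = 0" using s[of y] by simp
  qed
  then show ?thesis using a by blast
qed

lemma monomial_inj: "inj_on monomial (exponents k :: ('a::euclidean_space \<Rightarrow> nat) set)"
proof (rule inj_onI, rule ccontr)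
  fix a a' :: "'a \<Rightarrow> nat"
  assume a: "a \<in> exponents k" "a' \<in> exponents k" "monomial a = monomial a'" "a \<noteq> a'"
  let ?c = "\<lambda>d. if d = a then 1 else (-1 :: real)"
  have "?c a = 0"
    by (rule monomial_independent[of "{a, a'}" k]) (use a in auto)
  then show False by simp
qed

lemma homog_poly_monomial:
  fixes a :: "'a::euclidean_space \<Rightarrow> nat"
  assumes "a \<in> exponents k" shows "homog_poly k (monomial a)"
proof -
  have lin: "real_polynomial_function (\<lambda>x::'a. x \<bullet> b)" for b
    by (rule poly_linear[OF bounded_linear_inner_left])
  have "real_polynomial_function (\<lambda>x. \<Prod>b\<in>Basis. (x \<bullet> b) ^ a b)"
    by (rule real_polynomial_function_prod[OF finite_Basis real_polynomial_function_power[OF lin]])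
  moreover have "monomial a (c *\<^sub>R x) = c ^ k * monomial a x" for c x
    using assms by (simp add: monomial_def exponents_def power_mult_distrib prod.distrib power_sum[symmetric])
  ultimately show ?thesis by (simp add: homog_poly_def monomial_def[abs_def])
qed

lemma monomials_eq: "monomials k \<subseteq> monomial ` (exponents k :: ('a::euclidean_space \<Rightarrow> nat) set)"
proof (induction k)
  case 0
  have "monomial (\<lambda>b. 0) = (\<lambda>x::'a. 1)" by (rule ext) (simp add: monomial_def)
  moreover have "(\<lambda>b. 0) \<in> exponents 0" by (simp add: exponents_def)
  ultimately have "(\<lambda>x::'a. 1) \<in> monomial ` exponents 0" by (metis image_eqI)
  then show ?case by simp
next
  case (Suc k)
  have "(\<lambda>x. (x \<bullet> b) * monomial a x) \<in> monomial ` exponents (Suc k)"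
    if b: "b \<in> Basis" and a: "a \<in> exponents k" for b and a :: "'a \<Rightarrow> nat"
  proof
    show "(\<lambda>x. (x \<bullet> b) * monomial a x) = monomial (a(b := Suc (a b)))"
    proof
      fix x
      have "(\<Prod>c\<in>Basis - {b}. (x \<bullet> c) ^ (a(b := Suc (a b))) c) = (\<Prod>c\<in>Basis - {b}. (x \<bullet> c) ^ a c)"
        by (intro prod.cong) auto
      then show "(x \<bullet> b) * monomial a x = monomial (a(b := Suc (a b))) x"
        unfolding monomial_def by (simp add: prod.remove[OF finite_Basis b])
    qed
    have "(\<Sum>c\<in>Basis - {b}. (a(b := Suc (a b))) c) = (\<Sum>c\<in>Basis - {b}. a c)"
      by (intro sum.cong) auto
    then have "(\<Sum>c\<in>Basis. (a(b := Suc (a b))) c) = Suc (\<Sum>c\<in>Basis. a c)"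
      by (simp add: sum.remove[OF finite_Basis b])
    then show "a(b := Suc (a b)) \<in> exponents (Suc k)" using a b by (auto simp: exponents_def)
  qed
  then show ?case using Suc by auto
qed

lemma homog_poly_basis:
  fixes k :: nat
  defines "B \<equiv> monomial ` (exponents k :: ('a::euclidean_space \<Rightarrow> nat) set)"
  shows "finite B" "card B = (k + DIM('a) - 1) choose k" "fun_space.independent B"
    "fun_space.span B = {f. homog_poly k f}"
proof -
  show fin: "finite B" unfolding B_def using finite_exponents by (rule finite_imageI)
  show "card B = (k + DIM('a) - 1) choose k"
    unfolding B_def card_image[OF monomial_inj] by (rule card_exponents)
  show "fun_space.independent B"
  proof (rule fun_space.independent_if_scalars_zero[OF fin])
    fix f m assume f: "(\<Sum>m\<in>B. (\<lambda>x. f m * m x)) = 0" and m: "m \<in> B"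
    then obtain a where a: "a \<in> exponents k" "m = monomial a" by (auto simp: B_def)
    have "(\<Sum>a\<in>exponents k. f (monomial a) * monomial a x) = 0" for x
      using fun_cong[OF f, of x] by (simp add: B_def sum.reindex[OF monomial_inj] fsum_apply)
    then have "f (monomial a) = 0"
      by (rule monomial_independent[OF subset_refl _ a(1), where c="\<lambda>a. f (monomial a)"])
    then show "f m = 0" by (simp add: a(2))
  qed
  show "fun_space.span B = {f. homog_poly k f}"
  proof
    have "fun_space.subspace {f :: 'a \<Rightarrow> real. homog_poly k f}"
      by (rule fun_space.subspaceI) (auto simp: plus_fun_def zero_fun_def homog_poly_add homog_poly_cmult)
    then show "fun_space.span B \<subseteq> {f. homog_poly k f}"
      by (intro fun_space.span_minimal) (auto simp: B_def homog_poly_monomial)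
    show "{f. homog_poly k f} \<subseteq> fun_space.span B"
      using homog_poly_span fun_space.span_mono[OF monomials_eq[of k]] by (auto simp: B_def)
  qed
qed

section \<open>Multiplicities\<close>

lemma partial_deriv_fst:
  fixes g :: "'b::euclidean_space \<Rightarrow> real" and v :: "'b \<times> real"
  assumes "real_polynomial_function g"
  shows "partial_deriv v (\<lambda>x. g (fst x)) = (\<lambda>x. partial_deriv (fst v) g (fst x))"
proof
  fix x :: "'b \<times> real"
  show "partial_deriv v (\<lambda>x. g (fst x)) x = partial_deriv (fst v) g (fst x)"
    by (rule partial_deriv_eq)
       (rule has_derivative_compose[OF bounded_linear_imp_has_derivative[OF bounded_linear_fst]
             has_derivative_partial[OF poly_differentiable[OF assms]]])
qed

lemma partial_deriv_zero:
  fixes g :: "'b::euclidean_space \<Rightarrow> real"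
  assumes "real_polynomial_function g" shows "partial_deriv 0 g = (\<lambda>x. 0)"
  using linear_0[OF linear_frechet_derivative[OF poly_differentiable[OF assms]]] by (auto simp: partial_deriv_def)

lemma partial_deriv_snd_power:
  "partial_deriv v (\<lambda>x :: 'b::euclidean_space \<times> real. snd x ^ i) = (\<lambda>x. real i * snd v * snd x ^ (i - 1))"
proof
  fix x :: "'b \<times> real"
  show "partial_deriv v (\<lambda>x. snd x ^ i) x = real i * snd v * snd x ^ (i - 1)"
    by (rule partial_deriv_eq) (auto intro!: derivative_eq_intros simp: fun_eq_iff)
qed

lemma laplacian_prod:
  fixes f :: "'b::euclidean_space \<times> real \<Rightarrow> real"
  shows "laplacian f x = (\<Sum>b\<in>Basis. partial_deriv (b, 0) (partial_deriv (b, 0) f) x)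
    + partial_deriv (0, 1) (partial_deriv (0, 1) f) x"
proof -
  have "(\<Sum>b\<in>Basis. h b) = (\<Sum>b\<in>Basis. h (b, 0)) + h (0, 1)" for h :: "'b \<times> real \<Rightarrow> real"
  proof -
    have B: "(Basis :: ('b \<times> real) set) = (\<lambda>b. (b, 0)) ` Basis \<union> {(0, 1)}" by (auto simp: Basis_prod_def)
    have "(\<Sum>b\<in>Basis. h b) = (\<Sum>b\<in>(\<lambda>b. (b, 0)) ` Basis. h b) + h (0, 1)"
      unfolding B by (subst sum.union_disjoint) auto
    also have "(\<Sum>b\<in>(\<lambda>b. (b, 0)) ` Basis. h b) = (\<Sum>b\<in>Basis. h (b, 0))"
      by (subst sum.reindex) (auto simp: inj_on_def)
    finally show ?thesis .
  qed
  then show ?thesis unfolding laplacian_def .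
qed

lemma poly_fst: "real_polynomial_function g \<Longrightarrow> real_polynomial_function (\<lambda>x :: 'b::euclidean_space \<times> real. g (fst x))"
  by (rule poly_comp_linear[OF _ bounded_linear_fst])

lemma poly_snd: "real_polynomial_function (\<lambda>x :: 'b::euclidean_space \<times> real. snd x ^ i)"
  by (rule real_polynomial_function_power[OF poly_linear[OF bounded_linear_snd]])

lemma partial_deriv_snd_power_fst:
  fixes g :: "'b::euclidean_space \<Rightarrow> real" and v :: "'b \<times> real"
  assumes g: "real_polynomial_function g"
  shows "partial_deriv v (\<lambda>x. snd x ^ i * g (fst x)) =
    (\<lambda>x. snd x ^ i * partial_deriv (fst v) g (fst x) + (real i * snd v) * (snd x ^ (i - 1) * g (fst x)))"
  by (rule ext, subst partial_deriv_mult)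
     (simp_all only: partial_deriv_fst[OF g] partial_deriv_snd_power poly_differentiable[OF poly_fst[OF g]]
       poly_differentiable[OF poly_snd] mult.assoc)

lemma laplacian_snd_power_fst:
  fixes g :: "'b::euclidean_space \<Rightarrow> real"
  assumes g: "real_polynomial_function g"
  shows "laplacian (\<lambda>x. snd x ^ i * g (fst x)) x =
    snd x ^ i * laplacian g (fst x) + real i * real (i - 1) * snd x ^ (i - 2) * g (fst x)"
proof -
  note p = poly_mult[OF poly_snd poly_fst]
  have "partial_deriv (b, 0) (\<lambda>x. snd x ^ i * g (fst x)) = (\<lambda>x. snd x ^ i * partial_deriv b g (fst x))" for b
    by (simp add: partial_deriv_snd_power_fst[OF g])
  then have 1: "partial_deriv (b, 0) (partial_deriv (b, 0) (\<lambda>x. snd x ^ i * g (fst x))) x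
      = snd x ^ i * partial_deriv b (partial_deriv b g) (fst x)" for b
    by (simp add: partial_deriv_snd_power_fst[OF poly_partial_deriv[OF g]])
  have "partial_deriv (0, 1) (\<lambda>x. snd x ^ j * g (fst x)) = (\<lambda>x. real j * (snd x ^ (j - 1) * g (fst x)))" for j
    by (simp add: partial_deriv_snd_power_fst[OF g] partial_deriv_zero[OF g])
  then have 2: "partial_deriv (0, 1) (partial_deriv (0, 1) (\<lambda>x. snd x ^ i * g (fst x))) x
      = real i * (real (i - 1) * (snd x ^ (i - 2) * g (fst x)))"
    by (simp add: partial_deriv_cmult[OF poly_differentiable[OF p[OF g]]] numeral_2_eq_2)
  show ?thesis unfolding laplacian_prod 1 2 by (simp add: laplacian_def sum_distrib_left)
qed

lemma homog_poly_laplacian_low: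
  assumes "homog_poly k f" "k \<le> 1" shows "laplacian f = (\<lambda>x. 0)"
proof -
  have "homog_poly 0 (partial_deriv b f)" for b
    using homog_poly_partial_deriv'[OF assms(1), of b] assms(2) by simp
  then show ?thesis by (simp add: laplacian_def[abs_def] homog_poly_0_partial_deriv)
qed

text \<open>Cauchy--Kovalevskaya: \<open>\<Sum>\<^sub>i t\<^sup>i ck_coeff q i y\<close> is the harmonic function with Cauchy data \<open>0\<close>
  and \<open>q\<close> on the hyperplane \<open>t = 0\<close>.\<close>

fun ck_coeff :: "('b::euclidean_space \<Rightarrow> real) \<Rightarrow> nat \<Rightarrow> 'b \<Rightarrow> real" where
  "ck_coeff q 0 = (\<lambda>y. 0)"
| "ck_coeff q (Suc 0) = q"
| "ck_coeff q (Suc (Suc i)) = (\<lambda>y. - 1 / (real (Suc i) * real (Suc (Suc i))) * laplacian (ck_coeff q i) y)"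

text \<open>For q of degree K - 1 with K \<ge> 1 the coefficient of t^i has degree K - i, so the
  series stops at i = K.\<close>

definition ck_ext :: "nat \<Rightarrow> ('b::euclidean_space \<Rightarrow> real) \<Rightarrow> 'b \<times> real \<Rightarrow> real" where
  "ck_ext K q x = (\<Sum>i\<le>K. snd x ^ i * ck_coeff q i (fst x))"

lemma homog_ck_coeff: "homog_poly (K - 1) q \<Longrightarrow> homog_poly (K - i) (ck_coeff q i)"
proof (induction q i rule: ck_coeff.induct)
  case (3 q i)
  have e: "K - Suc (Suc i) = K - i - 2" by simp
  show ?case unfolding ck_coeff.simps e
    by (rule homog_poly_cmult[OF homog_poly_laplacian[OF "3.IH"[OF "3.prems"]]])
qed simp_all

lemma ck_coeff_linear:
  assumes "homog_poly k f" "homog_poly k g"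
  shows "ck_coeff (\<lambda>y. f y + g y) i = (\<lambda>y. ck_coeff f i y + ck_coeff g i y)"
    and "ck_coeff (\<lambda>y. c * f y) i = (\<lambda>y. c * ck_coeff f i y)"
proof -
  have p: "real_polynomial_function (ck_coeff h i)" if "homog_poly k h" for h i
    using homog_polyD(1)[OF homog_ck_coeff[of "Suc k" h i]] that by simp
  show "ck_coeff (\<lambda>y. f y + g y) i = (\<lambda>y. ck_coeff f i y + ck_coeff g i y)"
  proof (induction i rule: less_induct)
    case (less i)
    show ?case
    proof (cases "(f, i)" rule: ck_coeff.cases)
      case (3 q j)
      then have i: "i = Suc (Suc j)" by simp
      have IH: "ck_coeff (\<lambda>y. f y + g y) j = (\<lambda>y. ck_coeff f j y + ck_coeff g j y)" by (rule less.IH) (simp add: i)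
      show ?thesis unfolding i ck_coeff.simps IH
        by (rule ext) (simp only: laplacian_poly_simps(1)[OF p[OF assms(1)] p[OF assms(2)]] distrib_left)
    qed auto
  qed
  show "ck_coeff (\<lambda>y. c * f y) i = (\<lambda>y. c * ck_coeff f i y)"
  proof (induction i rule: less_induct)
    case (less i)
    show ?case
    proof (cases "(f, i)" rule: ck_coeff.cases)
      case (3 q j)
      then have i: "i = Suc (Suc j)" by simp
      have IH: "ck_coeff (\<lambda>y. c * f y) j = (\<lambda>y. c * ck_coeff f j y)" by (rule less.IH) (simp add: i)
      show ?thesis unfolding i ck_coeff.simps IH
        by (rule ext) (simp only: laplacian_poly_simps(3)[OF p[OF assms(1)] p[OF assms(1)]] mult.left_commute)
    qed auto
  qed
qed

text \<open>The recursion makes the second normal derivative of term i + 2 cancel the tangential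
  Laplacian of term i. The top terms have no partner, but their coefficients have degree at most 1,
  so their Laplacians vanish.\<close>

lemma ck_ext_homog_harmonic:
  fixes q :: "'b::euclidean_space \<Rightarrow> real"
  assumes q: "homog_poly (K - 1) q"
  shows "homog_poly K (ck_ext K q)" "harmonic_poly (ck_ext K q)"
proof -
  note f = homog_ck_coeff[OF q]
  have homog: "homog_poly K (\<lambda>x :: 'b \<times> real. snd x ^ i * ck_coeff q i (fst x))" if "i \<le> K" for i
    unfolding homog_poly_def
  proof (intro conjI allI)
    show "real_polynomial_function (\<lambda>x :: 'b \<times> real. snd x ^ i * ck_coeff q i (fst x))"
      by (rule poly_mult[OF poly_snd poly_fst[OF homog_polyD(1)[OF f]]])
    fix c :: real and x :: "'b \<times> real"
    have "c ^ K = c ^ i * c ^ (K - i)" using that by (simp add: power_add[symmetric])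
    then show "snd (c *\<^sub>R x) ^ i * ck_coeff q i (fst (c *\<^sub>R x)) = c ^ K * (snd x ^ i * ck_coeff q i (fst x))"
      by (simp add: homog_polyD(2)[OF f] power_mult_distrib)
  qed
  show 1: "homog_poly K (ck_ext K q)"
    unfolding ck_ext_def[abs_def] by (rule homog_poly_sum) (simp_all add: homog)
  have pf: "real_polynomial_function (\<lambda>x :: 'b \<times> real. snd x ^ i * ck_coeff q i (fst x))" for i
    by (rule poly_mult[OF poly_snd poly_fst[OF homog_polyD(1)[OF f]]])
  have sum: "laplacian (\<lambda>x. \<Sum>i\<in>I. snd x ^ i * ck_coeff q i (fst x)) x
      = (\<Sum>i\<in>I. laplacian (\<lambda>x. snd x ^ i * ck_coeff q i (fst x)) x)" if "finite I" for I and x :: "'b \<times> real"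
    using that
  proof (induction I)
    case empty
    then show ?case by (simp add: laplacian_const)
  next
    case (insert i I)
    have "real_polynomial_function (\<lambda>x :: 'b \<times> real. \<Sum>i\<in>I. snd x ^ i * ck_coeff q i (fst x))"
      by (rule real_polynomial_function_sum[OF insert(1) pf])
    then show ?case using insert by (simp add: laplacian_poly_simps(1)[OF pf])
  qed
  have "laplacian (ck_ext K q) x = 0" for x
  proof -
    define T where "T i = snd x ^ i * laplacian (ck_coeff q i) (fst x)" for i
    have T0: "T i = 0" if "i \<ge> K - 1" for i
    proof -
      have "K - i \<le> 1" using that by simp
      then show ?thesis using homog_poly_laplacian_low[OF f, of i] by (simp add: T_def)
    qed
    have step: "real (Suc (Suc i)) * real (Suc (Suc i) - 1) * snd x ^ (Suc (Suc i) - 2) * ck_coeff q (Suc (Suc i)) (fst x) = - T i" for i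
    proof -
      have "real (Suc (Suc i)) * real (Suc i) * (- 1 / (real (Suc i) * real (Suc (Suc i)))) = -1"
        by (simp add: field_simps del: of_nat_Suc)
      then have "real (Suc (Suc i)) * real (Suc i) * (- 1 / (real (Suc i) * real (Suc (Suc i)))) * T i = -1 * T i"
        by (simp only:)
      then show ?thesis by (simp add: T_def mult_ac del: of_nat_Suc)
    qed
    have "laplacian (ck_ext K q) x = (\<Sum>i\<le>K. T i + real i * real (i - 1) * snd x ^ (i - 2) * ck_coeff q i (fst x))"
      unfolding ck_ext_def[abs_def] sum[OF finite_atMost] laplacian_snd_power_fst[OF homog_polyD(1)[OF f]] T_def ..
    also have "\<dots> = (\<Sum>i\<le>K. T i) + (\<Sum>i\<le>K. real i * real (i - 1) * snd x ^ (i - 2) * ck_coeff q i (fst x))"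
      by (rule sum.distrib)
    also have "(\<Sum>i\<le>K. real i * real (i - 1) * snd x ^ (i - 2) * ck_coeff q i (fst x)) = (\<Sum>i<K - 1. - T i)"
    proof (cases "K \<le> 1")
      case True
      then have "K = 0 \<or> K = 1" by auto
      then show ?thesis by auto
    next
      case False
      then obtain m where m: "K = Suc (Suc m)" by (metis One_nat_def Suc_leI le_add_diff_inverse2 linorder_not_le nat_less_le not0_implies_Suc not_less_eq_eq zero_le)
      show ?thesis unfolding m sum.atMost_Suc_shift step[symmetric]
        by (simp add: lessThan_Suc_atMost del: of_nat_Suc ck_coeff.simps(3))
    qed
    also have "(\<Sum>i\<le>K. T i) = (\<Sum>i<K - 1. T i)"
      by (rule sum.mono_neutral_right) (auto intro!: T0)
    finally show ?thesis by (simp add: sum_negf)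
  qed
  then show "harmonic_poly (ck_ext K q)" using homog_polyD(1)[OF 1] unfolding harmonic_poly_def by blast
qed

lemma ck_ext_data:
  fixes q :: "'b::euclidean_space \<Rightarrow> real"
  assumes q: "homog_poly (K - 1) q" and K: "K \<ge> 1"
  shows "snd x = 0 \<Longrightarrow> ck_ext K q x = 0" "partial_deriv (0, 1) (ck_ext K q) (y, 0) = q y"
proof -
  note f = homog_ck_coeff[OF q]
  show "ck_ext K q x = 0" if "snd x = 0"
    unfolding ck_ext_def by (rule sum.neutral) (auto simp: that power_0_left)
  have "partial_deriv (0, 1) (ck_ext K q) (y, 0)
      = (\<Sum>i\<le>K. partial_deriv (0, 1) (\<lambda>x. snd x ^ i * ck_coeff q i (fst x)) (y, 0))"
    unfolding ck_ext_def[abs_def]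
    by (rule partial_deriv_sum) (rule poly_differentiable, rule poly_mult[OF poly_snd poly_fst[OF homog_polyD(1)[OF f]]])
  also have "\<dots> = (\<Sum>i\<le>K. real i * 0 ^ (i - 1) * ck_coeff q i y)"
    by (simp add: partial_deriv_snd_power_fst[OF homog_polyD(1)[OF f]] partial_deriv_zero[OF homog_polyD(1)[OF f]] mult.assoc)
  \<comment> \<open>The factor i removes i = 0, where the truncated exponent i - 1 gives 0^0 =
    1.\<close>
  also have "\<dots> = (\<Sum>i\<in>{1}. real i * 0 ^ (i - 1) * ck_coeff q i y)"
    using K by (intro sum.mono_neutral_right) (auto simp: power_0_left)
  finally show "partial_deriv (0, 1) (ck_ext K q) (y, 0) = q y" by simp
qed

text \<open>Harmonicity trades two normal derivatives for tangential ones, and tangential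
  derivatives of a function that is 0 on the hyperplane are 0 there. So all normal derivatives
  vanish on the hyperplane, and the Taylor expansion in the normal direction ends at order
  K.\<close>

lemma harmonic_cauchy_unique:
  fixes D :: "'b::euclidean_space \<times> real \<Rightarrow> real"
  assumes D: "homog_poly K D" "harmonic_poly D"
    and D0: "\<And>y. D (y, 0) = 0" and D1: "\<And>y. partial_deriv (0, 1) D (y, 0) = 0"
  shows "D x = 0"
proof -
  let ?e = "(0, 1) :: 'b \<times> real"
  note Dp = homog_polyD(1)[OF D(1)]
  have tang: "partial_deriv (b, 0) g (y, 0) = 0"
    if g: "real_polynomial_function g" "\<And>y. g (y, 0) = 0" for g :: "'b \<times> real \<Rightarrow> real" and b y
  proof -
    have "((\<lambda>s. g ((y, 0) + s *\<^sub>R (b, 0))) has_real_derivative partial_deriv (b, 0) g ((y, 0) + 0 *\<^sub>R (b, 0))) (at 0)"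
      by (rule partial_deriv_along) (rule poly_differentiable[OF g(1)])
    then have "((\<lambda>s::real. 0::real) has_real_derivative partial_deriv (b, 0) g (y, 0)) (at 0)" using g(2) by simp
    then show ?thesis using DERIV_unique[OF DERIV_const] by metis
  qed
  have z: "(partial_deriv ?e ^^ m) D (y, 0) = 0" for m y
  proof (induction m arbitrary: y rule: less_induct)
    case (less m)
    consider "m = 0" | "m = 1" | j where "m = Suc (Suc j)" by (metis One_nat_def not0_implies_Suc)
    then show ?case
    proof cases
      case 3
      define g where "g = (partial_deriv ?e ^^ j) D"
      have g: "real_polynomial_function g" unfolding g_def by (rule poly_iterated[OF Dp])
      have "harmonic_poly g" unfolding g_def by (rule harmonic_poly_iterated[OF D(2)])
      then have "laplacian g (y, 0) = 0" by (rule harmonic_polyD(2))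
      moreover have g0: "g (y, 0) = 0" for y unfolding g_def by (rule less.IH) (simp add: 3)
      have "partial_deriv (b, 0) (partial_deriv (b, 0) g) (y, 0) = 0" for b
        by (rule tang[OF poly_partial_deriv[OF g] tang[OF g g0]])
      ultimately show ?thesis by (simp add: laplacian_prod 3 g_def)
    qed (use D0 D1 in simp_all)
  qed
  obtain y t where x: "x = (y, t)" by (cases x)
  define F where "F m s = (partial_deriv ?e ^^ m) D ((y, 0) + s *\<^sub>R ?e)" for m s
  have "\<forall>m s. (F m has_real_derivative F (Suc m) s) (at s)"
  proof (intro allI)
    fix m s
    show "(F m has_real_derivative F (Suc m) s) (at s)"
      unfolding F_def funpow.simps o_def
      by (rule partial_deriv_along) (rule poly_differentiable[OF poly_iterated[OF Dp]])
  qed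
  from Maclaurin_all_le[OF refl this, of t "Suc K"] obtain s where
    s: "F 0 t = (\<Sum>m<Suc K. F m 0 / fact m * t ^ m) + F (Suc K) s / fact (Suc K) * t ^ Suc K" by blast
  have "F m 0 = 0" for m using z by (simp add: F_def)
  moreover have "F (Suc K) s = 0"
  proof -
    have "homog_poly 0 ((partial_deriv ?e ^^ K) D)" using homog_poly_iterated[OF D(1), of K ?e] by simp
    from homog_poly_0_partial_deriv[OF this, of ?e] show ?thesis by (simp add: F_def)
  qed
  ultimately have "F 0 t = 0" using s by simp
  then show ?thesis by (simp add: F_def x)
qed

section \<open>Parametrisation of the eigenspaces\<close>

lemma hemisphere_determines_homog:
  fixes P :: "(real ^ 'n::finite) \<times> real \<Rightarrow> real"
  assumes P: "homog_poly K P" and z: "\<And>x. x \<in> hemisphere \<Longrightarrow> P x = 0" and x: "snd x > 0"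
  shows "P x = 0"
proof -
  have x0: "x \<noteq> 0" using x by auto
  then have "x /\<^sub>R norm x \<in> hemisphere" using x by (simp add: hemisphere_def)
  from z[OF this] show ?thesis using x0 by (simp add: homog_polyD(2)[OF P])
qed

definition hemi_restrict :: "((real ^ 'n::finite) \<times> real \<Rightarrow> real) \<Rightarrow> (real ^ 'n) \<times> real \<Rightarrow> real" where
  "hemi_restrict P x = (if x \<in> hemisphere then P x else 0)"

theorem eigenspace_dim:
  fixes K :: nat
  assumes K: "K \<ge> 1"
  defines "E \<equiv> dirichlet_eigenspace (real K * (real K + real CARD('n) - 1)) :: ((real ^ 'n::finite) \<times> real \<Rightarrow> real) set"
  shows "fun_space.dim E = (CARD('n) + K - 2) choose (CARD('n) - 1)"
proof -
  define B where "B = monomial ` (exponents (K - 1) :: (real ^ 'n \<Rightarrow> nat) set)"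
  note Bp = homog_poly_basis[of "K - 1", where 'a="real ^ 'n", folded B_def]
  define V where "V = {q :: real ^ 'n \<Rightarrow> real. homog_poly (K - 1) q}"
  define L where "L q = hemi_restrict (ck_ext K q)" for q :: "real ^ 'n \<Rightarrow> real"
  have VB: "fun_space.span B = V" using Bp(4) by (simp add: V_def)
  have V: "fun_space.subspace V" unfolding VB[symmetric] by (rule fun_space.subspace_span)
  have BV: "B \<subseteq> V" unfolding VB[symmetric] by (rule fun_space.span_superset)
  have Lscale: "L (\<lambda>x. c * f x) = (\<lambda>x. c * L f x)" if f: "f \<in> V" for f c
    using f ck_coeff_linear(2)[of "K - 1" f f c]
    by (auto simp: L_def hemi_restrict_def ck_ext_def V_def fun_eq_iff sum_distrib_left mult.left_commute)
  have Linj: "f = (\<lambda>x. 0)" if f: "f \<in> V" and Lf: "L f = (\<lambda>x. 0)" for f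
  proof -
    note h = ck_ext_homog_harmonic[of K f]
    have fh: "homog_poly (K - 1) f" using f by (simp add: V_def)
    have "ck_ext K f x = 0" if "x \<in> hemisphere" for x
      using fun_cong[OF Lf, of x] that by (simp add: L_def hemi_restrict_def)
    then have pos: "ck_ext K f x = 0" if "snd x > 0" for x
      using hemisphere_determines_homog[OF h(1)[OF fh]] that by blast
    have "f y = 0" for y
    proof -
      have "((\<lambda>s. ck_ext K f ((y, 0) + s *\<^sub>R (0, 1))) has_real_derivative
          partial_deriv (0, 1) (ck_ext K f) ((y, 0) + 0 *\<^sub>R (0, 1))) (at 0)"
        by (rule partial_deriv_along) (rule poly_differentiable[OF homog_polyD(1)[OF h(1)[OF fh]]])
      then have "((\<lambda>s. ck_ext K f (y, s)) has_real_derivative f y) (at 0)"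
        using ck_ext_data(2)[OF fh K] by simp
      \<comment> \<open>The extension is known to vanish only on the closed upper side, so the
        normal derivative is recovered from the one-sided difference quotient.\<close>
      then have "((\<lambda>s. (ck_ext K f (y, s) - ck_ext K f (y, 0)) / (s - 0)) \<longlongrightarrow> f y) (at_right 0)"
        by (auto simp: has_field_derivative_iff intro: tendsto_within_subset)
      moreover have "((\<lambda>s. (ck_ext K f (y, s) - ck_ext K f (y, 0)) / (s - 0)) \<longlongrightarrow> 0) (at_right 0)"
        by (rule tendsto_eventually)
           (auto simp: eventually_at_filter pos ck_ext_data(1)[OF fh K])
      ultimately show ?thesis using tendsto_unique[of "at_right (0::real)"] by fastforce
    qed
    then show ?thesis by auto
  qed
  have Ladd: "L (\<lambda>x. f x + g x) = (\<lambda>x. L f x + L g x)" if f: "f \<in> V" and g: "g \<in> V" for f g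
    using f g ck_coeff_linear(1)[of "K - 1" f g]
    by (auto simp: L_def hemi_restrict_def ck_ext_def V_def fun_eq_iff distrib_left sum.distrib)
  have I: "inj_on L B" "fun_space.independent (L ` B)" "L ` fun_space.span B = fun_space.span (L ` B)"
    by (rule linear_image_independent[where L=L and V=V and B=B]; fact V Ladd Lscale Linj Bp(1) BV Bp(3))+
  have "L ` V = E"
  proof
    show "L ` V \<subseteq> E"
    proof
      fix u assume "u \<in> L ` V"
      then obtain q where q: "homog_poly (K - 1) q" "u = L q" by (auto simp: V_def)
      show "u \<in> E"
        unfolding q(2) L_def hemi_restrict_def[abs_def] E_def
        by (rule harmonic_is_eigenfunction[OF ck_ext_homog_harmonic[OF q(1)] ck_ext_data(1)[OF q(1) K]])
    qed
    show "E \<subseteq> L ` V"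
    proof
      fix u assume u: "u \<in> E"
      show "u \<in> L ` V"
      proof (cases "u = (\<lambda>x. 0)")
        case True
        have "(\<lambda>y. 0) \<in> V" by (simp add: V_def)
        moreover have "L (\<lambda>y. 0) = (\<lambda>x. 0)"
          using ck_coeff_linear(2)[of "K - 1" "\<lambda>y::real^'n. 0" "\<lambda>y. 0" 0]
          by (auto simp: L_def hemi_restrict_def ck_ext_def fun_eq_iff)
        ultimately show ?thesis using True by (metis image_eqI)
      next
        case False
        obtain K' P where P: "K' \<ge> 1" "real K * (real K + real CARD('n) - 1) = real K' * (real K' + real CARD('n) - 1)"
          "homog_poly K' P" "harmonic_poly P" "\<And>x. snd x = 0 \<Longrightarrow> P x = 0" "u = hemi_restrict P"
          using eigenfunction_is_harmonic[OF u[unfolded E_def] False] unfolding hemi_restrict_def[abs_def] by blast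
        \<comment> \<open>The eigenvalue determines the degree: the difference of the two values
          factors, and the second factor is positive.\<close>
        have "(real K - real K') * (real K + real K' + real CARD('n) - 1) = 0"
          using P(2) by (simp add: algebra_simps)
        moreover have "real K + real K' + real CARD('n) - 1 > 0" using K P(1) by simp
        ultimately have "K' = K" by simp
        note P' = P(3-4)[unfolded \<open>K' = K\<close>]
        \<comment> \<open>The preimage of u is the normal derivative of P on the hyperplane; P and
          \<open>ck_ext K q\<close> then have the same Cauchy data.\<close>
        define q where "q y = partial_deriv (0, 1) P (y, 0)" for y
        have qp: "homog_poly (K - 1) (partial_deriv (0, 1) P)" by (rule homog_poly_partial_deriv'[OF P'(1)])
        have "bounded_linear (\<lambda>y :: real ^ 'n. (y, 0 :: real))"
          by (intro bounded_linear_Pair bounded_linear_ident bounded_linear_zero)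
        then have "real_polynomial_function q"
          unfolding q_def[abs_def] by (rule poly_comp_linear[OF homog_polyD(1)[OF qp]])
        moreover have "q (c *\<^sub>R y) = c ^ (K - 1) * q y" for c y
          using homog_polyD(2)[OF qp, of c "(y, 0)"] by (simp add: q_def)
        ultimately have q: "homog_poly (K - 1) q" by (simp add: homog_poly_def)
        note h = ck_ext_homog_harmonic[OF q]
        have "P x - ck_ext K q x = 0" for x
        proof (rule harmonic_cauchy_unique[OF homog_poly_diff[OF P'(1) h(1)] harmonic_poly_diff[OF P'(2) h(2)]])
          show "P (y, 0) - ck_ext K q (y, 0) = 0" for y
            using P(5)[of "(y, 0)"] ck_ext_data(1)[OF q K, of "(y, 0)"] by simp
          show "partial_deriv (0, 1) (\<lambda>x. P x - ck_ext K q x) (y, 0) = 0" for y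
            using iterated_diff[OF homog_polyD(1)[OF P'(1)] homog_polyD(1)[OF h(1)], of 1 "(0, 1)"]
              ck_ext_data(2)[OF q K, of y] by (simp add: q_def)
        qed
        then have "P = ck_ext K q" by auto
        then have "u = L q" by (simp add: P(6) L_def)
        then show ?thesis using q by (auto simp: V_def)
      qed
    qed
  qed
  then have "fun_space.span (L ` B) = E" by (simp only: I(3)[symmetric] VB)
  then have "fun_space.dim E = card (L ` B)"
    using fun_space.dim_span[of "L ` B"] fun_space.dim_eq_card_independent[OF I(2)] by simp
  also have "\<dots> = (K - 1 + CARD('n) - 1) choose (K - 1)"
    by (simp add: card_image[OF I(1)] Bp(2))
  also have "\<dots> = (CARD('n) + K - 2) choose (CARD('n) - 1)"
  proof -
    have n: "CARD('n) \<ge> 1" by (simp add: Suc_le_eq)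
    have "K - 1 + CARD('n) - 1 = CARD('n) + K - 2" using K n by simp
    moreover have "CARD('n) + K - 2 - (K - 1) = CARD('n) - 1" using K n by simp
    moreover have "K - 1 \<le> CARD('n) + K - 2" using K n by arith
    ultimately show ?thesis using binomial_symmetric[of "K - 1" "CARD('n) + K - 2"] by metis
  qed
  finally show ?thesis .
qed

section \<open>The eigenvalue list\<close>

definition chain_eigenvalue :: "nat \<Rightarrow> nat \<Rightarrow> real" where
  "chain_eigenvalue n K = real K * (real K + real n - 1)"

lemma chain_eigenvalue_strict_mono:
  assumes "n \<ge> 1" "i < j" shows "chain_eigenvalue n i < chain_eigenvalue n j"
proof -
  have "real i * (real i + real n - 1) \<le> real i * (real j + real n - 1)"
    using assms by (intro mult_left_mono) auto
  also have "\<dots> < real j * (real j + real n - 1)"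
    using assms by (intro mult_strict_right_mono) auto
  finally show ?thesis by (simp add: chain_eigenvalue_def)
qed

lemma dirichlet_eigenvalues_eq:
  fixes N :: "'n::finite itself"
  shows "dirichlet_eigenvalues N = chain_eigenvalue CARD('n) ` {1..}"
proof
  show "dirichlet_eigenvalues N \<subseteq> chain_eigenvalue CARD('n) ` {1..}"
  proof
    fix \<mu> assume "\<mu> \<in> dirichlet_eigenvalues N"
    then obtain u :: "(real ^ 'n) \<times> real \<Rightarrow> real" where "u \<in> dirichlet_eigenspace \<mu>" "u \<noteq> (\<lambda>x. 0)"
      unfolding dirichlet_eigenvalues_def by blast
    from eigenfunction_is_harmonic[OF this] obtain K where "K \<ge> 1" "\<mu> = real K * (real K + real CARD('n) - 1)"
      by blast
    then show "\<mu> \<in> chain_eigenvalue CARD('n) ` {1..}" by (simp add: chain_eigenvalue_def)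
  qed
  show "chain_eigenvalue CARD('n) ` {1..} \<subseteq> dirichlet_eigenvalues N"
  proof
    fix \<mu> assume "\<mu> \<in> chain_eigenvalue CARD('n) ` {1..}"
    then obtain K where K: "K \<ge> 1" "\<mu> = real K * (real K + real CARD('n) - 1)" by (auto simp: chain_eigenvalue_def)
    show "\<mu> \<in> dirichlet_eigenvalues N"
    \<comment> \<open>No eigenfunction is exhibited: a trivial eigenspace would have dimension 0,
      against the positive binomial coefficient.\<close>
    proof (rule ccontr)
      let ?E = "dirichlet_eigenspace \<mu> :: ((real ^ 'n) \<times> real \<Rightarrow> real) set"
      assume "\<mu> \<notin> dirichlet_eigenvalues N"
      then have "?E \<subseteq> {0}" unfolding dirichlet_eigenvalues_def zero_fun_def by blast
      then have "fun_space.span ?E \<subseteq> fun_space.span {0}" by (rule fun_space.span_mono)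
      then have "fun_space.span {} = fun_space.span ?E"
        using fun_space.span_zero[of ?E] by auto
      then have "fun_space.dim ?E = card ({} :: ((real ^ 'n) \<times> real \<Rightarrow> real) set)"
        by (rule fun_space.dim_eq_card) (rule fun_space.independent_empty)
      then have "(CARD('n) + K - 2) choose (CARD('n) - 1) = 0"
        using eigenspace_dim[OF K(1), where 'n='n] K(2) by simp
      then have "CARD('n) + K - 2 < CARD('n) - 1" by (simp add: binomial_eq_0_iff)
      then show False using K(1) by linarith
    qed
  qed
qed

lemma eigenvalue_mult_eq:
  fixes N :: "'n::finite itself"
  assumes "K \<ge> 1"
  shows "eigenvalue_mult N (chain_eigenvalue CARD('n) K) = chain_mult CARD('n) K"
  unfolding eigenvalue_mult_def chain_eigenvalue_def chain_mult_def by (rule eigenspace_dim[OF assms])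

lemma card_ge_1: "CARD('n::finite) \<ge> 1"
  by (simp add: Suc_le_eq)

lemma eigenvalue_count_eq:
  fixes N :: "'n::finite itself"
  shows "eigenvalue_count N \<mu> = (\<Sum>K | 1 \<le> K \<and> chain_eigenvalue CARD('n) K \<le> \<mu>. chain_mult CARD('n) K)"
proof -
  have inj: "inj_on (chain_eigenvalue CARD('n)) A" for A
    by (rule inj_onI) (metis card_ge_1 chain_eigenvalue_strict_mono less_irrefl linorder_neqE_nat)
  have "{\<nu> \<in> dirichlet_eigenvalues N. \<nu> \<le> \<mu>}
      = chain_eigenvalue CARD('n) ` {K. 1 \<le> K \<and> chain_eigenvalue CARD('n) K \<le> \<mu>}"
    unfolding dirichlet_eigenvalues_eq by auto
  then show ?thesis
    unfolding eigenvalue_count_def by (simp add: sum.reindex[OF inj] eigenvalue_mult_eq)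
qed

lemma k_minus_Suc: "K \<ge> 1 \<Longrightarrow> k_minus n (Suc K) = k_minus n K + chain_mult n K"
  by (simp add: k_minus_def)

text \<open>Up to the K-th distinct value exactly k_-(K+1) - 1 eigenvalues occur, and up to any
  smaller number at most k_-(K) - 1.\<close>

lemma hemi_eigenvalue_eq:
  fixes N :: "'n::finite itself"
  assumes K: "K \<ge> 1" and k: "k_minus CARD('n) K \<le> k" "k < k_minus CARD('n) (Suc K)"
  shows "hemi_eigenvalue N k = chain_eigenvalue CARD('n) K"
  unfolding hemi_eigenvalue_def
proof (rule Least_equality)
  have le: "chain_eigenvalue CARD('n) i \<le> chain_eigenvalue CARD('n) j \<longleftrightarrow> i \<le> j" for i j
    by (metis card_ge_1 chain_eigenvalue_strict_mono less_le_not_le linorder_le_less_linear order_refl order.order_iff_strict)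
  have "{i. 1 \<le> i \<and> chain_eigenvalue CARD('n) i \<le> chain_eigenvalue CARD('n) K} = {1..<Suc K}"
    unfolding le by auto
  then show "k \<le> eigenvalue_count N (chain_eigenvalue CARD('n) K)"
    using k(2) by (simp only: eigenvalue_count_eq k_minus_def)
  fix \<mu> assume \<mu>: "k \<le> eigenvalue_count N \<mu>"
  show "chain_eigenvalue CARD('n) K \<le> \<mu>"
  proof (rule ccontr)
    assume "\<not> ?thesis"
    then have "i < K" if "chain_eigenvalue CARD('n) i \<le> \<mu>" for i
      using that le[of K i] by linarith
    then have "{i. 1 \<le> i \<and> chain_eigenvalue CARD('n) i \<le> \<mu>} \<subseteq> {1..<K}" by auto
    then have "eigenvalue_count N \<mu> \<le> (\<Sum>i = 1..<K. chain_mult CARD('n) i)"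
      unfolding eigenvalue_count_eq by (intro sum_mono2) auto
    then show False using \<mu> k(1) by (simp add: k_minus_def)
  qed
qed

section \<open>Positions of the chains in the list\<close>

lemma chain_mult_pos: "n \<ge> 1 \<Longrightarrow> K \<ge> 1 \<Longrightarrow> chain_mult n K \<ge> 1"
  by (simp add: chain_mult_def Suc_le_eq)

lemma k_minus_ge: "K \<ge> 1 \<Longrightarrow> n \<ge> 1 \<Longrightarrow> K \<le> k_minus n K"
proof (induction K rule: nat_induct_at_least)
  case base
  show ?case by (simp add: k_minus_def)
next
  case (Suc K)
  then show ?case using chain_mult_pos[of n K] by (simp add: k_minus_Suc)
qed

text \<open>The last chain that starts no later than k; there is one because the K-th chain starts
  at K or later.\<close>

lemma chain_exists:
  assumes "n \<ge> 1" "k \<ge> 1"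
  shows "\<exists>K\<ge>1. k_minus n K \<le> k \<and> k < k_minus n (Suc K)"
proof -
  define S where "S = {K. 1 \<le> K \<and> k_minus n K \<le> k}"
  have "S \<subseteq> {..k}" using k_minus_ge[OF _ assms(1)] by (force simp: S_def)
  then have fin: "finite S" by (rule finite_subset) simp
  have "1 \<in> S" using assms(2) by (simp add: S_def k_minus_def)
  then have "Max S \<in> S" using fin by (intro Max_in) auto
  moreover have "Suc (Max S) \<notin> S" using Max_ge[OF fin, of "Suc (Max S)"] by auto
  ultimately show ?thesis by (intro exI[of _ "Max S"]) (auto simp: S_def)
qed

text \<open>Hockey-stick summation of the multiplicities, with Pascal's rule as the induction
  step.\<close>

lemma k_minus_binomial:
  assumes "n \<ge> 1" "K \<ge> 1" shows "k_minus n K = 1 + ((K - 1 + n - 1) choose n)"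
  using assms(2)
proof (induction K rule: nat_induct_at_least)
  case base
  show ?case using assms(1) by (simp add: k_minus_def)
next
  case (Suc K)
  obtain m where m: "n = Suc m" using assms(1) by (cases n) auto
  obtain j where j: "K = Suc j" using Suc(1) by (cases K) auto
  show ?case using Suc by (simp add: k_minus_Suc chain_mult_def m j add.commute)
qed

text \<open>For m = K - 1 the left side is n! (k_-(K) - 1). At m = 0 both sides vanish: the binomial
  because n - 1 < n, the product because of its factor i = 0.\<close>

lemma fact_binomial_prod:
  "fact n * real ((m + n - 1) choose n) = (\<Prod>i<n. real m + real i)" if "n \<ge> 1"
proof (cases m)
  case 0
  have z: "(\<Prod>i<n. real m + real i) = 0"
    by (rule prod_zero[OF finite_lessThan]) (use 0 that in \<open>auto intro!: bexI[of _ 0]\<close>)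
  have b: "(m + n - 1) choose n = 0" using 0 that by (intro binomial_eq_0) simp
  show ?thesis unfolding z b by simp
next
  case (Suc j)
  have "fact n * real ((j + n) choose n) = (\<Prod>i<n. real (Suc j) + real i)"
  proof (induction n)
    case (Suc n)
    have "real (Suc n) * real ((j + Suc n) choose Suc n) = real (Suc (j + n)) * real ((j + n) choose n)"
      unfolding of_nat_mult[symmetric] add_Suc_right by (simp only: Suc_times_binomial)
    then have "fact (Suc n) * real ((j + Suc n) choose Suc n) = (fact n * real ((j + n) choose n)) * real (Suc (j + n))"
      by (simp add: mult_ac del: of_nat_Suc binomial_Suc_Suc)
    then show ?case using Suc by simp
  qed simp
  then show ?thesis by (simp add: Suc)
qed

section \<open>The Weyl constant\<close>

lemma unit_ball_vol_rec: "x \<ge> 0 \<Longrightarrow> unit_ball_vol (x + 2) = 2 * pi / (x + 2) * unit_ball_vol x"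
proof -
  assume x: "x \<ge> 0"
  have g: "Gamma ((x + 2) / 2 + 1) = ((x + 2) / 2) * Gamma (x / 2 + 1)"
    using Gamma_plus1[of "x / 2 + 1"] x by (simp add: add_divide_distrib nonpos_Ints_def)
  have p: "pi powr ((x + 2) / 2) = pi * pi powr (x / 2)" by (simp add: add_divide_distrib powr_add)
  show ?thesis unfolding unit_ball_vol_def g p by simp
qed

text \<open>The second factor is the volume of the hemisphere, so this is the product in the Weyl
  constant. From n to n + 1 the volume for dimension n + 1 moves from the second factor to the
  first, and the recursion by two dimensions leaves the ratio 2 pi / (n + 1).\<close>

lemma unit_ball_vol_product:
  "unit_ball_vol (real n) * (real (Suc n) * unit_ball_vol (real (Suc n)) / 2) = (2 * pi) ^ n / fact n"
proof (induction n)
  case 0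
  show ?case by simp
next
  case (Suc n)
  have 1: "unit_ball_vol (real (Suc (Suc n))) = 2 * pi / (real n + 2) * unit_ball_vol (real n)"
    using unit_ball_vol_rec[of "real n"] by (simp add: add.commute)
  have "unit_ball_vol (real (Suc n)) * (real (Suc (Suc n)) * unit_ball_vol (real (Suc (Suc n))) / 2)
      = (2 * pi / real (Suc n)) * (unit_ball_vol (real n) * (real (Suc n) * unit_ball_vol (real (Suc n)) / 2))"
  proof -
    have alg: "a * (q * (t / q * b) / 2) = (t / r) * (b * (r * a / 2))" if "q \<noteq> 0" "r \<noteq> 0" for a b q r t :: real
      using that by simp
    have e: "real (Suc (Suc n)) = real n + 2" by simp
    show ?thesis unfolding 1 unfolding e by (rule alg) linarith+
  qed
  also have "\<dots> = (2 * pi / real (Suc n)) * ((2 * pi) ^ n / fact n)" unfolding Suc ..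
  also have "\<dots> = (2 * pi) ^ Suc n / fact (Suc n)" by simp
  finally show ?case .
qed

text \<open>The cone over the hemisphere is the upper half ball with the origin. The antipodal map
  carries it to its lower counterpart, and the separating disc is a null set, so its measure is half
  that of the ball.\<close>

lemma sphere_volume_hemisphere:
  "sphere_volume (hemisphere :: ((real ^ 'n::finite) \<times> real) set)
    = real (Suc CARD('n)) * unit_ball_vol (real (Suc CARD('n))) / 2"
proof -
  define S where "S = {x :: (real ^ 'n) \<times> real. norm x \<le> 1 \<and> snd x > 0} \<union> {0}"
  define T where "T = {x :: (real ^ 'n) \<times> real. norm x \<le> 1 \<and> snd x < 0} \<union> {0}"
  define Z where "Z = {x :: (real ^ 'n) \<times> real. norm x \<le> 1 \<and> snd x = 0}"
  have cone: "{r *\<^sub>R x | r x. 0 \<le> r \<and> r \<le> 1 \<and> x \<in> (hemisphere :: ((real ^ 'n) \<times> real) set)} = S"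
  proof
    show "{r *\<^sub>R x | r x. 0 \<le> r \<and> r \<le> 1 \<and> x \<in> (hemisphere :: ((real ^ 'n) \<times> real) set)} \<subseteq> S"
    proof
      fix y :: "(real ^ 'n) \<times> real" assume "y \<in> {r *\<^sub>R x | r x. 0 \<le> r \<and> r \<le> 1 \<and> x \<in> hemisphere}"
      then obtain r x where *: "y = r *\<^sub>R x" "0 \<le> r" "r \<le> 1" "norm x = 1" "snd x > 0"
        by (auto simp: hemisphere_def)
      then show "y \<in> S" by (cases "r = 0") (simp_all add: S_def)
    qed
    show "S \<subseteq> {r *\<^sub>R x | r x. 0 \<le> r \<and> r \<le> 1 \<and> x \<in> (hemisphere :: ((real ^ 'n) \<times> real) set)}"
    proof
      fix y assume y: "y \<in> S"
      show "y \<in> {r *\<^sub>R x | r x. 0 \<le> r \<and> r \<le> 1 \<and> x \<in> (hemisphere :: ((real ^ 'n) \<times> real) set)}"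
      proof (cases "y = 0")
        case True
        have "(0, 1) \<in> (hemisphere :: ((real ^ 'n) \<times> real) set)" by (simp add: hemisphere_def norm_prod_def)
        then show ?thesis unfolding True by (intro CollectI exI[of _ "0::real"] exI[of _ "(0, 1)"] conjI) (simp_all add: zero_prod_def)
      next
        case False
        then have "y /\<^sub>R norm y \<in> hemisphere" "norm y \<le> 1" using y by (simp_all add: hemisphere_def S_def)
        then show ?thesis using False by (intro CollectI exI[of _ "norm y"] exI[of _ "y /\<^sub>R norm y"]) simp
      qed
    qed
  qed
  have meas: "{x :: (real ^ 'n) \<times> real. norm x \<le> 1 \<and> snd x > 0} \<in> lmeasurable"
    "{x :: (real ^ 'n) \<times> real. norm x \<le> 1 \<and> snd x < 0} \<in> lmeasurable"
    "Z \<in> lmeasurable"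
  proof -
    have *: "cball 0 1 \<inter> A \<in> lmeasurable" if "A \<in> sets borel" for A :: "((real ^ 'n) \<times> real) set"
      using that by (intro fmeasurable_Int_fmeasurable lmeasurable_cball sets_completionI_sets) auto
    have "open {x :: (real ^ 'n) \<times> real. snd x < 0}" by (intro open_Collect_less continuous_intros)
    moreover have "closed {x :: (real ^ 'n) \<times> real. snd x = 0}" by (intro closed_Collect_eq continuous_intros)
    ultimately have "cball 0 1 \<inter> {x :: (real ^ 'n) \<times> real. snd x > 0} \<in> lmeasurable"
      "cball 0 1 \<inter> {x :: (real ^ 'n) \<times> real. snd x < 0} \<in> lmeasurable"
      "cball 0 1 \<inter> {x :: (real ^ 'n) \<times> real. snd x = 0} \<in> lmeasurable"
      using *[OF borel_open[OF open_upper]] *[OF borel_open] *[OF borel_closed] by blast+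
    then show "{x :: (real ^ 'n) \<times> real. norm x \<le> 1 \<and> snd x > 0} \<in> lmeasurable"
      "{x :: (real ^ 'n) \<times> real. norm x \<le> 1 \<and> snd x < 0} \<in> lmeasurable" "Z \<in> lmeasurable"
      by (simp_all add: Z_def Int_def)
  qed
  have ST: "S \<in> lmeasurable" "T \<in> lmeasurable"
    unfolding S_def T_def by (intro fmeasurable.Un meas negligible_imp_measurable[OF negligible_sing])+
  have "T = (\<lambda>x. (-1) *\<^sub>R x + 0) ` S"
  proof -
    have TS: "- x \<in> S \<longleftrightarrow> x \<in> T" for x unfolding S_def T_def by simp
    have "x \<in> (\<lambda>x. (-1) *\<^sub>R x + 0) ` S" if "x \<in> T" for x
      by (rule image_eqI[of _ _ "- x"]) (simp_all add: TS that)
    moreover have "(-1) *\<^sub>R x + 0 \<in> T" if "x \<in> S" for x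
      using TS[of "- x"] that by simp
    ultimately show ?thesis by blast
  qed
  then have mT: "measure lebesgue T = measure lebesgue S"
    using measure_lebesgue_affine[of "-1" "0 :: (real ^ 'n) \<times> real" S] by simp
  have "Z \<subseteq> {x. (0, 1) \<bullet> x = 0}" by (auto simp: Z_def)
  then have "negligible Z" using negligible_subset[OF negligible_hyperplane[of "(0 :: real ^ 'n, 1 :: real)" 0]] by (simp add: zero_prod_def)
  then have mZ: "measure lebesgue Z = 0" by (rule negligible_imp_measure0)
  have "measure lebesgue (cball (0 :: (real ^ 'n) \<times> real) 1) = measure lebesgue S + measure lebesgue T + measure lebesgue Z"
  proof (rule measure_Un3_negligible[OF ST meas(3)])
    have neg: "negligible A" if "A \<subseteq> {0}" for A :: "((real ^ 'n) \<times> real) set"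
      using negligible_subset[OF negligible_sing that] .
    show "negligible (S \<inter> T)" "negligible (S \<inter> Z)" "negligible (T \<inter> Z)"
      by (rule neg, auto simp: S_def T_def Z_def)+
    have "x \<in> S \<union> T \<union> Z \<longleftrightarrow> x \<in> cball 0 1" for x :: "(real ^ 'n) \<times> real"
      by (cases "snd x" "0::real" rule: linorder_cases) (auto simp: S_def T_def Z_def)
    then show "S \<union> T \<union> Z = cball 0 1" by blast
  qed
  then have "2 * measure lebesgue S = measure lborel (cball (0 :: (real ^ 'n) \<times> real) 1)"
    by (simp add: mT mZ)
  also have "\<dots> = unit_ball_vol (real (Suc CARD('n)))"
    by (simp add: content_cball)
  finally show ?thesis unfolding sphere_volume_def cone by simp
qed

lemma hemi_weyl_const_eq:
  fixes N :: "'n::finite itself"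
  shows "hemi_weyl_const N = fact CARD('n) powr (2 / real CARD('n))"
proof -
  define n where "n = CARD('n)"
  have n: "n \<ge> 1" unfolding n_def by (rule card_ge_1)
  have "((2 * pi) ^ n) powr (2 / real n) = (2 * pi) powr 2"
  proof -
    have "(2 * pi) ^ n = (2 * pi) powr real n" by (simp add: powr_realpow)
    then show ?thesis using n by (simp only: powr_powr) simp
  qed
  then have "((2 * pi) ^ n / fact n) powr (2 / real n) = (2 * pi)\<^sup>2 / fact n powr (2 / real n)"
    by (simp add: powr_divide)
  then show ?thesis
    unfolding hemi_weyl_const_def weyl_const_def sphere_volume_hemisphere unit_ball_vol_product n_def[symmetric]
    by (simp add: power_mult_distrib)
qed

section \<open>Bounds for rising products and the conclusion\<close>

lemma rising_bounds:
  fixes m :: real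
  assumes n: "n \<ge> 1" and m: "m \<ge> 0"
  defines "y \<equiv> (\<Prod>i<n. m + real i) powr (1 / real n)"
  shows "m \<le> y" "m * (m + real n - 1) \<le> y\<^sup>2" "y\<^sup>2 \<le> (m + (real n - 1) / 2)\<^sup>2" "0 \<le> y"
proof -
  define P where "P = (\<Prod>i<n. m + real i)"
  have P0: "P \<ge> 0" unfolding P_def using m by (intro prod_nonneg) auto
  show y0: "0 \<le> y" by (simp add: y_def)
  have yn: "y ^ n = P"
  proof (cases "P = 0")
    case True
    then show ?thesis using n by (simp add: y_def P_def[symmetric])
  next
    case False
    then have "P > 0" using P0 by simp
    then have "y ^ n = y powr real n" by (simp add: y_def P_def[symmetric] powr_realpow)
    also have "\<dots> = P" using n \<open>P > 0\<close> unfolding y_def P_def[symmetric] by (simp only: powr_powr) simp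
    finally show ?thesis .
  qed
  have "m ^ n = (\<Prod>i<n. m)" by simp
  also have "\<dots> \<le> P" unfolding P_def using m by (intro prod_mono) auto
  finally have "m ^ n \<le> y ^ n" by (simp add: yn)
  then show "m \<le> y" using y0 n m by (simp add: power_mono_iff)
  have P': "(\<Prod>i<n. m + real (n - Suc i)) = P" unfolding P_def by (rule prod.nat_diff_reindex)
  \<comment> \<open>Squaring pairs i with n - 1 - i without a special middle factor. Each pair
    equals m (m + n - 1) + i (n - 1 - i) and also (m + (n - 1)/2)^2 minus the square of i - (n -
    1)/2, which gives both bounds factor by factor.\<close>
  have "(y\<^sup>2) ^ n = (y ^ n)\<^sup>2" by (simp only: power_mult[symmetric] mult.commute)
  also have "\<dots> = (\<Prod>i<n. (m + real i) * (m + real (n - Suc i)))"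
    unfolding prod.distrib P' yn by (simp add: power2_eq_square P_def)
  also have "\<dots> = (\<Prod>i<n. (m + real i) * (m + (real n - 1 - real i)))"
    by (intro prod.cong refl) (simp add: of_nat_diff Suc_leI)
  finally have y2: "(y\<^sup>2) ^ n = (\<Prod>i<n. (m + real i) * (m + (real n - 1 - real i)))" .
  have "(m * (m + real n - 1)) ^ n \<le> (y\<^sup>2) ^ n"
  proof -
    have "(\<Prod>i<n. m * (m + real n - 1)) \<le> (\<Prod>i<n. (m + real i) * (m + (real n - 1 - real i)))"
    proof (intro prod_mono conjI)
      fix i assume "i \<in> {..<n}"
      then have "real i * (real n - 1 - real i) \<ge> 0" by (intro mult_nonneg_nonneg) auto
      moreover have "(m + real i) * (m + (real n - 1 - real i)) = m * (m + real n - 1) + real i * (real n - 1 - real i)"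
        by (simp add: algebra_simps)
      ultimately show "m * (m + real n - 1) \<le> (m + real i) * (m + (real n - 1 - real i))" by simp
      show "0 \<le> m * (m + real n - 1)" using m n by simp
    qed
    then show ?thesis by (simp add: y2)
  qed
  then show "m * (m + real n - 1) \<le> y\<^sup>2" using n m by (simp add: power_mono_iff)
  have "(y\<^sup>2) ^ n \<le> ((m + (real n - 1) / 2)\<^sup>2) ^ n"
  proof -
    have "(\<Prod>i<n. (m + real i) * (m + (real n - 1 - real i))) \<le> (\<Prod>i<n. (m + (real n - 1) / 2)\<^sup>2)"
    proof (intro prod_mono conjI)
      fix i assume i: "i \<in> {..<n}"
      show "0 \<le> (m + real i) * (m + (real n - 1 - real i))" using i m by (intro mult_nonneg_nonneg) auto
      have "(m + (real n - 1) / 2)\<^sup>2 - (m + real i) * (m + (real n - 1 - real i)) = (real i - (real n - 1) / 2)\<^sup>2"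
        by (simp add: power2_eq_square field_simps)
      then show "(m + real i) * (m + (real n - 1 - real i)) \<le> (m + (real n - 1) / 2)\<^sup>2"
        using zero_le_power2[of "real i - (real n - 1) / 2"] by linarith
    qed
    then show ?thesis by (simp add: y2)
  qed
  then show "y\<^sup>2 \<le> (m + (real n - 1) / 2)\<^sup>2" using n by (simp add: power_mono_iff)
qed

theorem theorem3:
  fixes N :: "'n::finite itself" and n :: nat and lam :: "nat \<Rightarrow> real" and C :: real
  assumes n: "n = CARD('n)" "n \<ge> 2"
    and lam: "lam = hemi_eigenvalue N"
    and C: "C = hemi_weyl_const N"
  shows "(\<forall>k\<ge>1. lam k \<le> C * (real k - 1) powr (2 / real n)
                        + 2 * sqrt C * (real k - 1) powr (1 / real n) + real n) \<and>
         lam 1 = C * (real 1 - 1) powr (2 / real n)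
                 + 2 * sqrt C * (real 1 - 1) powr (1 / real n) + real n \<and>
         ((\<lambda>K. (lam (k_minus n K) - C * (real (k_minus n K) - 1) powr (2 / real n))
               / (2 * sqrt C * (real (k_minus n K) - 1) powr (1 / real n))) \<longlonglongrightarrow> 1)"
proof -
  have n1: "n \<ge> 1" using n(2) by simp
  \<comment> \<open>In terms of \<open>y\<close> the two Weyl terms are y^2 and 2 y.\<close>
  define y where "y k = (fact n * (real k - 1)) powr (1 / real n)" for k :: nat
  define Y where "Y K = (\<Prod>i<n. real (K - 1) + real i) powr (1 / real n)" for K :: nat
  have Ceq: "C = fact n powr (2 / real n)" using C hemi_weyl_const_eq[of N] n(1) by simp
  have sqrtC: "sqrt C = fact n powr (1 / real n)"
    unfolding Ceq by (simp add: powr_half_sqrt[symmetric] powr_powr)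
  have t1: "2 * sqrt C * (real k - 1) powr (1 / real n) = 2 * y k" if "k \<ge> 1" for k
    using that by (simp add: sqrtC y_def powr_mult)
  have t2: "C * (real k - 1) powr (2 / real n) = (y k)\<^sup>2" if "k \<ge> 1" for k
  proof -
    have "(y k)\<^sup>2 = (fact n * (real k - 1)) powr (2 / real n)"
      unfolding y_def by (simp add: power2_eq_square powr_add[symmetric])
    then show ?thesis using that by (simp add: Ceq powr_mult)
  qed
  have yK: "y (k_minus n K) = Y K" if "K \<ge> 1" for K
    unfolding y_def Y_def using fact_binomial_prod[OF n1, of "K - 1"] by (simp add: k_minus_binomial[OF n1 that])
  \<comment> \<open>Reduces the inequality on a chain to its lowest index.\<close>
  have mono: "y k \<le> y k'" if "1 \<le> k" "k \<le> k'" for k k'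
    unfolding y_def using that by (intro powr_mono2) auto
  have lamK: "lam k = chain_eigenvalue n K" if "K \<ge> 1" "k_minus n K \<le> k" "k < k_minus n (Suc K)" for K k
    using hemi_eigenvalue_eq[of K k N] that unfolding lam n(1) by blast
  have k1: "k_minus n K \<ge> 1" for K by (simp add: k_minus_def)
  have kS: "k_minus n K < k_minus n (Suc K)" if "K \<ge> 1" for K
    using chain_mult_pos[OF n1 that] by (simp add: k_minus_Suc[OF that])
  note bounds = rising_bounds[OF n1, of "real (K - 1)" for K, folded Y_def]
  have ev: "chain_eigenvalue n K = (real (K - 1) + 1) * (real (K - 1) + real n)" if "K \<ge> 1" for K
    using that by (simp add: chain_eigenvalue_def of_nat_diff)
  have "lam k \<le> (y k)\<^sup>2 + 2 * y k + real n" if k: "k \<ge> 1" for k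
  proof -
    obtain K where K: "K \<ge> 1" "k_minus n K \<le> k" "k < k_minus n (Suc K)" using chain_exists[OF n1 k] by blast
    define m where "m = real (K - 1)"
    have Y: "m \<le> Y K" "m * (m + real n - 1) \<le> (Y K)\<^sup>2" "0 \<le> Y K" using bounds[of K] by (auto simp: m_def)
    have "lam k = (m + 1) * (m + real n)" unfolding lamK[OF K] ev[OF K(1)] m_def ..
    also have "\<dots> = m * (m + real n - 1) + 2 * m + real n" by (simp add: algebra_simps)
    also have "\<dots> \<le> (Y K)\<^sup>2 + 2 * Y K + real n" using Y by simp
    also have "\<dots> \<le> (y k)\<^sup>2 + 2 * y k + real n"
      using mono[OF k1 K(2)] Y(3) unfolding yK[OF K(1)] by (intro add_mono mult_left_mono power_mono) auto
    finally show ?thesis .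
  qed
  moreover have "lam 1 = real n"
    using lamK[of 1 1] kS[of 1] by (simp add: k_minus_def chain_eigenvalue_def)
  moreover have "(\<lambda>K. (lam (k_minus n K) - (y (k_minus n K))\<^sup>2) / (2 * y (k_minus n K))) \<longlonglongrightarrow> 1"
  proof -
    \<comment> \<open>The constant for which (m + 1) (m + n) - (m + (n - 1)/2)^2 = 2 m + d.\<close>
    define d where "d = real n - ((real n - 1) / 2)\<^sup>2"
    define f where "f K = (lam (k_minus n K) - (y (k_minus n K))\<^sup>2) / (2 * y (k_minus n K))" for K
    have lim1: "(\<lambda>K. (2 * (real K - 1) + d) / (2 * (real K - 1) + (real n - 1))) \<longlonglongrightarrow> 1" by real_asymp
    have lim2: "(\<lambda>K. (2 * (real K - 1) + real n) / (2 * (real K - 1))) \<longlonglongrightarrow> 1" by real_asymp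
    \<comment> \<open>For K \<ge> K0 and m = K - 1 this gives m \<ge> 1 and 2 m + d \<ge> 0, so that
      enlarging the denominator lowers the quotient in the lower bound.\<close>
    obtain K0 :: nat where K0: "real K0 \<ge> \<bar>d\<bar> + 2" using real_arch_simple by blast
    have both: "(2 * (real K - 1) + d) / (2 * (real K - 1) + (real n - 1)) \<le> f K \<and>
        f K \<le> (2 * (real K - 1) + real n) / (2 * (real K - 1))" if K: "K \<ge> K0" for K
    proof -
      define m where "m = real K - 1"
      have K2: "real K \<ge> \<bar>d\<bar> + 2" using K K0 by linarith
      then have K1: "K \<ge> 1" by linarith
      have m: "m \<ge> 1" "2 * m + d \<ge> 0" using K2 by (auto simp: m_def abs_if split: if_splits)
      have mK: "real (K - 1) = m" using K1 by (simp add: m_def of_nat_diff)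
      note b = bounds[of K, unfolded mK]
      have Y: "m \<le> Y K" "m * (m + real n - 1) \<le> (Y K)\<^sup>2" "(Y K)\<^sup>2 \<le> (m + (real n - 1) / 2)\<^sup>2" "0 \<le> Y K"
        using b m by auto
      have Yup: "Y K \<le> m + (real n - 1) / 2"
        by (rule power2_le_imp_le[OF Y(3)]) (use m n1 in simp)
      have "f K = ((m + 1) * (m + real n) - (Y K)\<^sup>2) / (2 * Y K)"
        unfolding f_def yK[OF K1] lamK[OF K1 order_refl kS[OF K1]] ev[OF K1] mK ..
      moreover have "(m + 1) * (m + real n) - (Y K)\<^sup>2 \<le> 2 * m + real n" using Y(2) by (simp add: algebra_simps)
      moreover have "2 * m + d \<le> (m + 1) * (m + real n) - (Y K)\<^sup>2"
      proof -
        have "(m + (real n - 1) / 2)\<^sup>2 = (m + 1) * (m + real n) - (2 * m + d)"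
          unfolding d_def by (simp add: power2_eq_square field_simps)
        then show ?thesis using Y(3) by linarith
      qed
      moreover have "2 * Y K \<le> 2 * m + (real n - 1)" using Yup by (simp add: field_simps)
      then have "(2 * m + d) / (2 * m + (real n - 1)) \<le> (2 * m + d) / (2 * Y K)"
        using m Y(1) n1 by (intro divide_left_mono) (auto intro!: mult_pos_pos)
      moreover have "(2 * m + real n) / (2 * Y K) \<le> (2 * m + real n) / (2 * m)"
        using m Y(1) by (intro divide_left_mono) auto
      ultimately show ?thesis
        unfolding m_def[symmetric] using m Y(1)
        by (smt (verit, best) divide_right_mono)
    qed
    have "f \<longlonglongrightarrow> 1"
      by (rule tendsto_sandwich[OF _ _ lim1 lim2]) (use both in \<open>auto simp: eventually_sequentially\<close>)
    then show ?thesis unfolding f_def .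
  qed
  ultimately show ?thesis
    using n1 k1 by (simp add: t1 t2)
qed

end
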